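(* There is a set $E\subset\big(\frac1{\sqrt3},+\infty\big)$ with at most one element such that, for every $a\in(0,+\infty)\setminus E$, the ellipsoid $\mathbb S^3_a$ contains infinitely many pairwise noncongruent $\mathsf S^1$-invariant immersed minimal tori. If $a\in\big(0,\frac1{\sqrt3}\big)$, then at least one of these minimal tori is embedded and not congruent to the Clifford torus $\Sigma_a$.
   Context: For $a>0$, $\mathbb S^3_a=\{(z,w)\in\mathbb C^2: |z|^2/a^2+|w|^2=1\}$ with the Riemannian metric induced from $\mathbb C^2=\mathbb R^4$. The torus $\mathsf S^1\times\mathsf S^1$ acts isometrically on $\mathbb S^3_a$, the first factor by multiplication of $z$ by unit complex numbers, the second by multiplication of $w$. $\mathsf S^1$-invariant means invariant under the circle $\{1\}\times\mathsf S^1$. The Clifford torus is $\Sigma_a=\{(z,w)\in\mathbb S^3_a: |z|^2/a^2=|w|^2=\frac12\}$. Two immersed tori in $\mathbb S^3_a$ are congruent if some isometry of $\mathbb S^3_a$ maps the image of one onto the image of the other. *)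

theory Defs
  imports "HOL-Analysis.Analysis"
begin

text \<open>\<open>C\<^sup>2\<close> is \<^typ>\<open>complex \<times> complex\<close>, whose library inner product is the Euclidean one of
  \<open>R\<^sup>4\<close>.\<close>

text \<open>\<open>C\<^sup>k\<close> maps on a set \<open>U\<close>, intended for open \<open>U\<close>.\<close>

fun Ck_on :: "nat \<Rightarrow> 'a::real_normed_vector set \<Rightarrow> ('a \<Rightarrow> 'b::real_normed_vector) \<Rightarrow> bool" where
  "Ck_on 0 U f \<longleftrightarrow> continuous_on U f"
| "Ck_on (Suc k) U f \<longleftrightarrow> (\<forall>x\<in>U. f differentiable (at x)) \<and>
     (\<forall>v. Ck_on k U (\<lambda>x. frechet_derivative f (at x) v))"

definition smooth_on :: "'a::real_normed_vector set \<Rightarrow> ('a \<Rightarrow> 'b::real_normed_vector) \<Rightarrow> bool" where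
  "smooth_on U f \<longleftrightarrow> (\<forall>k. Ck_on k U f)"

text \<open>Smoothness of a map given only on a (not necessarily open) subset: local existence of smooth
  extensions.\<close>

definition smooth_on_subset ::
    "'a::real_normed_vector set \<Rightarrow> ('a \<Rightarrow> 'b::real_normed_vector) \<Rightarrow> bool" where
  "smooth_on_subset S f \<longleftrightarrow>
     (\<forall>p\<in>S. \<exists>U F. open U \<and> p \<in> U \<and> smooth_on U F \<and> (\<forall>q\<in>S \<inter> U. F q = f q))"

definition ellipsoid :: "real \<Rightarrow> (complex \<times> complex) set" where
  "ellipsoid a = {(z, w). (cmod z)\<^sup>2 / a\<^sup>2 + (cmod w)\<^sup>2 = 1}"

text \<open>The kernel of the differential of the defining function of the ellipsoid.\<close>

definition ellipsoid_tangent :: "real \<Rightarrow> complex \<times> complex \<Rightarrow> (complex \<times> complex) set" where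
  "ellipsoid_tangent a p = {v. (fst p \<bullet> fst v) / a\<^sup>2 + snd p \<bullet> snd v = 0}"

text \<open>Riemannian isometries. The derivative \<open>D\<close> of \<open>\<phi>\<close> at \<open>p\<close> within the ellipsoid is uniquely
  determined on the tangent space, where it is the differential of \<open>\<phi>\<close>.\<close>

definition ellipsoid_isometry ::
    "real \<Rightarrow> (complex \<times> complex \<Rightarrow> complex \<times> complex) \<Rightarrow> bool" where
  "ellipsoid_isometry a \<phi> \<longleftrightarrow>
     bij_betw \<phi> (ellipsoid a) (ellipsoid a) \<and>
     smooth_on_subset (ellipsoid a) \<phi> \<and>
     smooth_on_subset (ellipsoid a) (inv_into (ellipsoid a) \<phi>) \<and>
     (\<forall>p\<in>ellipsoid a. \<exists>D. (\<phi> has_derivative D) (at p within ellipsoid a) \<and>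
        (\<forall>v\<in>ellipsoid_tangent a p. \<forall>w\<in>ellipsoid_tangent a p. D v \<bullet> D w = v \<bullet> w))"

definition congruent_in_ellipsoid ::
    "real \<Rightarrow> (complex \<times> complex) set \<Rightarrow> (complex \<times> complex) set \<Rightarrow> bool" where
  "congruent_in_ellipsoid a A B \<longleftrightarrow> (\<exists>\<phi>. ellipsoid_isometry a \<phi> \<and> \<phi> ` A = B)"

text \<open>Maps on the torus \<open>R\<^sup>2/Z\<^sup>2\<close> are represented by \<open>Z\<^sup>2\<close>-periodic maps on \<open>R\<^sup>2\<close>.\<close>

definition same_torus_point :: "real \<times> real \<Rightarrow> real \<times> real \<Rightarrow> bool" where
  "same_torus_point x y \<longleftrightarrow> fst x - fst y \<in> \<int> \<and> snd x - snd y \<in> \<int>"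

definition immersed_torus :: "real \<Rightarrow> (real \<times> real \<Rightarrow> complex \<times> complex) \<Rightarrow> bool" where
  "immersed_torus a f \<longleftrightarrow>
     (\<forall>x y. same_torus_point x y \<longrightarrow> f x = f y) \<and>
     range f \<subseteq> ellipsoid a \<and>
     smooth_on UNIV f \<and>
     (\<forall>x. inj (frechet_derivative f (at x)))"

text \<open>By compactness of the torus, an injective immersion is an embedding.\<close>

definition embedded_torus :: "real \<Rightarrow> (real \<times> real \<Rightarrow> complex \<times> complex) \<Rightarrow> bool" where
  "embedded_torus a f \<longleftrightarrow> immersed_torus a f \<and> (\<forall>x y. f x = f y \<longrightarrow> same_torus_point x y)"

definition du :: "(real \<times> real \<Rightarrow> complex \<times> complex) \<Rightarrow> real \<times> real \<Rightarrow> complex \<times> complex" where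
  "du f x = frechet_derivative f (at x) (1, 0)"

definition dv :: "(real \<times> real \<Rightarrow> complex \<times> complex) \<Rightarrow> real \<times> real \<Rightarrow> complex \<times> complex" where
  "dv f x = frechet_derivative f (at x) (0, 1)"

definition unit_normal ::
    "real \<Rightarrow> (real \<times> real \<Rightarrow> complex \<times> complex) \<Rightarrow> real \<times> real \<Rightarrow> complex \<times> complex \<Rightarrow> bool" where
  "unit_normal a f x n \<longleftrightarrow>
     n \<in> ellipsoid_tangent a (f x) \<and> norm n = 1 \<and> n \<bullet> du f x = 0 \<and> n \<bullet> dv f x = 0"

text \<open>Half the trace of the second fundamental form with respect to the first one. The Levi-Civita
  connection of the ellipsoid is the tangential part of the flat one and \<open>n\<close> is tangent to the
  ellipsoid, so the coefficients of the second fundamental form in the ellipsoid are the inner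
  products of \<open>n\<close> with the second partial derivatives of \<open>f\<close>.\<close>

definition mean_curvature ::
    "(real \<times> real \<Rightarrow> complex \<times> complex) \<Rightarrow> real \<times> real \<Rightarrow> complex \<times> complex \<Rightarrow> real" where
  "mean_curvature f x n =
     ((dv f x \<bullet> dv f x) * (du (du f) x \<bullet> n)
       - 2 * (du f x \<bullet> dv f x) * (du (dv f) x \<bullet> n)
       + (du f x \<bullet> du f x) * (dv (dv f) x \<bullet> n))
     / (2 * ((du f x \<bullet> du f x) * (dv f x \<bullet> dv f x) - (du f x \<bullet> dv f x)\<^sup>2))"

definition minimal_torus :: "real \<Rightarrow> (real \<times> real \<Rightarrow> complex \<times> complex) \<Rightarrow> bool" where
  "minimal_torus a f \<longleftrightarrow>
     immersed_torus a f \<and> (\<forall>x n. unit_normal a f x n \<longrightarrow> mean_curvature f x n = 0)"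

definition torus_action :: "complex \<times> complex \<Rightarrow> complex \<times> complex \<Rightarrow> complex \<times> complex" where
  "torus_action g p = (fst g * fst p, snd g * snd p)"

definition S1_invariant :: "(complex \<times> complex) set \<Rightarrow> bool" where
  "S1_invariant A \<longleftrightarrow> (\<forall>g \<in> {1} \<times> sphere 0 1. torus_action g ` A = A)"

definition clifford_torus :: "real \<Rightarrow> (complex \<times> complex) set" where
  "clifford_torus a =
     {(z, w). (z, w) \<in> ellipsoid a \<and> (cmod z)\<^sup>2 / a\<^sup>2 = 1 / 2 \<and> (cmod w)\<^sup>2 = 1 / 2}"

end

theory Submission imports Defs "HOL-Library.Ramsey" begin

text \<open>
  An \<open>S\<^sup>1\<close>-invariant minimal surface is generated by a geodesic of the disc \<open>|z| < a\<close> with the metric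
  of the orbit space rescaled by the squared orbit length. This metric is rotationally symmetric, so a
  geodesic oscillates between two circles while turning, and it closes up iff the angle
  swept during one oscillation is a rational multiple of \<open>2\<pi>\<close>. As a function of the Clairaut
  constant this angle is continuous; it equals \<open>\<pi> sqrt (1 + 1/a\<^sup>2)\<close> for the
  Clifford torus and tends to \<open>\<pi>\<close> for geodesics through the centre, hence takes all values in between,
  for every \<open>a\<close>. If \<open>a < 1 / sqrt 3\<close>, then \<open>2\<pi>\<close> is among them and gives an embedded torus.

  Isometries of the ellipsoid are bi-Lipschitz for the chordal distance with a constant that depends
  only on \<open>a\<close>. The tori with sweep angle \<open>2\<pi> p / 2\<^sup>n\<close>, \<open>p\<close> odd, become dense in a fixed open set as \<open>n\<close>
  grows, so by compactness only finitely many of them are congruent to a given closed set without interior;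
  Ramsey's theorem then yields an infinite pairwise noncongruent family. The Clifford torus is flat,
  which distinguishes it from the embedded torus found above.
\<close>

subsection \<open>Smooth maps\<close>

text \<open>The exceptional set is taken empty: pi * sqrt (1 + 1 / a^2) exceeds pi for every a, so
  the interval of attained sweep angles never degenerates. The threshold 1 / sqrt 3 is the a at
  which this value equals 2 pi. Sweep angle 2 pi means one turn per oscillation, and then
  injectivity follows because the angle is strictly increasing. The obstacle is noncongruence. The
  isometry group depends on a (it is much larger at a = 1), so nothing relies on its description;
  only a uniform Lipschitz bound enters. An odd number over a power of two is in lowest terms, so
  the torus passes each level of |z| within its range along a full grid of angles; a lower bound on
  the amplitude of the oscillation makes all these grids fill one common region. The oscillation is
  parametrized by a phase rather than by arc length. This removes the singularities of the sweep
  integral at the turning points, so smoothness of the torus and continuity of the sweep angle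
  concern one regular integrand. No curvature is defined: flatness of the Clifford torus enters
  through the differentials of arc length on its two circles.\<close>

lemma Ck_on_cong:
  assumes "open U" "\<And>x. x \<in> U \<Longrightarrow> f x = g x"
  shows "Ck_on k U f \<longleftrightarrow> Ck_on k U g"
  using assms(2)
proof (induction k arbitrary: f g)
  case 0
  then show ?case by (simp cong: continuous_on_cong)
next
  case (Suc k)
  have diff: "f differentiable (at x) \<longleftrightarrow> g differentiable (at x)" if "x \<in> U" for x
    using that Suc.prems assms(1) unfolding differentiable_def
    by (metis has_derivative_transform_within_open)
  have eq: "frechet_derivative f (at x) v = frechet_derivative g (at x) v"
    if "f differentiable (at x)" "x \<in> U" for x v
    using frechet_derivative_transform_within_open[OF that(1) assms(1) that(2), of g] Suc.prems
    by metis
  show ?case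
  proof (cases "\<forall>x\<in>U. f differentiable (at x)")
    case True
    then show ?thesis using Suc.IH[of "\<lambda>x. frechet_derivative f (at x) v"
        "\<lambda>x. frechet_derivative g (at x) v" for v] eq diff by simp
  qed (use diff in auto)
qed

lemma Ck_on_mono: "Ck_on k U f \<Longrightarrow> V \<subseteq> U \<Longrightarrow> Ck_on k V f"
  by (induction k arbitrary: f) (auto intro: continuous_on_subset)

lemma Ck_on_local:
  assumes "\<And>x. x \<in> U \<Longrightarrow> \<exists>V. open V \<and> x \<in> V \<and> Ck_on k V f"
  shows "Ck_on k U f"
  using assms
proof (induction k arbitrary: f)
  case 0
  have "continuous (at x within U) f" if x: "x \<in> U" for x
  proof -
    obtain V where "open V" "x \<in> V" "continuous_on V f" using 0 x by auto
    then have "isCont f x" by (simp add: continuous_on_eq_continuous_at)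
    then show ?thesis by (rule continuous_at_imp_continuous_within)
  qed
  then show ?case by (simp add: continuous_on_eq_continuous_within)
next
  case (Suc k)
  show ?case
  proof (simp, intro conjI ballI allI)
    show "f differentiable at x" if "x \<in> U" for x using Suc.prems[OF that] by auto
    show "Ck_on k U (\<lambda>x. frechet_derivative f (at x) v)" for v
    proof (rule Suc.IH)
      fix x assume "x \<in> U"
      then obtain V where "open V" "x \<in> V" "Ck_on (Suc k) V f" using Suc.prems by blast
      then show "\<exists>V. open V \<and> x \<in> V \<and> Ck_on k V (\<lambda>x. frechet_derivative f (at x) v)" by auto
    qed
  qed
qed

lemma Ck_on_SucD: "Ck_on (Suc k) U f \<Longrightarrow> Ck_on k U f"
proof (induction k arbitrary: f)
  case 0
  then show ?case
    by (simp add: continuous_at_imp_continuous_on differentiable_imp_continuous_within)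
qed auto

lemma Ck_on_SucI:
  assumes "\<And>x. x \<in> U \<Longrightarrow> (f has_derivative f' x) (at x)"
    and "open U" "\<And>v. Ck_on k U (\<lambda>x. f' x v)"
  shows "Ck_on (Suc k) U f"
proof -
  have "Ck_on k U (\<lambda>x. frechet_derivative f (at x) v)" for v
    using Ck_on_cong[OF assms(2), of "\<lambda>x. frechet_derivative f (at x) v" "\<lambda>x. f' x v"]
      assms(1,3) frechet_derivative_at by metis
  then show ?thesis using assms(1) by (auto intro: differentiableI)
qed

lemma Ck_on_const: "Ck_on k U (\<lambda>x. c)"
  by (induction k arbitrary: c) auto

lemma Ck_on_linear:
  assumes "bounded_linear f" shows "Ck_on k U f"
proof (cases k)
  case 0
  then show ?thesis using assms by (simp add: linear_continuous_on)
next
  case (Suc n)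
  have "frechet_derivative f (at x) = f" for x
    using assms frechet_derivative_at bounded_linear_imp_has_derivative by metis
  then show ?thesis using assms Suc
    by (auto simp: Ck_on_const intro: bounded_linear_imp_differentiable)
qed

lemma Ck_on_linear_compose:
  assumes "bounded_linear h" "open U" "Ck_on k U f" shows "Ck_on k U (\<lambda>x. h (f x))"
  using assms(3)
proof (induction k arbitrary: f)
  case 0
  then show ?case using bounded_linear.continuous_on[OF assms(1)] by simp
next
  case (Suc k)
  show ?case
    by (rule Ck_on_SucI[where f' = "\<lambda>x v. h (frechet_derivative f (at x) v)"])
      (use Suc assms(2) in \<open>auto intro!: bounded_linear.has_derivative[OF assms(1)]
        simp: frechet_derivative_works[symmetric]\<close>)
qed

lemma Ck_on_add:
  assumes "open U" "Ck_on k U f" "Ck_on k U g" shows "Ck_on k U (\<lambda>x. f x + g x)"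
  using assms(2,3)
proof (induction k arbitrary: f g)
  case 0
  then show ?case by (simp add: continuous_on_add)
next
  case (Suc k)
  show ?case
    by (rule Ck_on_SucI[where f' = "\<lambda>x v. frechet_derivative f (at x) v + frechet_derivative g (at x) v"])
      (use Suc assms(1) in \<open>auto intro!: derivative_eq_intros simp: frechet_derivative_works[symmetric]\<close>)
qed

lemma Ck_on_sum:
  assumes "open U" "finite I" "\<And>i. i \<in> I \<Longrightarrow> Ck_on k U (f i)"
  shows "Ck_on k U (\<lambda>x. \<Sum>i\<in>I. f i x)"
  using assms(2,3) by (induction I) (auto intro: Ck_on_const Ck_on_add[OF assms(1)])

lemma Ck_on_bilinear:
  assumes "bounded_bilinear pr" "open U" "Ck_on k U f" "Ck_on k U g"
  shows "Ck_on k U (\<lambda>x. pr (f x) (g x))"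
  using assms(3,4)
proof (induction k arbitrary: f g)
  case 0
  then show ?case using bounded_bilinear.continuous_on[OF assms(1)] by simp
next
  case (Suc k)
  have "Ck_on k U (\<lambda>x. pr (f x) (frechet_derivative g (at x) v) + pr (frechet_derivative f (at x) v) (g x))" for v
    using Suc.prems Ck_on_SucD[OF Suc.prems(1)] Ck_on_SucD[OF Suc.prems(2)]
    by (intro Ck_on_add[OF assms(2)] Suc.IH) simp_all
  moreover have "((\<lambda>x. pr (f x) (g x)) has_derivative (\<lambda>v. pr (f x) (frechet_derivative g (at x) v) +
      pr (frechet_derivative f (at x) v) (g x))) (at x)" if "x \<in> U" for x
    by (rule bounded_bilinear.FDERIV[OF assms(1)])
      (use Suc.prems that in \<open>simp_all add: frechet_derivative_works[symmetric]\<close>)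
  ultimately show ?case using assms(2) by (rule Ck_on_SucI[rotated 2]) 
qed

text \<open>\<open>Ck_on\<close> controls the derivative of \<open>F\<close> only in fixed
  directions, while the chain rule applies it to the moving vector \<open>f' x v\<close>. Expanding
  this vector in an orthonormal basis turns the derivative into a sum of products to which the
  induction hypothesis applies; this is why the middle space is Euclidean.\<close>

lemma Ck_on_compose:
  fixes f :: "'a::real_normed_vector \<Rightarrow> 'b::euclidean_space"
  assumes "open V" "f ` V \<subseteq> U" "Ck_on k U F" "Ck_on k V f"
  shows "Ck_on k V (\<lambda>x. F (f x))"
  using assms(3,4)
proof (induction k arbitrary: F)
  case 0
  then show ?case using assms(2) continuous_on_compose2 by fastforce
next
  case (Suc k)
  define f' where "f' x = frechet_derivative f (at x)" for x
  define F' where "F' x = frechet_derivative F (at x)" for x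
  have f': "(f has_derivative f' x) (at x)" if "x \<in> V" for x
    using Suc.prems that by (simp add: f'_def frechet_derivative_works[symmetric])
  have F': "(F has_derivative F' (f x)) (at (f x))" if "x \<in> V" for x
    using Suc.prems that assms(2) by (auto simp: F'_def frechet_derivative_works[symmetric])
  have expand: "F' (f x) (f' x v) = (\<Sum>b\<in>Basis. (f' x v \<bullet> b) *\<^sub>R F' (f x) b)" if "x \<in> V" for x v
  proof -
    have "linear (F' (f x))" using F'[OF that] has_derivative_linear by blast
    then show ?thesis
      by (subst euclidean_representation[symmetric, of "f' x v"]) (simp add: linear_sum linear_cmul)
  qed
  have "Ck_on k V (\<lambda>x. \<Sum>b\<in>Basis. (f' x v \<bullet> b) *\<^sub>R F' (f x) b)" for v
  proof (intro Ck_on_sum[OF assms(1)] Ck_on_bilinear[OF bounded_bilinear_scaleR assms(1)]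
      Ck_on_bilinear[OF bounded_bilinear_inner assms(1)] Ck_on_const)
    show "Ck_on k V (\<lambda>x. f' x v)" using Suc.prems by (simp add: f'_def)
    show "Ck_on k V (\<lambda>x. F' (f x) b)" for b
      using Suc.prems by (intro Suc.IH) (auto simp: F'_def intro: Ck_on_SucD)
  qed auto
  then have "Ck_on k V (\<lambda>x. F' (f x) (f' x v))" for v
    using Ck_on_cong[OF assms(1), of "\<lambda>x. F' (f x) (f' x v)"
        "\<lambda>x. \<Sum>b\<in>Basis. (f' x v \<bullet> b) *\<^sub>R F' (f x) b"] expand by blast
  moreover have "((\<lambda>x. F (f x)) has_derivative (\<lambda>v. F' (f x) (f' x v))) (at x)" if "x \<in> V" for x
    using has_derivative_compose[OF f' F'] that by blast
  ultimately show ?case using assms(1) by (intro Ck_on_SucI[where f' = "\<lambda>x v. F' (f x) (f' x v)"])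
qed

lemma smooth_on_const: "smooth_on U (\<lambda>x. c)"
  by (simp add: smooth_on_def Ck_on_const)

lemma smooth_on_linear: "bounded_linear f \<Longrightarrow> smooth_on U f"
  by (simp add: smooth_on_def Ck_on_linear)

lemma smooth_on_linear_compose:
  "bounded_linear h \<Longrightarrow> open U \<Longrightarrow> smooth_on U f \<Longrightarrow> smooth_on U (\<lambda>x. h (f x))"
  by (simp add: smooth_on_def Ck_on_linear_compose)

lemma smooth_on_add:
  "open U \<Longrightarrow> smooth_on U f \<Longrightarrow> smooth_on U g \<Longrightarrow> smooth_on U (\<lambda>x. f x + g x)"
  by (simp add: smooth_on_def Ck_on_add)

lemma smooth_on_bilinear:
  "bounded_bilinear pr \<Longrightarrow> open U \<Longrightarrow> smooth_on U f \<Longrightarrow> smooth_on U g \<Longrightarrow>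
    smooth_on U (\<lambda>x. pr (f x) (g x))"
  by (simp add: smooth_on_def Ck_on_bilinear)

lemma smooth_on_compose:
  fixes f :: "'a::real_normed_vector \<Rightarrow> 'b::euclidean_space"
  shows "open V \<Longrightarrow> f ` V \<subseteq> U \<Longrightarrow> smooth_on U F \<Longrightarrow> smooth_on V f \<Longrightarrow> smooth_on V (\<lambda>x. F (f x))"
  unfolding smooth_on_def using Ck_on_compose by blast

lemma smooth_on_cong:
  "open U \<Longrightarrow> (\<And>x. x \<in> U \<Longrightarrow> f x = g x) \<Longrightarrow> smooth_on U f \<longleftrightarrow> smooth_on U g"
  using Ck_on_cong unfolding smooth_on_def by blast

lemma smooth_on_local:
  assumes "\<And>x. x \<in> U \<Longrightarrow> \<exists>V. open V \<and> x \<in> V \<and> smooth_on V f"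
  shows "smooth_on U f"
  unfolding smooth_on_def
proof
  show "Ck_on k U f" for k by (rule Ck_on_local) (use assms in \<open>auto simp: smooth_on_def\<close>)
qed

lemma smooth_on_Pair:
  assumes "open U" "smooth_on U f" "smooth_on U g" shows "smooth_on U (\<lambda>x. (f x, g x))"
proof -
  have 1: "bounded_linear (\<lambda>y. (y, 0))" and 2: "bounded_linear (\<lambda>y. (0, y))"
    by (auto intro!: bounded_linear_Pair bounded_linear_ident bounded_linear_zero)
  have "smooth_on U (\<lambda>x. (f x, 0))" "smooth_on U (\<lambda>x. (0, g x))"
    using smooth_on_linear_compose[OF 1 assms(1,2)] smooth_on_linear_compose[OF 2 assms(1,3)]
    by auto
  from smooth_on_add[OF assms(1) this] show ?thesis by simp
qed

section \<open>Smoothness of powers, of the unit circle parametrization and of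
  antiderivatives\<close>

lemma has_derivative_powr_const:
  "0 < x \<Longrightarrow> ((\<lambda>x::real. x powr r) has_derivative (\<lambda>v. v * (r * x powr (r - 1)))) (at x)"
  by (auto intro!: derivative_eq_intros simp: powr_diff field_simps)

text \<open>Differentiation maps powers to multiples of powers, so the induction runs over all
  exponents at once. The exponents 1/2 and -1 give square root and inverse below.\<close>

lemma smooth_on_powr: "smooth_on {0<..} (\<lambda>x::real. x powr r)"
  unfolding smooth_on_def
proof
  show "Ck_on k {0<..} (\<lambda>x::real. x powr r)" for k
  proof (induction k arbitrary: r)
    case 0
    then show ?case by (auto intro!: continuous_intros)
  next
    case (Suc k)
    show ?case
      by (rule Ck_on_SucI[OF has_derivative_powr_const])
        (auto intro!: Ck_on_bilinear[OF bounded_bilinear_mult] Ck_on_const Suc)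
  qed
qed

lemma smooth_on_sqrt:
  fixes f :: "'a::real_normed_vector \<Rightarrow> real"
  assumes "smooth_on UNIV f" "\<And>x. 0 < f x"
  shows "smooth_on UNIV (\<lambda>x. sqrt (f x))"
proof -
  have "smooth_on UNIV (\<lambda>x. f x powr (1/2))"
    by (rule smooth_on_compose[OF _ _ smooth_on_powr]) (use assms in auto)
  moreover have "(\<lambda>x. f x powr (1/2)) = (\<lambda>x. sqrt (f x))"
    using assms(2) by (simp add: powr_half_sqrt less_imp_le)
  ultimately show ?thesis by simp
qed

lemma smooth_on_inverse:
  fixes f :: "'a::real_normed_vector \<Rightarrow> real"
  assumes "smooth_on UNIV f" "\<And>x. 0 < f x"
  shows "smooth_on UNIV (\<lambda>x. inverse (f x))"
proof -
  have "smooth_on UNIV (\<lambda>x. f x powr (-1))"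
    by (rule smooth_on_compose[OF _ _ smooth_on_powr]) (use assms in auto)
  moreover have "(\<lambda>x. f x powr (-1)) = (\<lambda>x. inverse (f x))"
    using assms(2) by (simp add: powr_minus less_imp_le)
  ultimately show ?thesis by simp
qed

lemma smooth_on_cis: "smooth_on UNIV cis"
proof -
  have "Ck_on k UNIV (\<lambda>x. c * cis x)" for k c
  proof (induction k arbitrary: c)
    case 0
    then show ?case by (auto intro!: continuous_intros)
  next
    case (Suc k)
    show ?case
    proof (rule Ck_on_SucI)
      show "((\<lambda>x. c * cis x) has_derivative (\<lambda>v. v *\<^sub>R ((c * \<i>) * cis x))) (at x)" for x
        by (auto intro!: derivative_eq_intros simp: has_vector_derivative_def scaleR_conv_of_real
            mult_ac has_derivative_cis)
      show "Ck_on k UNIV (\<lambda>x. v *\<^sub>R ((c * \<i>) * cis x))" for v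
        by (intro Ck_on_bilinear[OF bounded_bilinear_scaleR] Ck_on_const Suc open_UNIV)
    qed auto
  qed
  from this[of _ 1] show ?thesis by (simp add: smooth_on_def)
qed

text \<open>The angle of the profile curve is known only as an antiderivative; this is its source of
  smoothness.\<close>

lemma smooth_on_antiderivative:
  fixes F g :: "real \<Rightarrow> real"
  assumes "\<And>x. (F has_real_derivative g x) (at x)" "smooth_on UNIV g"
  shows "smooth_on UNIV F"
  unfolding smooth_on_def
proof
  fix k
  have "Ck_on (Suc k) UNIV F"
  proof (rule Ck_on_SucI)
    show "(F has_derivative (\<lambda>v. g x * v)) (at x)" for x
      using assms(1) by (simp add: has_field_derivative_def)
    show "Ck_on k UNIV (\<lambda>x. g x * v)" for v
      using assms(2) by (intro Ck_on_bilinear[OF bounded_bilinear_mult] Ck_on_const)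
        (auto simp: smooth_on_def)
  qed auto
  then show "Ck_on k UNIV F" by (rule Ck_on_SucD)
qed

subsection \<open>Isometries of the ellipsoid\<close>

text \<open>A linear map carrying the ellipsoid onto the unit sphere: membership becomes a condition
  on the norm, and tangency becomes orthogonality.\<close>

definition escale :: "real \<Rightarrow> complex \<times> complex \<Rightarrow> complex \<times> complex" where
  "escale a p = ((1 / a) *\<^sub>R fst p, snd p)"

lemma bounded_linear_escale: "bounded_linear (escale a)"
  unfolding escale_def
  by (intro bounded_linear_Pair bounded_linear_snd
      bounded_linear_compose[OF bounded_linear_scaleR_right bounded_linear_fst])

lemma linear_escale: "linear (escale a)"
  by (rule bounded_linear.linear[OF bounded_linear_escale])

lemma norm_escale: "(norm (escale a p))\<^sup>2 = (cmod (fst p))\<^sup>2 / a\<^sup>2 + (cmod (snd p))\<^sup>2"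
  by (simp add: escale_def norm_Pair power_divide)

lemma ellipsoid_iff: "p \<in> ellipsoid a \<longleftrightarrow> norm (escale a p) = 1"
proof -
  have "p \<in> ellipsoid a \<longleftrightarrow> (norm (escale a p))\<^sup>2 = 1"
    unfolding norm_escale by (cases p) (simp add: ellipsoid_def)
  then show ?thesis by (simp add: power2_eq_1_iff) (metis neg_0_le_iff_le norm_ge_zero not_one_le_zero)
qed

lemma ellipsoid_tangent_iff: "v \<in> ellipsoid_tangent a p \<longleftrightarrow> escale a p \<bullet> escale a v = 0"
  by (simp add: ellipsoid_tangent_def escale_def inner_prod_def power2_eq_square divide_inverse mult_ac)

lemma norm_escale_le:
  assumes "a > 0" shows "norm (escale a p) \<le> max 1 (1 / a) * norm p"
proof (rule power2_le_imp_le)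
  have "1 / a\<^sup>2 \<le> (max 1 (1 / a))\<^sup>2" "1 \<le> (max 1 (1 / a))\<^sup>2"
    using assms power_mono[of "1/a" "max 1 (1/a)" 2] power_mono[of 1 "max 1 (1/a)" 2]
    by (auto simp: power_divide)
  then have "(1 / a\<^sup>2) * (cmod (fst p))\<^sup>2 + 1 * (cmod (snd p))\<^sup>2
      \<le> (max 1 (1 / a))\<^sup>2 * (cmod (fst p))\<^sup>2 + (max 1 (1 / a))\<^sup>2 * (cmod (snd p))\<^sup>2"
    by (intro add_mono mult_right_mono) auto
  then show "(norm (escale a p))\<^sup>2 \<le> (max 1 (1 / a) * norm p)\<^sup>2"
    unfolding norm_escale power_mult_distrib by (simp add: norm_prod_def distrib_left)
qed auto

lemma norm_le_escale:
  assumes "a > 0" shows "norm p \<le> max 1 a * norm (escale a p)"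
proof (rule power2_le_imp_le)
  have "a\<^sup>2 \<le> (max 1 a)\<^sup>2" "1 \<le> (max 1 a)\<^sup>2"
    using assms power_mono[of a "max 1 a" 2] power_mono[of 1 "max 1 a" 2] by auto
  then have "1 * (cmod (snd p))\<^sup>2 + a\<^sup>2 * ((cmod (fst p))\<^sup>2 / a\<^sup>2)
      \<le> (max 1 a)\<^sup>2 * (cmod (snd p))\<^sup>2 + (max 1 a)\<^sup>2 * ((cmod (fst p))\<^sup>2 / a\<^sup>2)"
    by (intro add_mono mult_right_mono) auto
  then show "(norm p)\<^sup>2 \<le> (max 1 a * norm (escale a p))\<^sup>2"
    using assms unfolding norm_escale power_mult_distrib
    by (simp add: norm_prod_def distrib_left)
qed auto

lemma compact_ellipsoid:
  assumes "a > 0" shows "compact (ellipsoid a)"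
proof -
  have "closed {p. norm (escale a p) = 1}"
    by (intro closed_Collect_eq continuous_intros linear_continuous_on bounded_linear_escale)
  moreover have "norm p \<le> max 1 a" if "norm (escale a p) = 1" for p
    using norm_le_escale[OF assms, of p] that by simp
  moreover have "ellipsoid a = {p. norm (escale a p) = 1}"
    by (rule set_eqI) (simp add: ellipsoid_iff)
  ultimately show ?thesis unfolding compact_eq_bounded_closed bounded_iff by auto
qed

text \<open>Differentiate the constant squared norm of the scaled curve. The derivative is taken
  within \<open>S\<close>, since the chords used later live on a closed interval and have one-sided
  derivatives at its ends.\<close>

lemma ellipsoid_curve_tangent:
  assumes "\<And>t. t \<in> S \<Longrightarrow> \<gamma> t \<in> ellipsoid a" "t \<in> S" "at t within S \<noteq> bot"
    and der: "(\<gamma> has_vector_derivative \<gamma>') (at t within S)"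
  shows "\<gamma>' \<in> ellipsoid_tangent a (\<gamma> t)"
proof -
  have d: "((\<lambda>t. escale a (\<gamma> t)) has_vector_derivative escale a \<gamma>') (at t within S)"
    by (rule bounded_linear.has_vector_derivative[OF bounded_linear_escale der])
  have 1: "((\<lambda>t. escale a (\<gamma> t) \<bullet> escale a (\<gamma> t)) has_vector_derivative
      escale a (\<gamma> t) \<bullet> escale a \<gamma>' + escale a \<gamma>' \<bullet> escale a (\<gamma> t)) (at t within S)"
    by (rule bounded_bilinear.has_vector_derivative[OF bounded_bilinear_inner d d])
  have 2: "((\<lambda>t. escale a (\<gamma> t) \<bullet> escale a (\<gamma> t)) has_vector_derivative 0) (at t within S)"
    by (rule has_vector_derivative_transform[OF assms(2) _ has_vector_derivative_const[of 1]])
      (use assms(1) in \<open>auto simp: ellipsoid_iff norm_eq_1[symmetric]\<close>)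
  show ?thesis
    using vector_derivative_unique_within[OF assms(3) 1 2] by (simp add: ellipsoid_tangent_iff inner_commute)
qed

text \<open>The curve is the radial projection of the line through p with direction v. As v is
  tangent, the scaled norm along the line is sqrt (1 + t^2 |escale a v|^2), whose derivative
  vanishes at 0, so the projection does not change the initial velocity.\<close>

lemma ellipsoid_tangent_curve:
  assumes "p \<in> ellipsoid a" "v \<in> ellipsoid_tangent a p"
  obtains \<gamma> where "\<gamma> 0 = p" "\<And>t. \<gamma> t \<in> ellipsoid a" "(\<gamma> has_vector_derivative v) (at 0)"
proof
  define n where "n t = sqrt (1 + t\<^sup>2 * (norm (escale a v))\<^sup>2)" for t
  define \<gamma> where "\<gamma> t = (1 / n t) *\<^sub>R (p + t *\<^sub>R v)" for t
  have n: "norm (escale a (p + t *\<^sub>R v)) = n t" for t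
  proof -
    have "(norm (escale a (p + t *\<^sub>R v)))\<^sup>2 = 1 + t\<^sup>2 * (norm (escale a v))\<^sup>2"
      using assms unfolding ellipsoid_tangent_iff ellipsoid_iff power2_norm_eq_inner
      by (simp add: linear_add[OF linear_escale] linear_cmul[OF linear_escale] inner_add_left
          inner_add_right inner_commute norm_eq_1 power2_eq_square)
    then show ?thesis by (simp add: n_def real_sqrt_unique)
  qed
  have npos: "n t > 0" for t unfolding n_def by (simp add: add_pos_nonneg)
  show "\<gamma> 0 = p" by (simp add: \<gamma>_def n_def)
  show "\<gamma> t \<in> ellipsoid a" for t
    using n[of t] npos[of t] unfolding ellipsoid_iff \<gamma>_def linear_cmul[OF linear_escale] by simp
  have "(n has_vector_derivative 0) (at 0)"
    unfolding n_def has_real_derivative_iff_has_vector_derivative[symmetric]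
    by (auto intro!: derivative_eq_intros)
  then show "(\<gamma> has_vector_derivative v) (at 0)"
    unfolding \<gamma>_def using npos[of 0]
    by (auto intro!: derivative_eq_intros simp: n_def has_real_derivative_iff_has_vector_derivative[symmetric])
qed

text \<open>An isometry is differentiable only within the ellipsoid, so the chain rule is applied
  along curves that stay there; their velocities are tangent and therefore keep their
  length.\<close>

lemma isometry_curve:
  assumes "ellipsoid_isometry a \<phi>"
    and "\<And>t. t \<in> S \<Longrightarrow> \<gamma> t \<in> ellipsoid a" "t \<in> S" "at t within S \<noteq> bot"
    and "(\<gamma> has_vector_derivative \<gamma>') (at t within S)"
  obtains y where "((\<lambda>t. \<phi> (\<gamma> t)) has_vector_derivative y) (at t within S)" "norm y = norm \<gamma>'"
proof -
  obtain D where D: "(\<phi> has_derivative D) (at (\<gamma> t) within ellipsoid a)"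
    and iso: "\<forall>v\<in>ellipsoid_tangent a (\<gamma> t). \<forall>w\<in>ellipsoid_tangent a (\<gamma> t). D v \<bullet> D w = v \<bullet> w"
    using assms unfolding ellipsoid_isometry_def by blast
  have "(\<phi> has_derivative D) (at (\<gamma> t) within \<gamma> ` S)"
    using D by (rule has_derivative_subset) (use assms in auto)
  from has_derivative_in_compose[OF assms(5)[unfolded has_vector_derivative_def] this]
  have "((\<lambda>t. \<phi> (\<gamma> t)) has_vector_derivative D \<gamma>') (at t within S)"
    by (simp add: has_vector_derivative_def linear_cmul[OF has_derivative_linear[OF D]])
  moreover have "norm (D \<gamma>') = norm \<gamma>'"
    using iso ellipsoid_curve_tangent[OF assms(2-5)] by (simp add: norm_eq_sqrt_inner)
  ultimately show ?thesis using that by blast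
qed

lemma smooth_on_subset_has_derivative:
  assumes "smooth_on_subset S f" "p \<in> S"
  shows "\<exists>D. (f has_derivative D) (at p within S)"
proof -
  obtain U F where U: "open U" "p \<in> U" and F: "smooth_on U F" "\<And>q. q \<in> S \<inter> U \<Longrightarrow> F q = f q"
    using bspec[OF assms(1)[unfolded smooth_on_subset_def] assms(2)] by metis
  have "Ck_on (Suc 0) U F" using F(1) unfolding smooth_on_def by blast
  then obtain D where "(F has_derivative D) (at p within S)"
    using U(2) unfolding Ck_on.simps differentiable_def by (meson has_derivative_at_withinI)
  moreover have "eventually (\<lambda>q. F q = f q) (at p within S)"
    using U F(2) unfolding eventually_at_topological by blast
  ultimately have "(f has_derivative D) (at p within S)"
    by (rule has_derivative_transform_eventually) (use F(2) U(2) assms(2) in auto)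
  then show ?thesis by blast
qed

lemma ellipsoid_isometry_id: "ellipsoid_isometry a id"
proof -
  have "smooth_on_subset (ellipsoid a) (inv_into (ellipsoid a) id)"
    "smooth_on_subset (ellipsoid a) id"
    unfolding smooth_on_subset_def
    by (auto intro!: exI[of _ UNIV] exI[of _ "\<lambda>x. x"] smooth_on_linear bounded_linear_ident
        inv_into_f_eq[symmetric])
  then show ?thesis unfolding ellipsoid_isometry_def
    by (auto intro!: exI[of _ id] simp: id_def[abs_def] bij_betw_def)
qed

text \<open>Smoothness of the inverse is part of the definition, but its differential has to be
  shown isometric. It is enough that the differential of \<phi> undoes that of the inverse on
  tangent vectors.\<close>

lemma ellipsoid_isometry_inv:
  assumes iso: "ellipsoid_isometry a \<phi>"
  shows "ellipsoid_isometry a (inv_into (ellipsoid a) \<phi>)"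
proof -
  let ?E = "ellipsoid a"
  define \<psi> where "\<psi> = inv_into ?E \<phi>"
  have bij: "bij_betw \<phi> ?E ?E" and sm: "smooth_on_subset ?E \<phi>" and smi: "smooth_on_subset ?E \<psi>"
    using iso by (auto simp: ellipsoid_isometry_def \<psi>_def)
  have bij': "bij_betw \<psi> ?E ?E" unfolding \<psi>_def by (rule bij_betw_inv_into[OF bij])
  have \<phi>\<psi>: "\<phi> (\<psi> q) = q" if "q \<in> ?E" for q
    using bij that by (simp add: \<psi>_def bij_betw_inv_into_right)
  have \<psi>E: "\<psi> q \<in> ?E" if "q \<in> ?E" for q using bij' that by (auto simp: bij_betw_def)
  have invinv: "inv_into ?E \<psi> q = \<phi> q" if "q \<in> ?E" for q
    using bij bij' that \<phi>\<psi> unfolding \<psi>_def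
    by (metis bij_betw_def bij_betw_inv_into_left inv_into_f_f \<psi>E imageI)
  have sm': "smooth_on_subset ?E (inv_into ?E \<psi>)"
    using sm unfolding smooth_on_subset_def by (metis IntD1 invinv)
  have "\<exists>D'. (\<psi> has_derivative D') (at q within ?E) \<and>
      (\<forall>v\<in>ellipsoid_tangent a q. \<forall>w\<in>ellipsoid_tangent a q. D' v \<bullet> D' w = v \<bullet> w)" if q: "q \<in> ?E" for q
  proof -
    obtain D' where D': "(\<psi> has_derivative D') (at q within ?E)"
      using smooth_on_subset_has_derivative[OF smi q] by blast
    obtain D where D: "(\<phi> has_derivative D) (at (\<psi> q) within ?E)"
      and isoD: "\<And>v w. v \<in> ellipsoid_tangent a (\<psi> q) \<Longrightarrow> w \<in> ellipsoid_tangent a (\<psi> q) \<Longrightarrow> D v \<bullet> D w = v \<bullet> w"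
      using iso \<psi>E[OF q] unfolding ellipsoid_isometry_def by blast
    \<comment> \<open>Move along a curve with velocity v and differentiate the identity \<phi>
      (\<psi> (\<gamma> t)) = \<gamma> t.\<close>
    have key: "D' v \<in> ellipsoid_tangent a (\<psi> q) \<and> D (D' v) = v" if v: "v \<in> ellipsoid_tangent a q" for v
    proof -
      obtain \<gamma> where \<gamma>: "\<gamma> 0 = q" "\<And>t. \<gamma> t \<in> ?E" "(\<gamma> has_vector_derivative v) (at 0)"
        using ellipsoid_tangent_curve[OF q v] by blast
      have "(\<psi> has_derivative D') (at (\<gamma> 0) within range \<gamma>)"
        using D' unfolding \<gamma>(1) by (rule has_derivative_subset) (use \<gamma> in auto)
      from has_derivative_in_compose[OF \<gamma>(3)[unfolded has_vector_derivative_def] this]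
      have \<psi>\<gamma>: "((\<lambda>t. \<psi> (\<gamma> t)) has_vector_derivative D' v) (at 0)"
        by (simp add: has_vector_derivative_def linear_cmul[OF has_derivative_linear[OF D']])
      have tan: "D' v \<in> ellipsoid_tangent a (\<psi> q)"
        using ellipsoid_curve_tangent[OF _ _ _ \<psi>\<gamma>] \<gamma>(1,2) \<psi>E by auto
      have "(\<phi> has_derivative D) (at (\<psi> (\<gamma> 0)) within range (\<lambda>t. \<psi> (\<gamma> t)))"
        using D unfolding \<gamma>(1) by (rule has_derivative_subset) (use \<gamma>(2) \<psi>E in blast)
      from has_derivative_in_compose[OF \<psi>\<gamma>[unfolded has_vector_derivative_def] this]
      have "((\<lambda>t. \<phi> (\<psi> (\<gamma> t))) has_vector_derivative D (D' v)) (at 0)"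
        by (simp add: has_vector_derivative_def linear_cmul[OF has_derivative_linear[OF D]])
      then have "(\<gamma> has_vector_derivative D (D' v)) (at 0)" using \<phi>\<psi> \<gamma>(2) by simp
      then have "D (D' v) = v" using \<gamma>(3) vector_derivative_unique_at by blast
      then show ?thesis using tan by blast
    qed
    have "D' v \<bullet> D' w = v \<bullet> w" if "v \<in> ellipsoid_tangent a q" "w \<in> ellipsoid_tangent a q" for v w
      using isoD key that by metis
    then show ?thesis using D' by blast
  qed
  then show ?thesis using bij' smi sm' unfolding ellipsoid_isometry_def \<psi>_def by blast
qed

section \<open>Congruence, and the uniform Lipschitz bound for isometries\<close>

lemma congruent_in_ellipsoid_refl: "congruent_in_ellipsoid a A A"
  unfolding congruent_in_ellipsoid_def 
  by (rule exI[of _ id]) (simp add: ellipsoid_isometry_id)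

lemma congruent_in_ellipsoid_sym:
  assumes "congruent_in_ellipsoid a A B" "A \<subseteq> ellipsoid a"
  shows "congruent_in_ellipsoid a B A"
proof -
  obtain \<phi> where \<phi>: "ellipsoid_isometry a \<phi>" "\<phi> ` A = B"
    using assms unfolding congruent_in_ellipsoid_def by blast
  then have "inj_on \<phi> (ellipsoid a)" by (auto simp: ellipsoid_isometry_def bij_betw_def)
  then have "inv_into (ellipsoid a) \<phi> ` B = A" 
    using inv_into_image_cancel[OF _ assms(2)] \<phi>(2) by metis
  then show ?thesis unfolding congruent_in_ellipsoid_def
    using ellipsoid_isometry_inv[OF \<phi>(1)] by blast
qed

text \<open>Nearby points of the ellipsoid are joined by the radial projection of their chord, whose length
  is comparable to their distance and preserved by isometries.\<close>

lemma ellipsoid_isometry_lipschitz: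
  assumes a: "a > 0"
  obtains L where "L > 0" "\<And>\<phi> p q. ellipsoid_isometry a \<phi> \<Longrightarrow> p \<in> ellipsoid a \<Longrightarrow> q \<in> ellipsoid a \<Longrightarrow>
    dist (\<phi> p) (\<phi> q) \<le> L * dist p q"
proof
  define C where "C = max 1 (1 / a)"
  define M where "M = max 1 a"
  \<comment> \<open>For far points the diameter bound 2 M is at most 4 M C |d|, because 1 is at most
    2 C |d|. For near points the projected chord has speed at most |d| / n + |n'| |y| / n^2, where n
    is at least 1/2, |n'| is at most C |d| and |y| is at most M. This \<open>L\<close> covers both
    cases.\<close>
  define L where "L = 2 + 4 * M * C"
  have CM: "C \<ge> 1" "M \<ge> 1" by (auto simp: C_def M_def)
  then show "L > 0" by (simp add: L_def add_pos_pos)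
  fix \<phi> p q assume iso: "ellipsoid_isometry a \<phi>" and p: "p \<in> ellipsoid a" and q: "q \<in> ellipsoid a"
  have \<phi>E: "\<phi> x \<in> ellipsoid a" if "x \<in> ellipsoid a" for x
    using iso that by (auto simp: ellipsoid_isometry_def bij_betw_def)
  have nM: "norm x \<le> M" if "x \<in> ellipsoid a" for x
    using norm_le_escale[OF a, of x] that by (simp add: ellipsoid_iff M_def)
  define d where "d = q - p"
  have dC: "norm (escale a d) \<le> C * norm d" unfolding C_def by (rule norm_escale_le[OF a])
  show "dist (\<phi> p) (\<phi> q) \<le> L * dist p q"
  \<comment> \<open>The threshold 1/2 keeps the scaled chord at distance at least 1/2 from the
    origin, so that radial projection is harmless.\<close>
  proof (cases "norm (escale a d) \<le> 1/2")
    case False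
    then have "1 \<le> 2 * C * norm d" using dC by simp
    then have "2 * M * 1 \<le> 2 * M * (2 * C * norm d)" using CM by (intro mult_left_mono) auto
    also have "\<dots> \<le> L * norm d" by (simp add: L_def algebra_simps)
    finally have "2 * M \<le> L * norm d" by simp
    moreover have "dist (\<phi> p) (\<phi> q) \<le> 2 * M"
      using nM[OF \<phi>E[OF p]] nM[OF \<phi>E[OF q]] norm_triangle_ineq4[of "\<phi> p" "\<phi> q"] by (simp add: dist_norm)
    ultimately show ?thesis by (simp add: d_def dist_norm norm_minus_commute)
  next
    case True
    define y where "y t = p + t *\<^sub>R d" for t
    define n where "n t = norm (escale a (y t))" for t
    define \<gamma> where "\<gamma> t = (1 / n t) *\<^sub>R y t" for t
    define S where "S = {0..1::real}"
    have n1: "n t \<ge> 1/2" if "t \<in> S" for t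
    proof -
      have "norm (escale a p) \<le> n t + norm (escale a (t *\<^sub>R d))"
        unfolding n_def y_def linear_add[OF linear_escale]
        using norm_triangle_ineq4[of "escale a p + escale a (t *\<^sub>R d)" "escale a (t *\<^sub>R d)"] by simp
      moreover have "norm (escale a (t *\<^sub>R d)) \<le> 1/2"
        using that True mult_mono[of t 1 "norm (escale a d)" "1/2"]
        by (simp add: linear_cmul[OF linear_escale] S_def)
      ultimately show ?thesis using p by (simp add: ellipsoid_iff)
    qed
    have y: "norm (y t) \<le> M" if "t \<in> S" for t
    proof -
      have "y t = (1 - t) *\<^sub>R p + t *\<^sub>R q" by (simp add: y_def d_def algebra_simps)
      also have "norm \<dots> \<le> (1 - t) * norm p + t * norm q"
        using that norm_triangle_ineq[of "(1 - t) *\<^sub>R p" "t *\<^sub>R q"] by (simp add: S_def)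
      also have "\<dots> \<le> (1 - t) * M + t * M"
        using that nM[OF p] nM[OF q] by (intro add_mono mult_left_mono) (auto simp: S_def)
      finally show ?thesis by (simp add: algebra_simps)
    qed
    have \<gamma>E: "\<gamma> t \<in> ellipsoid a" if "t \<in> S" for t
      using n1[OF that] unfolding ellipsoid_iff \<gamma>_def linear_cmul[OF linear_escale]
      by (simp add: n_def[symmetric])
    define n' where "n' t = (escale a (y t) \<bullet> escale a d) / n t" for t
    define \<gamma>' where "\<gamma>' t = (1 / n t) *\<^sub>R d - (n' t / (n t)\<^sup>2) *\<^sub>R y t" for t
    have yd: "(y has_vector_derivative d) F" for F
      unfolding y_def has_vector_derivative_def by (auto intro!: derivative_eq_intros)
    have nd: "(n has_real_derivative n' t) (at t)" if "t \<in> S" for t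
    proof -
      have e: "((\<lambda>t. escale a (y t)) has_vector_derivative escale a d) (at t)"
        by (rule bounded_linear.has_vector_derivative[OF bounded_linear_escale yd])
      have pos: "escale a (y t) \<bullet> escale a (y t) > 0"
        using n1[OF that] by (simp add: n_def) force
      have "((\<lambda>t. escale a (y t) \<bullet> escale a (y t)) has_real_derivative 2 * (escale a (y t) \<bullet> escale a d)) (at t)"
        using bounded_bilinear.has_vector_derivative[OF bounded_bilinear_inner e e]
        by (simp add: has_real_derivative_iff_has_vector_derivative inner_commute)
      from DERIV_chain2[OF DERIV_real_sqrt[OF pos] this] show ?thesis
        by (simp add: n_def[abs_def] n'_def norm_eq_sqrt_inner field_simps)
    qed
    have n'b: "\<bar>n' t\<bar> \<le> norm (escale a d)" if "t \<in> S" for t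
    proof -
      have "\<bar>escale a (y t) \<bullet> escale a d\<bar> \<le> n t * norm (escale a d)"
        unfolding n_def by (rule Cauchy_Schwarz_ineq2)
      then show ?thesis using n1[OF that] by (simp add: n'_def abs_divide divide_le_eq mult.commute)
    qed
    have \<gamma>d: "(\<gamma> has_vector_derivative \<gamma>' t) (at t within S)" if "t \<in> S" for t
    proof -
      have "((\<lambda>t. 1 / n t) has_real_derivative - (n' t / (n t)\<^sup>2)) (at t within S)"
      proof -
        have nz: "n t \<noteq> 0" using n1[OF that] by simp
        have "(n has_real_derivative n' t) (at t within S)"
          by (rule has_field_derivative_at_within[OF nd[OF that]])
        from DERIV_divide[OF DERIV_const this nz, of 1] show ?thesis
          by (simp add: power2_eq_square)
      qed
      from has_vector_derivative_scaleR[OF this yd] show ?thesis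
        by (simp add: \<gamma>_def[abs_def] \<gamma>'_def)
    qed
    have \<gamma>'b: "norm (\<gamma>' t) \<le> L * norm d" if t: "t \<in> S" for t
    proof -
      have i: "1 / n t \<le> 2" using n1[OF t] by (simp add: divide_le_eq)
      have "1 / (n t)\<^sup>2 = (1 / n t) * (1 / n t)" by (simp add: power2_eq_square)
      also have "\<dots> \<le> 2 * 2" using i n1[OF t] by (intro mult_mono) auto
      finally have i2: "1 / (n t)\<^sup>2 \<le> 4" by simp
      have "norm (\<gamma>' t) \<le> (1 / n t) * norm d + (\<bar>n' t\<bar> * (1 / (n t)\<^sup>2)) * norm (y t)"
        unfolding \<gamma>'_def using n1[OF t]
        by (intro order_trans[OF norm_triangle_ineq4]) (simp add: abs_divide)
      also have "\<dots> \<le> 2 * norm d + ((C * norm d) * 4) * M"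
        using i i2 n'b[OF t] dC y[OF t] CM n1[OF t]
        by (intro add_mono mult_mono) auto
      also have "\<dots> = L * norm d" by (simp add: L_def algebra_simps)
      finally show ?thesis .
    qed
    have "\<exists>z. ((\<lambda>t. \<phi> (\<gamma> t)) has_vector_derivative z) (at t within S) \<and> norm z \<le> L * norm d"
      if t: "t \<in> S" for t
    proof -
      have "at t within S \<noteq> bot" using t by (simp add: S_def trivial_limit_within islimpt_Icc)
      from isometry_curve[OF iso \<gamma>E t this \<gamma>d[OF t]] show ?thesis using \<gamma>'b[OF t] by metis
    qed
    then obtain z where z: "\<And>t. t \<in> S \<Longrightarrow> ((\<lambda>t. \<phi> (\<gamma> t)) has_vector_derivative z t) (at t within S)"
      and zb: "\<And>t. t \<in> S \<Longrightarrow> norm (z t) \<le> L * norm d" by metis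
    have "norm (\<phi> (\<gamma> 1) - \<phi> (\<gamma> 0)) \<le> (L * norm d) * norm (1 - 0 :: real)"
    proof (rule differentiable_bound[where S = S and f' = "\<lambda>t h. h *\<^sub>R z t"])
      show "onorm (\<lambda>h. h *\<^sub>R z t) \<le> L * norm d" if "t \<in> S" for t
        using zb[OF that] by (intro onorm_le) (simp add: mult.commute mult_left_mono)
    qed (use z in \<open>auto simp: S_def has_vector_derivative_def\<close>)
    moreover have "\<gamma> 0 = p" "\<gamma> 1 = q"
      using p q by (auto simp: \<gamma>_def n_def y_def d_def ellipsoid_iff)
    ultimately show ?thesis by (simp add: d_def dist_norm norm_minus_commute)
  qed
qed

subsection \<open>Sets dense in a fixed ball\<close>

text \<open>Suppose isometries \<open>\<phi> n\<close> carry infinitely many \<open>A n\<close> onto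
  B, and let x' be a limit point of the images of p. By the Lipschitz bound the inverses map the
  ball of radius r / (2 L) about x' into \<open>ball p r\<close>, where \<open>A n\<close> is nearly
  dense; mapping forward again shows that B is dense in that ball. As B is closed, it contains the
  part of the ball in the ellipsoid.\<close>

lemma finite_congruent_dense:
  assumes a: "a > 0" and A: "\<And>n. A n \<subseteq> ellipsoid a" and B: "closed B" "B \<subseteq> ellipsoid a"
    and noint: "\<And>x r. x \<in> B \<Longrightarrow> r > 0 \<Longrightarrow> \<not> ball x r \<inter> ellipsoid a \<subseteq> B"
    and p: "p \<in> ellipsoid a" and r: "r > 0"
    and dense: "\<And>\<epsilon>. \<epsilon> > 0 \<Longrightarrow>
      eventually (\<lambda>n. \<forall>y\<in>ball p r \<inter> ellipsoid a. \<exists>x\<in>A n. dist x y < \<epsilon>) sequentially"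
  shows "finite {n. congruent_in_ellipsoid a (A n) B}"
proof (rule ccontr)
  let ?E = "ellipsoid a"
  assume "infinite {n. congruent_in_ellipsoid a (A n) B}"
  from infinite_enumerate[OF this] obtain h :: "nat \<Rightarrow> nat"
    where h: "strict_mono h" "\<And>n. congruent_in_ellipsoid a (A (h n)) B" by blast
  from h(2) obtain \<phi> where \<phi>: "\<And>n. ellipsoid_isometry a (\<phi> n)" "\<And>n. \<phi> n ` A (h n) = B"
    unfolding congruent_in_ellipsoid_def by metis
  define \<psi> where "\<psi> n = inv_into ?E (\<phi> n)" for n
  have \<psi>: "ellipsoid_isometry a (\<psi> n)" for n
    unfolding \<psi>_def by (rule ellipsoid_isometry_inv[OF \<phi>(1)])
  have bij: "bij_betw (\<phi> n) ?E ?E" for n using \<phi>(1) by (simp add: ellipsoid_isometry_def)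
  obtain L where L: "L > 0" and lip: "\<And>\<phi> p q. ellipsoid_isometry a \<phi> \<Longrightarrow> p \<in> ?E \<Longrightarrow> q \<in> ?E \<Longrightarrow>
    dist (\<phi> p) (\<phi> q) \<le> L * dist p q" using ellipsoid_isometry_lipschitz[OF a] by metis
  define x where "x n = \<phi> n p" for n
  have xE: "x n \<in> ?E" for n using bij[of n] p by (auto simp: x_def bij_betw_def)
  obtain x' s where x': "x' \<in> ?E" and s: "strict_mono (s :: nat \<Rightarrow> nat)" "(x \<circ> s) \<longlonglongrightarrow> x'"
    using compact_ellipsoid[OF a, unfolded compact_def, rule_format, of x] xE by blast
  have "ball x' (r / (2 * L)) \<inter> ?E \<subseteq> B"
  proof
    fix y assume y: "y \<in> ball x' (r / (2 * L)) \<inter> ?E"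
    have "\<exists>z\<in>B. dist z y < \<epsilon>" if \<epsilon>: "\<epsilon> > 0" for \<epsilon>
    proof -
      have "eventually (\<lambda>n. dist (x (s n)) x' < r / (2 * L)) sequentially"
        using tendstoD[OF s(2)] r L by simp
      moreover have "eventually (\<lambda>n. \<forall>y\<in>ball p r \<inter> ?E. \<exists>x\<in>A (h (s n)). dist x y < \<epsilon> / L) sequentially"
      proof -
        have "filterlim (\<lambda>n. h (s n)) sequentially sequentially"
          using filterlim_subseq[OF strict_mono_o[OF h(1) s(1)]] by (simp add: o_def)
        from filterlim_iff[THEN iffD1, OF this, rule_format, OF dense[of "\<epsilon> / L"]] show ?thesis
          using \<epsilon> L by simp
      qed
      ultimately obtain n where n: "dist (x (s n)) x' < r / (2 * L)"
        and nd: "\<forall>y\<in>ball p r \<inter> ?E. \<exists>x\<in>A (h (s n)). dist x y < \<epsilon> / L"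
        using eventually_happens'[OF sequentially_bot eventually_conj] by blast
      define m where "m = s n"
      define y' where "y' = \<psi> m y"
      have yE: "y \<in> ?E" using y by simp
      have y'E: "y' \<in> ?E" and \<phi>y': "\<phi> m y' = y"
        using bij[of m] yE by (auto simp: y'_def \<psi>_def bij_betw_def inv_into_into f_inv_into_f)
      have \<psi>x: "\<psi> m (x m) = p"
        using bij[of m] p by (simp add: \<psi>_def x_def bij_betw_inv_into_left)
      have "dist (x m) y < r / L"
        using n y dist_triangle_less_add[of "x m" x' "r / (2 * L)" y "r / (2 * L)"]
        by (simp add: m_def dist_commute field_simps)
      then have "L * dist (x m) y < r" using L by (simp add: field_simps)
      moreover have "dist p y' \<le> L * dist (x m) y"
        using lip[OF \<psi> xE yE, of m m] by (simp add: \<psi>x y'_def)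
      ultimately have "y' \<in> ball p r \<inter> ?E" using y'E by simp
      then obtain z where z: "z \<in> A (h m)" "dist z y' < \<epsilon> / L" using nd unfolding m_def by blast
      have "dist (\<phi> m z) y \<le> L * dist z y'"
        using lip[OF \<phi>(1) _ y'E, of z m] A z(1) by (auto simp: \<phi>y')
      also have "\<dots> < \<epsilon>" using z(2) L by (simp add: field_simps)
      finally show ?thesis using \<phi>(2)[of m] z(1) by blast
    qed
    then have "y \<in> closure B" by (simp add: closure_approachable)
    then show "y \<in> B" using B(1) by simp
  qed
  moreover have "x' \<in> ball x' (r / (2 * L)) \<inter> ?E" using x' r L by simp
  ultimately show False using noint[of x' "r / (2 * L)"] r L
    by (metis divide_pos_pos mult_pos_pos subsetD zero_less_numeral)
qed

text \<open>Near a point with nonzero second coordinate the ellipsoid contains the graph over the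
  z-plane obtained by freezing the phase of w. If B contained a ball, the z-values on this graph
  would form a nonempty open subset of the null set \<open>N\<close>.\<close>

lemma ellipsoid_no_interior:
  assumes a: "a > 0" and B: "\<And>p. p \<in> B \<Longrightarrow> fst p \<in> N \<and> snd p \<noteq> 0" and N: "negligible N"
    and x: "x \<in> B" "x \<in> ellipsoid a" and r: "r > 0"
  shows "\<not> ball x r \<inter> ellipsoid a \<subseteq> B"
proof
  assume sub: "ball x r \<inter> ellipsoid a \<subseteq> B"
  define w where "w = snd x"
  have w: "w \<noteq> 0" using B[OF x(1)] by (simp add: w_def)
  \<comment> \<open>The local section through x: the modulus of w is determined by z, its phase is
    that of \<open>snd x\<close>.\<close>
  define g where "g z = (z, complex_of_real (sqrt (1 - (cmod z)\<^sup>2 / a\<^sup>2) / cmod w) * w)" for z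
  have eq: "(cmod (fst x))\<^sup>2 / a\<^sup>2 + (cmod w)\<^sup>2 = 1"
    using x(2) by (cases x) (simp add: ellipsoid_def w_def)
  have gx: "g (fst x) = x"
  proof -
    have "1 - (cmod (fst x))\<^sup>2 / a\<^sup>2 = (cmod w)\<^sup>2" using eq by simp
    then show ?thesis using w by (simp add: g_def w_def)
  qed
  define U where "U = {z. (cmod z)\<^sup>2 / a\<^sup>2 < 1} \<inter> g -` ball x r"
  have cont: "continuous_on UNIV g" unfolding g_def by (intro continuous_intros) (use a w in auto)
  have "open U" unfolding U_def
    by (intro open_Int open_vimage cont open_Collect_less continuous_intros) (use a in auto)
  moreover have "fst x \<in> U" using eq w gx r by (auto simp: U_def) (metis add.right_neutral add_less_cancel_left less_add_same_cancel1 zero_less_norm_iff zero_less_power)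
  moreover have "U \<subseteq> N"
  proof
    fix z assume z: "z \<in> U"
    have z1: "(cmod z)\<^sup>2 / a\<^sup>2 < 1" using z by (simp add: U_def)
    then have "cmod (snd (g z)) = sqrt (1 - (cmod z)\<^sup>2 / a\<^sup>2)"
      using w by (simp add: g_def norm_mult norm_divide)
    then have "g z \<in> ellipsoid a"
      using z1 by (simp add: g_def ellipsoid_def)
    then have "g z \<in> B" using sub z by (auto simp: U_def)
    then show "z \<in> N" using B[of "g z"] by (simp add: g_def)
  qed
  ultimately show False using open_not_negligible negligible_subset[OF N] by blast
qed

text \<open>An infinite set homogeneous for R would lie, apart from one of its points m, in the
  finite set of indices related to m. Hence the homogeneous set given by Ramsey's theorem is
  homogeneous for the negation.\<close>

lemma Ramsey_finite_classes:
  fixes R :: "nat \<Rightarrow> nat \<Rightarrow> bool"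
  assumes "symp R" "\<And>m. finite {n. R n m}"
  obtains H where "infinite H" "\<And>m n. m \<in> H \<Longrightarrow> n \<in> H \<Longrightarrow> m \<noteq> n \<Longrightarrow> \<not> R m n"
proof -
  define f where "f X = (if \<exists>m n. X = {m, n} \<and> m \<noteq> n \<and> R m n then 0 else 1 :: nat)" for X
  have f: "f {m, n} = 0 \<longleftrightarrow> R m n" if "m \<noteq> n" for m n
    using that assms(1) by (auto simp: f_def doubleton_eq_iff symp_def)
  obtain Y t where Y: "infinite Y" and t: "\<forall>x\<in>Y. \<forall>y\<in>Y. x \<noteq> y \<longrightarrow> f {x, y} = t"
  proof -
    have "\<forall>x\<in>UNIV. \<forall>y\<in>UNIV. x \<noteq> y \<longrightarrow> f {x, y} < 2" by (simp add: f_def)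
    from Ramsey2[OF infinite_UNIV_nat this] show ?thesis using that by blast
  qed
  have "t \<noteq> 0"
  proof
    assume "t = 0"
    obtain m where m: "m \<in> Y" using Y by (metis ex_in_conv finite.emptyI)
    have "Y - {m} \<subseteq> {n. R n m}" using t m f \<open>t = 0\<close> by auto
    then show False using Y assms(2)[of m] finite_subset by fastforce
  qed
  then show ?thesis using that[OF Y] t f by metis
qed

subsection \<open>Tori congruent to the Clifford torus\<close>

text \<open>Schwarz's argument: the second difference over a square of side d equals d^2 times a
  mixed derivative at some interior point, for either order of differentiation. Continuity compares
  both values with those at the corner.\<close>

lemma mixed_partials_eq:
  fixes h hu hv huv hvu :: "real \<Rightarrow> real \<Rightarrow> real"
  assumes hu: "\<And>u v. ((\<lambda>s. h s v) has_real_derivative hu u v) (at u)"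
    and hv: "\<And>u v. (h u has_real_derivative hv u v) (at v)"
    and huv: "\<And>u v. (hu u has_real_derivative huv u v) (at v)"
    and hvu: "\<And>u v. ((\<lambda>s. hv s v) has_real_derivative hvu u v) (at u)"
    and cont: "isCont (\<lambda>(u, v). huv u v) (u0, v0)" "isCont (\<lambda>(u, v). hvu u v) (u0, v0)"
  shows "huv u0 v0 = hvu u0 v0"
proof (rule ccontr)
  assume "huv u0 v0 \<noteq> hvu u0 v0"
  define \<epsilon> where "\<epsilon> = \<bar>huv u0 v0 - hvu u0 v0\<bar> / 2"
  have \<epsilon>: "\<epsilon> > 0" using \<open>huv u0 v0 \<noteq> hvu u0 v0\<close> by (simp add: \<epsilon>_def)
  obtain d1 where d1: "d1 > 0" "\<And>p. dist p (u0, v0) < d1 \<Longrightarrow> \<bar>huv (fst p) (snd p) - huv u0 v0\<bar> < \<epsilon>"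
    using cont(1) \<epsilon> unfolding continuous_at_eps_delta by (auto simp: dist_real_def case_prod_beta)
  obtain d2 where d2: "d2 > 0" "\<And>p. dist p (u0, v0) < d2 \<Longrightarrow> \<bar>hvu (fst p) (snd p) - hvu u0 v0\<bar> < \<epsilon>"
    using cont(2) \<epsilon> unfolding continuous_at_eps_delta by (auto simp: dist_real_def case_prod_beta)
  define d where "d = min d1 d2 / 2"
  have d: "d > 0" "2 * d \<le> d1" "2 * d \<le> d2" using d1(1) d2(1) by (auto simp: d_def)
  have close: "dist (x, y) (u0, v0) < 2 * d" if "u0 < x" "x < u0 + d" "v0 < y" "y < v0 + d" for x y
  proof -
    have "dist (x, y) (u0, v0) \<le> \<bar>x - u0\<bar> + \<bar>y - v0\<bar>"
      using sqrt_sum_squares_le_sum_abs by (simp add: dist_Pair_Pair dist_real_def)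
    then show ?thesis using that by simp
  qed
  define \<Delta> where "\<Delta> = h (u0 + d) (v0 + d) - h (u0 + d) v0 - (h u0 (v0 + d) - h u0 v0)"
  have "\<exists>x. u0 < x \<and> x < u0 + d \<and> \<Delta> = d * (hu x (v0 + d) - hu x v0)"
    using MVT2[of u0 "u0 + d" "\<lambda>x. h x (v0 + d) - h x v0", OF _ DERIV_diff[OF hu hu]] d(1)
    by (simp add: \<Delta>_def)
  then obtain x where x: "u0 < x" "x < u0 + d" "\<Delta> = d * (hu x (v0 + d) - hu x v0)" by blast
  obtain y where y: "v0 < y" "y < v0 + d" "hu x (v0 + d) - hu x v0 = d * huv x y"
    using MVT2[of v0 "v0 + d" "hu x" "huv x"] d(1) huv by auto
  have "\<exists>y. v0 < y \<and> y < v0 + d \<and> \<Delta> = d * (hv (u0 + d) y - hv u0 y)"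
    using MVT2[of v0 "v0 + d" "\<lambda>y. h (u0 + d) y - h u0 y", OF _ DERIV_diff[OF hv hv]] d(1)
    by (simp add: \<Delta>_def algebra_simps)
  then obtain y' where y': "v0 < y'" "y' < v0 + d" "\<Delta> = d * (hv (u0 + d) y' - hv u0 y')" by blast
  obtain x' where x': "u0 < x'" "x' < u0 + d" "hv (u0 + d) y' - hv u0 y' = d * hvu x' y'"
    using MVT2[of u0 "u0 + d" "\<lambda>s. hv s y'" "\<lambda>s. hvu s y'"] d(1) hvu by auto
  have "huv x y = hvu x' y'" using x(3) y(3) y'(3) x'(3) d(1) by simp
  moreover have "\<bar>huv x y - huv u0 v0\<bar> < \<epsilon>" using d1(2)[of "(x, y)"] close[OF x(1,2) y(1,2)] d by simp
  moreover have "\<bar>hvu x' y' - hvu u0 v0\<bar> < \<epsilon>" using d2(2)[of "(x', y')"] close[OF x'(1,2) y'(1,2)] d by simp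
  moreover have "\<bar>huv u0 v0 - hvu u0 v0\<bar> = 2 * \<epsilon>" by (simp add: \<epsilon>_def)
  ultimately show False by linarith
qed

section \<open>Partial derivatives of maps on the plane\<close>

lemma smooth_on_imp_differentiable: "smooth_on U f \<Longrightarrow> x \<in> U \<Longrightarrow> f differentiable (at x)"
  unfolding smooth_on_def by (metis Ck_on.simps(2))

lemma smooth_on_frechet: "smooth_on U f \<Longrightarrow> smooth_on U (\<lambda>x. frechet_derivative f (at x) v)"
  unfolding smooth_on_def by (metis Ck_on.simps(2))

lemma smooth_on_imp_continuous_on: "smooth_on U f \<Longrightarrow> continuous_on U f"
  unfolding smooth_on_def by (metis Ck_on.simps(1))

lemma smooth_on_du: "smooth_on U f \<Longrightarrow> smooth_on U (du f)"
  unfolding du_def[abs_def] by (rule smooth_on_frechet)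

lemma smooth_on_dv: "smooth_on U f \<Longrightarrow> smooth_on U (dv f)"
  unfolding dv_def[abs_def] by (rule smooth_on_frechet)

lemma du_has_vector_derivative:
  assumes "f differentiable (at (u, v))"
  shows "((\<lambda>s. f (s, v)) has_vector_derivative du f (u, v)) (at u)"
proof -
  have f: "(f has_derivative frechet_derivative f (at (u, v))) (at (u, v))"
    using assms by (simp add: frechet_derivative_works)
  have "((\<lambda>s. (s, v)) has_derivative (\<lambda>h. (h, 0))) (at u)"
    by (auto intro!: derivative_eq_intros)
  from has_derivative_compose[OF this f]
  show ?thesis unfolding has_vector_derivative_def du_def
  proof (rule has_derivative_eq_rhs)
    show "(\<lambda>h. frechet_derivative f (at (u, v)) (h, 0)) = (\<lambda>h. h *\<^sub>R frechet_derivative f (at (u, v)) (1, 0))"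
      by (subst linear_cmul[OF has_derivative_linear[OF f], symmetric]) simp
  qed
qed

lemma dv_has_vector_derivative:
  assumes "f differentiable (at (u, v))"
  shows "((\<lambda>t. f (u, t)) has_vector_derivative dv f (u, v)) (at v)"
proof -
  have f: "(f has_derivative frechet_derivative f (at (u, v))) (at (u, v))"
    using assms by (simp add: frechet_derivative_works)
  have "((\<lambda>t. (u, t)) has_derivative (\<lambda>h. (0, h))) (at v)"
    by (auto intro!: derivative_eq_intros)
  from has_derivative_compose[OF this f]
  show ?thesis unfolding has_vector_derivative_def dv_def
  proof (rule has_derivative_eq_rhs)
    show "(\<lambda>h. frechet_derivative f (at (u, v)) (0, h)) = (\<lambda>h. h *\<^sub>R frechet_derivative f (at (u, v)) (0, 1))"
      by (subst linear_cmul[OF has_derivative_linear[OF f], symmetric]) simp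
  qed
qed

lemma du_dv_commute:
  assumes G: "smooth_on UNIV G"
  shows "du (dv G) (u, v) = dv (du G) (u, v)"
proof (rule euclidean_eqI)
  fix b :: "complex \<times> complex"
  have inner: "((\<lambda>t. g t \<bullet> b) has_real_derivative g' \<bullet> b) (at t)"
    if "(g has_vector_derivative g') (at t)" for g g' t
    using bounded_linear.has_vector_derivative[OF bounded_linear_inner_left that]
    by (simp add: has_real_derivative_iff_has_vector_derivative)
  note d = smooth_on_imp_differentiable[OF _ UNIV_I]
  have c: "isCont (\<lambda>(u, v). g (u, v) \<bullet> b) (u, v)" if "smooth_on UNIV g" for g :: "real \<times> real \<Rightarrow> complex \<times> complex"
    using smooth_on_imp_continuous_on[OF that]
    by (simp add: case_prod_unfold continuous_on_eq_continuous_at continuous_inner)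
  show "du (dv G) (u, v) \<bullet> b = dv (du G) (u, v) \<bullet> b"
    by (rule sym, rule mixed_partials_eq[where h = "\<lambda>u v. G (u, v) \<bullet> b" and hu = "\<lambda>u v. du G (u, v) \<bullet> b"
          and hv = "\<lambda>u v. dv G (u, v) \<bullet> b" and huv = "\<lambda>u v. dv (du G) (u, v) \<bullet> b"
          and hvu = "\<lambda>u v. du (dv G) (u, v) \<bullet> b"])
      (intro inner du_has_vector_derivative dv_has_vector_derivative d c smooth_on_du smooth_on_dv G)+
qed

text \<open>The one-forms \<open>k\<^sub>i du + m\<^sub>i dv\<close> are the differentials of the coordinates of an isometric map
  from the metric \<open>e du\<^sup>2 + r dv\<^sup>2\<close> to the plane. The \<open>u\<close>-curves are geodesics, so they are mapped
  to straight lines and \<open>m\<^sub>i\<close> is an affine function of the arc length along them; being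
  periodic, it is constant.\<close>

lemma flat_warped_metric_constant:
  fixes k m n l :: "bool \<Rightarrow> real \<Rightarrow> real \<Rightarrow> real" and e r :: "real \<Rightarrow> real"
  assumes ke: "\<And>u v. (k True u v)\<^sup>2 + (k False u v)\<^sup>2 = e u"
    and km: "\<And>u v. k True u v * m True u v + k False u v * m False u v = 0"
    and mr: "\<And>u v. (m True u v)\<^sup>2 + (m False u v)\<^sup>2 = r u"
    and pos: "\<And>u. e u > 0" "\<And>u. r u > 0"
    and ku: "\<And>i u v. ((\<lambda>s. k i s v) has_real_derivative l i u v) (at u)"
    and kv: "\<And>i u v. (k i u has_real_derivative n i u v) (at v)"
    and mu: "\<And>i u v. ((\<lambda>s. m i s v) has_real_derivative n i u v) (at u)"
    and per: "\<And>i v. m i 1 v = m i 0 v"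
  shows "r u = r 0"
proof -
  have kn: "k True u v * n True u v + k False u v * n False u v = 0" for u v
  proof -
    have "((\<lambda>t. (k True u t)\<^sup>2 + (k False u t)\<^sup>2) has_real_derivative
        2 * (k True u v * n True u v + k False u v * n False u v)) (at v)"
      by (auto intro!: derivative_eq_intros kv simp: algebra_simps)
    moreover have "((\<lambda>t. (k True u t)\<^sup>2 + (k False u t)\<^sup>2) has_real_derivative 0) (at v)"
      unfolding ke by simp
    ultimately show ?thesis using DERIV_unique by fastforce
  qed
  have lm: "l True u v * m True u v + l False u v * m False u v = 0" for u v
  proof -
    have "((\<lambda>s. k True s v * m True s v + k False s v * m False s v) has_real_derivative
        (l True u v * m True u v + k True u v * n True u v) +
        (l False u v * m False u v + k False u v * n False u v)) (at u)"
      by (auto intro!: derivative_eq_intros ku mu simp: algebra_simps)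
    moreover have "((\<lambda>s. k True s v * m True s v + k False s v * m False s v) has_real_derivative 0) (at u)"
      unfolding km by simp
    ultimately have "(l True u v * m True u v + k True u v * n True u v) +
        (l False u v * m False u v + k False u v * n False u v) = 0" using DERIV_unique by fastforce
    then show ?thesis using kn[of u v] by simp
  qed
  \<comment> \<open>In the plane, k and l are both orthogonal to the nonzero vector m, hence
    parallel.\<close>
  have kl: "k True u v * l False u v = k False u v * l True u v" for u v
  proof -
    have "(k True u v * l False u v - k False u v * l True u v) * ((m True u v)\<^sup>2 + (m False u v)\<^sup>2) = 0"
      using km[of u v] lm[of u v] by algebra
    then show ?thesis using mr[of u v] pos(2)[of u] by simp
  qed
  \<comment> \<open>The unit direction of the image of a u-curve. Its u-derivative vanishes because
    \<open>l\<close>, the u-derivative of k, is parallel to k: the image is straight.\<close>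
  define c where "c i u v = k i u v / sqrt (e u)" for i u v
  have cu: "((\<lambda>s. c i s v) has_real_derivative 0) (at u)" for i u v
  proof -
    have "((\<lambda>s. (k True s v)\<^sup>2 + (k False s v)\<^sup>2) has_real_derivative
        2 * (k True u v * l True u v + k False u v * l False u v)) (at u)"
      by (auto intro!: derivative_eq_intros ku simp: algebra_simps)
    then have "(e has_real_derivative 2 * (k True u v * l True u v + k False u v * l False u v)) (at u)"
      unfolding ke by simp
    from DERIV_chain2[OF DERIV_real_sqrt[OF pos(1)] this]
    have s: "((\<lambda>s. sqrt (e s)) has_real_derivative
        (k True u v * l True u v + k False u v * l False u v) / sqrt (e u)) (at u)"
      by (rule DERIV_cong) (use pos(1)[of u] in \<open>simp add: field_simps\<close>)
    have "sqrt (e u) \<noteq> 0" using pos(1)[of u] by simp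
    from DERIV_divide[OF ku s this]
    have "((\<lambda>s. c i s v) has_real_derivative (l i u v * sqrt (e u) -
        k i u v * ((k True u v * l True u v + k False u v * l False u v) / sqrt (e u))) /
        (sqrt (e u) * sqrt (e u))) (at u)" by (simp add: c_def)
    moreover have "l i u v * sqrt (e u) -
        k i u v * ((k True u v * l True u v + k False u v * l False u v) / sqrt (e u)) = 0"
    proof -
      have "l i u v * e u = k i u v * (k True u v * l True u v + k False u v * l False u v)"
      proof -
        have "l True u v * e u = k True u v * (k True u v * l True u v + k False u v * l False u v)"
          unfolding ke[of u v, symmetric] using kl[of u v] by algebra
        moreover have "l False u v * e u = k False u v * (k True u v * l True u v + k False u v * l False u v)"
          unfolding ke[of u v, symmetric] using kl[of u v] by algebra
        ultimately show ?thesis by (cases i) auto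
      qed
      moreover have "sqrt (e u) * (sqrt (e u) * l i u v) = l i u v * e u"
        using pos(1)[of u] by (simp flip: mult.assoc)
      ultimately show ?thesis using pos(1)[of u] by (simp add: field_simps)
    qed
    ultimately show ?thesis by simp
  qed
  have c0: "c i u v = c i 0 v" for i u v
    using DERIV_isconst_all[of "\<lambda>s. c i s v" u 0] cu by blast
  \<comment> \<open>Since e depends on u alone, this quotient is the v-derivative of c, which does
    not depend on u. Thus n vanishes for all u as soon as it vanishes for one.\<close>
  have n0: "n i u v / sqrt (e u) = n i 0 v / sqrt (e 0)" for i u v
  proof -
    have d: "(c i u has_real_derivative n i u v / sqrt (e u)) (at v)" for u
      unfolding c_def using kv by (rule DERIV_cdivide)
    have "c i u = c i 0" using c0 by auto
    then show ?thesis using DERIV_unique[OF d[of u]] d[of 0] by simp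
  qed
  have n: "n i u v = 0" for i u v
  proof -
    \<comment> \<open>Rolle's theorem on one period of m supplies the zero of n.\<close>
    obtain z where z: "n i z v = 0"
      using MVT2[of 0 1 "\<lambda>s. m i s v" "\<lambda>s. n i s v"] mu per[of i v] by auto
    have "n i 0 v = 0" using n0[of i z v] pos(1)[of 0] z by simp
    then show ?thesis using n0[of i u v] pos(1)[of u] by simp
  qed
  have "m i u v = m i 0 v" for i v
    using DERIV_isconst_all[of "\<lambda>s. m i s v" u 0] mu[of i v] unfolding n by blast
  then show ?thesis using mr by metis
qed

section \<open>Images of surfaces under isometries, and the Clifford torus\<close>

lemma isometry_compose_smooth:
  assumes "smooth_on UNIV f" "\<And>x. f x \<in> ellipsoid a" "ellipsoid_isometry a \<phi>"
  shows "smooth_on UNIV (\<lambda>x. \<phi> (f x))"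
proof (rule smooth_on_local)
  fix x
  have "smooth_on_subset (ellipsoid a) \<phi>" using assms(3) by (simp add: ellipsoid_isometry_def)
  then obtain U F where U: "open U" "f x \<in> U" and F: "smooth_on U F" "\<And>q. q \<in> ellipsoid a \<inter> U \<Longrightarrow> F q = \<phi> q"
    using assms(2)[of x] unfolding smooth_on_subset_def by metis
  have V: "open (f -` U)" "x \<in> f -` U"
    using U smooth_on_imp_continuous_on[OF assms(1)] by (auto intro: open_vimage)
  have "smooth_on (f -` U) (\<lambda>x. F (f x))"
    using assms(1) Ck_on_mono[OF _ subset_UNIV]
    by (intro smooth_on_compose[OF V(1) _ F(1)]) (auto simp: smooth_on_def)
  then have "smooth_on (f -` U) (\<lambda>x. \<phi> (f x))"
    using smooth_on_cong[OF V(1), of "\<lambda>x. F (f x)" "\<lambda>x. \<phi> (f x)"] F(2) assms(2) by auto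
  then show "\<exists>V. open V \<and> x \<in> V \<and> smooth_on V (\<lambda>x. \<phi> (f x))" using V by blast
qed

lemma isometry_compose_metric:
  assumes "smooth_on UNIV f" "\<And>x. f x \<in> ellipsoid a" "ellipsoid_isometry a \<phi>"
  defines "G \<equiv> \<lambda>x. \<phi> (f x)"
  shows "du G x \<bullet> du G x = du f x \<bullet> du f x" "du G x \<bullet> dv G x = du f x \<bullet> dv f x"
    "dv G x \<bullet> dv G x = dv f x \<bullet> dv f x"
proof -
  obtain u v where x: "x = (u, v)" by fastforce
  have df: "f differentiable (at (u, v))" by (rule smooth_on_imp_differentiable[OF assms(1) UNIV_I])
  have dG: "G differentiable (at (u, v))" unfolding G_def
    by (rule smooth_on_imp_differentiable[OF isometry_compose_smooth[OF assms(1-3)] UNIV_I])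
  obtain D where D: "(\<phi> has_derivative D) (at (f x) within ellipsoid a)"
    and iso: "\<And>v w. v \<in> ellipsoid_tangent a (f x) \<Longrightarrow> w \<in> ellipsoid_tangent a (f x) \<Longrightarrow> D v \<bullet> D w = v \<bullet> w"
    using assms(2,3) unfolding ellipsoid_isometry_def by metis
  have chain: "((\<lambda>t. \<phi> (\<gamma> t)) has_vector_derivative D \<gamma>') (at t)"
    if "\<gamma> t = f x" "\<And>t. \<gamma> t \<in> ellipsoid a" "(\<gamma> has_vector_derivative \<gamma>') (at t)" for \<gamma> \<gamma>' t
  proof -
    have "(\<phi> has_derivative D) (at (\<gamma> t) within range \<gamma>)"
      using D unfolding that(1) by (rule has_derivative_subset) (use that in auto)
    from has_derivative_in_compose[OF that(3)[unfolded has_vector_derivative_def] this] show ?thesis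
      by (simp add: has_vector_derivative_def linear_cmul[OF has_derivative_linear[OF D]])
  qed
  note fu = du_has_vector_derivative[OF df] and fv = dv_has_vector_derivative[OF df]
  have "du G x = D (du f x)"
    using chain[OF _ _ fu] du_has_vector_derivative[OF dG] assms(2) vector_derivative_unique_at
    unfolding G_def x by blast
  moreover have "dv G x = D (dv f x)"
    using chain[OF _ _ fv] dv_has_vector_derivative[OF dG] assms(2) vector_derivative_unique_at
    unfolding G_def x by blast
  moreover have "du f x \<in> ellipsoid_tangent a (f x)" "dv f x \<in> ellipsoid_tangent a (f x)"
    using ellipsoid_curve_tangent[OF _ _ _ fu, of a] ellipsoid_curve_tangent[OF _ _ _ fv, of a] assms(2)
    unfolding x by auto
  ultimately show "du G x \<bullet> du G x = du f x \<bullet> du f x" "du G x \<bullet> dv G x = du f x \<bullet> dv f x"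
    "dv G x \<bullet> dv G x = dv f x \<bullet> dv f x" using iso by metis+
qed

lemma orthogonal_complex_parallel:
  fixes z w :: complex
  assumes "z \<noteq> 0" "z \<bullet> w = 0"
  shows "w = ((w \<bullet> (\<i> * z)) / (z \<bullet> z)) *\<^sub>R (\<i> * z)"
proof -
  have n: "Re z * Re z + Im z * Im z \<noteq> 0"
    using assms(1) by (metis complex_eq_iff sum_squares_eq_zero_iff zero_complex.simps)
  have o: "Re z * Re w + Im z * Im w = 0" using assms(2) by (simp add: inner_complex_def)
  show ?thesis
  proof (rule complex_eqI)
    have "Re w * (Re z * Re z + Im z * Im z) = - ((Im w * Re z - Re w * Im z) * Im z)"
      using o by algebra
    then show "Re w = Re (((w \<bullet> (\<i> * z)) / (z \<bullet> z)) *\<^sub>R (\<i> * z))"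
      using n by (simp add: inner_complex_def field_simps)
    have "Im w * (Re z * Re z + Im z * Im z) = (Im w * Re z - Re w * Im z) * Re z"
      using o by algebra
    then show "Im w = Im (((w \<bullet> (\<i> * z)) / (z \<bullet> z)) *\<^sub>R (\<i> * z))"
      using n by (simp add: inner_complex_def field_simps)
  qed
qed

text \<open>Both vectors are real multiples of \<i> * z. For tangent vectors of a circle this turns
  inner products into products of coefficients, and a quarter turn makes any two of them
  orthogonal.\<close>

lemma orthogonal_complex_inner:
  fixes z w w' :: complex
  assumes "z \<noteq> 0" "z \<bullet> w = 0" "z \<bullet> w' = 0"
  shows "w \<bullet> w' = (w \<bullet> (\<i> * z)) * (w' \<bullet> (\<i> * z)) / (z \<bullet> z)" "w \<bullet> (\<i> * w') = 0"
proof -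
  define c c' where "c = (w \<bullet> (\<i> * z)) / (z \<bullet> z)" and "c' = (w' \<bullet> (\<i> * z)) / (z \<bullet> z)"
  have w: "w = c *\<^sub>R (\<i> * z)" "w' = c' *\<^sub>R (\<i> * z)"
    unfolding c_def c'_def using orthogonal_complex_parallel assms by blast+
  have zz: "(\<i> * z) \<bullet> (\<i> * z) = z \<bullet> z" by (simp add: inner_complex_def algebra_simps)
  have "w \<bullet> w' = c * c' * (z \<bullet> z)" using w zz by (metis inner_scaleR_left inner_scaleR_right mult.assoc)
  also have "\<dots> = (w \<bullet> (\<i> * z)) * (w' \<bullet> (\<i> * z)) / (z \<bullet> z)"
    using assms(1) by (simp add: c_def c'_def)
  finally show "w \<bullet> w' = (w \<bullet> (\<i> * z)) * (w' \<bullet> (\<i> * z)) / (z \<bullet> z)" .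
  have "(c *\<^sub>R (\<i> * z)) \<bullet> (\<i> * (c' *\<^sub>R (\<i> * z))) = 0"
    by (simp add: inner_complex_def algebra_simps)
  then show "w \<bullet> (\<i> * w') = 0" using w by metis
qed

text \<open>Composing f with the isometry gives a map G into a product of two circles, with the same
  induced metric e du^2 + r dv^2. The components of \<open>du G\<close> and \<open>dv G\<close>
  along the circles are the coefficients of two closed one-forms, and
  \<open>flat_warped_metric_constant\<close> forces r to be constant. Working with the forms avoids
  lifting G to the plane.\<close>

lemma not_congruent_clifford_torus:
  assumes a: "a > 0" and f: "smooth_on UNIV f" "\<And>x. f x \<in> ellipsoid a"
    and e: "\<And>u v. du f (u, v) \<bullet> du f (u, v) = e u" "\<And>u. e u > 0"
    and r: "\<And>u v. dv f (u, v) \<bullet> dv f (u, v) = r u" "\<And>u. r u > 0"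
    and orth: "\<And>u v. du f (u, v) \<bullet> dv f (u, v) = 0"
    and per: "\<And>v. f (1, v) = f (0, v)"
    and nonconst: "r u \<noteq> r 0"
  shows "\<not> congruent_in_ellipsoid a (range f) (clifford_torus a)"
proof
  assume "congruent_in_ellipsoid a (range f) (clifford_torus a)"
  then obtain \<phi> where \<phi>: "ellipsoid_isometry a \<phi>" "\<phi> ` range f = clifford_torus a"
    unfolding congruent_in_ellipsoid_def by blast
  define G where "G x = \<phi> (f x)" for x
  have G: "smooth_on UNIV G" unfolding G_def by (rule isometry_compose_smooth[OF f \<phi>(1)])
  have metric: "du G x \<bullet> du G x = du f x \<bullet> du f x" "du G x \<bullet> dv G x = du f x \<bullet> dv f x"
    "dv G x \<bullet> dv G x = dv f x \<bullet> dv f x" for x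
    unfolding G_def[abs_def] using isometry_compose_metric[OF f \<phi>(1)] by blast+
  have GC: "G x \<in> clifford_torus a" for x using \<phi>(2) by (auto simp: G_def)
  define P :: "bool \<Rightarrow> complex \<times> complex \<Rightarrow> complex" where "P i = (if i then fst else snd)" for i
  \<comment> \<open>The reciprocal radii of the two circles, so that \<open>q i\<close> times \<i> *
    P i (G x) is a unit tangent vector.\<close>
  define q where "q i = (if i then sqrt 2 / a else sqrt 2)" for i
  have P: "bounded_linear (P i)" for i by (auto simp: P_def bounded_linear_fst bounded_linear_snd)
  have q: "q i > 0" for i using a by (simp add: q_def)
  have PG: "P i (G x) \<bullet> P i (G x) = 1 / (q i)\<^sup>2" for i x
    using GC[of x] a by (cases i; cases "G x")
      (auto simp: clifford_torus_def P_def q_def power2_norm_eq_inner[symmetric] field_simps)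
  have PG0: "P i (G x) \<noteq> 0" for i x using PG[of i x] q[of i] by auto
  have Gd: "g differentiable (at x)" if "smooth_on UNIV g" for g :: "real \<times> real \<Rightarrow> complex \<times> complex" and x
    by (rule smooth_on_imp_differentiable[OF that UNIV_I])
  have Pu: "((\<lambda>s. P i (g (s, v))) has_vector_derivative P i (du g (u, v))) (at u)"
    and Pv: "((\<lambda>t. P i (g (u, t))) has_vector_derivative P i (dv g (u, v))) (at v)"
    if "smooth_on UNIV g" for g i u v
    using bounded_linear.has_vector_derivative[OF P du_has_vector_derivative[OF Gd[OF that]]]
      bounded_linear.has_vector_derivative[OF P dv_has_vector_derivative[OF Gd[OF that]]] by blast+
  have tangent: "h t \<bullet> h' = 0" if "(h has_vector_derivative h') (at t)" "\<And>t. h t \<bullet> h t = c"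
    for h :: "real \<Rightarrow> complex" and h' t c
  proof -
    have "((\<lambda>t. h t \<bullet> h t) has_vector_derivative h t \<bullet> h' + h' \<bullet> h t) (at t)"
      by (rule bounded_bilinear.has_vector_derivative[OF bounded_bilinear_inner that(1) that(1)])
    then show ?thesis unfolding that(2)
      using vector_derivative_unique_at[OF _ has_vector_derivative_const] by (fastforce simp: inner_commute)
  qed
  have ou: "P i (G (u, v)) \<bullet> P i (du G (u, v)) = 0" and ov: "P i (G (u, v)) \<bullet> P i (dv G (u, v)) = 0" for i u v
    using tangent[OF Pu[OF G, of i v u]] tangent[OF Pv[OF G, of i u v]] PG by blast+
  define J where "J g i u v = q i * (P i (g (u, v)) \<bullet> (\<i> * P i (G (u, v))))" for g i u v
  have sum: "w \<bullet> w' = P True w \<bullet> P True w' + P False w \<bullet> P False w'" for w w'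
    by (simp add: P_def inner_prod_def)
  have JJ: "P i (g (u, v)) \<bullet> P i (g' (u, v)) = J g i u v * J g' i u v"
    if "g \<in> {du G, dv G}" "g' \<in> {du G, dv G}" for g g' i u v
  proof -
    have "P i (G (u, v)) \<bullet> P i (g (u, v)) = 0" "P i (G (u, v)) \<bullet> P i (g' (u, v)) = 0"
      using ou ov that by auto
    from orthogonal_complex_inner(1)[OF PG0 this] show ?thesis
      unfolding PG J_def by (simp add: power2_eq_square)
  qed
  \<comment> \<open>When \<open>J\<close> is differentiated, the turning of the unit tangent
    contributes terms of this form; they vanish because both vectors are tangent to the same
    circle.\<close>
  have JJ0: "P i (g (u, v)) \<bullet> (\<i> * P i (g' (u, v))) = 0"
    if "g \<in> {du G, dv G}" "g' \<in> {du G, dv G}" for g g' i u v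
    by (rule orthogonal_complex_inner(2)[OF PG0[of i "(u, v)"]]) (use ou ov that in auto)
  have deriv: "((\<lambda>t. c * (h t \<bullet> (\<i> * H t))) has_real_derivative
      c * (h t \<bullet> (\<i> * H') + h' \<bullet> (\<i> * H t))) (at t)"
    if "(h has_vector_derivative h') (at t)" "(H has_vector_derivative H') (at t)"
    for h H :: "real \<Rightarrow> complex" and h' H' t c
  proof -
    have "((\<lambda>t. \<i> * H t) has_vector_derivative \<i> * H') (at t)"
      by (rule has_vector_derivative_mult_right[OF that(2)])
    from bounded_bilinear.has_vector_derivative[OF bounded_bilinear_inner that(1) this] show ?thesis
      by (intro DERIV_cmult) (simp add: has_real_derivative_iff_has_vector_derivative)
  qed
  have "r u = r 0"
  proof (rule flat_warped_metric_constant[where k = "J (du G)" and m = "J (dv G)" and e = e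
        and n = "J (dv (du G))"
        and l = "\<lambda>i u v. q i * (P i (du G (u, v)) \<bullet> (\<i> * P i (du G (u, v))) + P i (du (du G) (u, v)) \<bullet> (\<i> * P i (G (u, v))))"])
    show "(J (du G) True u v)\<^sup>2 + (J (du G) False u v)\<^sup>2 = e u" for u v
      using metric(1)[of "(u, v)"] e(1)[of u v] by (simp add: sum JJ power2_eq_square)
    show "J (du G) True u v * J (dv G) True u v + J (du G) False u v * J (dv G) False u v = 0" for u v
      using metric(2)[of "(u, v)"] orth[of u v] by (simp add: sum JJ)
    show "(J (dv G) True u v)\<^sup>2 + (J (dv G) False u v)\<^sup>2 = r u" for u v
      using metric(3)[of "(u, v)"] r(1)[of u v] by (simp add: sum JJ power2_eq_square)
    show "((\<lambda>s. J (du G) i s v) has_real_derivative q i * (P i (du G (u, v)) \<bullet> (\<i> * P i (du G (u, v))) + P i (du (du G) (u, v)) \<bullet> (\<i> * P i (G (u, v))))) (at u)" for i u v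
      unfolding J_def by (rule deriv[OF Pu Pu]) (intro smooth_on_du G)+
    show "(J (du G) i u has_real_derivative J (dv (du G)) i u v) (at v)" for i u v
    proof -
      have "((\<lambda>t. J (du G) i u t) has_real_derivative q i * (P i (du G (u, v)) \<bullet> (\<i> * P i (dv G (u, v))) + P i (dv (du G) (u, v)) \<bullet> (\<i> * P i (G (u, v))))) (at v)"
        unfolding J_def by (rule deriv[OF Pv Pv]) (intro smooth_on_du G)+
      then show ?thesis by (simp add: JJ0 J_def[of "dv (du G)"])
    qed
    \<comment> \<open>Closedness of the one-forms: the mixed second derivatives of G agree.\<close>
    show "((\<lambda>s. J (dv G) i s v) has_real_derivative J (dv (du G)) i u v) (at u)" for i u v
    proof -
      have "((\<lambda>s. J (dv G) i s v) has_real_derivative q i * (P i (dv G (u, v)) \<bullet> (\<i> * P i (du G (u, v))) + P i (du (dv G) (u, v)) \<bullet> (\<i> * P i (G (u, v))))) (at u)"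
        unfolding J_def by (rule deriv[OF Pu Pu]) (intro smooth_on_dv G)+
      then show ?thesis by (simp add: JJ0 J_def[of "dv (du G)"] du_dv_commute[OF G])
    qed
    show "J (dv G) i 1 v = J (dv G) i 0 v" for i v
    proof -
      have "G (1, t) = G (0, t)" for t by (simp add: G_def per)
      moreover have "dv G (1, v) = dv G (0, v)"
        using dv_has_vector_derivative[OF Gd[OF G], of 1 v] dv_has_vector_derivative[OF Gd[OF G], of 0 v]
        unfolding calculation by (rule vector_derivative_unique_at)
      ultimately show ?thesis by (simp add: J_def)
    qed
  qed (use e r in auto)
  then show False using nonconst by simp
qed

subsection \<open>Surfaces generated by a closed profile curve\<close>

text \<open>The constant c closes the family under partial derivatives: the u-derivative
  differentiates Z and W, while the v-derivative sets Z to 0 and multiplies c by 2 pi \<i>.\<close>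

definition rot_surface ::
    "(real \<Rightarrow> complex) \<Rightarrow> (real \<Rightarrow> real) \<Rightarrow> complex \<Rightarrow> real \<times> real \<Rightarrow> complex \<times> complex" where
  "rot_surface Z W c p = (Z (fst p), of_real (W (fst p)) * (c * cis (2 * pi * snd p)))"

lemma rot_surface_has_derivative:
  assumes "(Z has_vector_derivative Z') (at u)" "(W has_real_derivative W') (at u)"
  shows "(rot_surface Z W c has_derivative (\<lambda>h. (fst h *\<^sub>R Z', fst h *\<^sub>R (of_real W' * (c * cis (2 * pi * v))) +
    snd h *\<^sub>R (of_real (W u) * (2 * pi * \<i> * c * cis (2 * pi * v)))))) (at (u, v))"
proof -
  have f: "(fst has_derivative fst) (at (u, v))" and s: "(snd has_derivative snd) (at (u, v))"
    by (auto intro: bounded_linear_imp_has_derivative bounded_linear_fst bounded_linear_snd)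
  have Z: "((\<lambda>p. Z (fst p)) has_derivative (\<lambda>h. fst h *\<^sub>R Z')) (at (u, v))"
    using has_derivative_compose[OF f, of Z "\<lambda>h. h *\<^sub>R Z'"] assms(1) by (simp add: has_vector_derivative_def)
  have W: "((\<lambda>p. complex_of_real (W (fst p))) has_derivative (\<lambda>h. complex_of_real (W' * fst h))) (at (u, v))"
    using has_derivative_compose[OF f, of W "\<lambda>h. W' * h"] assms(2)
    by (intro has_derivative_of_real) (simp add: has_field_derivative_def)
  have "((\<lambda>t. cis (2 * pi * t)) has_derivative (\<lambda>h. (h * (2 * pi)) *\<^sub>R (\<i> * cis (2 * pi * v)))) (at v)"
    by (auto intro!: derivative_eq_intros has_derivative_cis simp: scaleR_conv_of_real mult_ac)
  from has_derivative_compose[OF s, of "\<lambda>t. cis (2 * pi * t)"] this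
  have C: "((\<lambda>p. cis (2 * pi * snd p)) has_derivative
      (\<lambda>h. (snd h * (2 * pi)) *\<^sub>R (\<i> * cis (2 * pi * v)))) (at (u, v))" by auto
  show ?thesis unfolding rot_surface_def[abs_def]
    by (rule has_derivative_eq_rhs[OF has_derivative_Pair[OF Z has_derivative_mult[OF W
      has_derivative_mult_right[OF C, of c]]]])
     (auto simp: scaleR_conv_of_real algebra_simps fun_eq_iff)
qed

lemma rot_surface_derivs:
  assumes "\<And>u. (Z has_vector_derivative Z' u) (at u)" "\<And>u. (W has_real_derivative W' u) (at u)"
  shows "du (rot_surface Z W c) = rot_surface Z' W' c"
    and "dv (rot_surface Z W c) = rot_surface (\<lambda>_. 0) W (2 * pi * \<i> * c)"
  unfolding du_def dv_def frechet_derivative_at[OF rot_surface_has_derivative[OF assms], symmetric]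
  by (auto simp: rot_surface_def fun_eq_iff
      frechet_derivative_at[OF rot_surface_has_derivative[OF assms], symmetric])

lemma inner_mult_cis: "(z * cis t) \<bullet> (w * cis t) = z \<bullet> w"
proof -
  have "(z * cis t) \<bullet> (w * cis t) = Re (z * cnj w * (cis t * cnj (cis t)))"
    by (simp add: inner_complex_def algebra_simps)
  also have "cis t * cnj (cis t) = 1" by (simp add: cis_cnj cis_mult)
  finally show ?thesis by (simp add: inner_complex_def)
qed

text \<open>The minimal surface equation for the profile \<open>x = r\<^sup>2 = 1 - W\<^sup>2\<close> with
  \<open>(x')\<^sup>2 = y\<^sup>2 = \<sigma>\<^sup>2 (x (1 - x) - \<epsilon>\<^sup>2)\<close>; the normal is \<open>(\<alpha> + i \<gamma>, \<beta>)\<close> in the rotating frame.\<close>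

lemma minimal_equation:
  fixes r W h :: real
  assumes pos: "a > 0" "r > 0" "W > 0" "h > 0" "\<theta>1 \<noteq> 0"
    and rW: "r\<^sup>2 + W\<^sup>2 = 1" and h: "h\<^sup>2 = a\<^sup>2 * W\<^sup>2 + r\<^sup>2"
    and y: "y\<^sup>2 = \<sigma>\<^sup>2 * (r\<^sup>2 * W\<^sup>2 - \<epsilon>\<^sup>2)" and x2: "x2 = \<sigma>\<^sup>2 * (W\<^sup>2 - r\<^sup>2) / 2"
    and \<theta>1: "a\<^sup>2 * \<theta>1\<^sup>2 = \<sigma>\<^sup>2 * \<epsilon>\<^sup>2 * h\<^sup>2 / (4 * r^4 * W\<^sup>2)"
    and \<theta>2: "\<theta>2 = \<theta>1 * y * ((1 - a\<^sup>2) / (2 * h\<^sup>2) - 1 / r\<^sup>2 + 1 / (2 * W\<^sup>2))"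
    and \<rho>: "\<rho> = a * r" "\<rho>1 = a * y / (2 * r)" "\<rho>2 = a * (x2 / (2 * r) - y\<^sup>2 / (4 * r^3))"
    and W: "W1 = - y / (2 * W)" "W2 = - x2 / (2 * W) - y\<^sup>2 / (4 * W^3)"
    and tan: "\<rho> * \<alpha> / a\<^sup>2 + W * \<beta> = 0" and nor: "\<rho>1 * \<alpha> + \<rho> * \<theta>1 * \<gamma> + W1 * \<beta> = 0"
  shows "W * ((\<rho>2 - \<rho> * \<theta>1\<^sup>2) * \<alpha> + (2 * \<rho>1 * \<theta>1 + \<rho> * \<theta>2) * \<gamma> + W2 * \<beta>) =
    (\<rho>1\<^sup>2 + \<rho>\<^sup>2 * \<theta>1\<^sup>2 + W1\<^sup>2) * \<beta>"
proof -
  \<comment> \<open>Tangency to the ellipsoid gives \<alpha> and orthogonality to the u-derivative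
    gives \<gamma>, both as multiples of \<beta>; what remains is to compare coefficients of
    \<beta>.\<close>
  have \<alpha>: "\<alpha> = - a * W * \<beta> / r" using tan pos unfolding \<rho> by (simp add: field_simps power2_eq_square)
  have "\<rho> * \<theta>1 * \<gamma> = (a\<^sup>2 * W\<^sup>2 + r\<^sup>2) * y * \<beta> / (2 * r\<^sup>2 * W)"
    using nor pos unfolding \<alpha> \<rho> W by (simp add: field_simps power2_eq_square)
  then have \<gamma>: "\<rho> * \<theta>1 * \<gamma> = h\<^sup>2 * y * \<beta> / (2 * r\<^sup>2 * W)" by (simp add: h)
  have "2 * \<rho>1 * \<theta>1 + \<rho> * \<theta>2 = \<rho> * \<theta>1 * (y / r\<^sup>2 + y * ((1 - a\<^sup>2) / (2 * h\<^sup>2) - 1 / r\<^sup>2 + 1 / (2 * W\<^sup>2)))"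
    using pos unfolding \<rho> \<theta>2 by (simp add: field_simps power2_eq_square)
  also have "y / r\<^sup>2 + y * ((1 - a\<^sup>2) / (2 * h\<^sup>2) - 1 / r\<^sup>2 + 1 / (2 * W\<^sup>2)) =
      y * (((1 - a\<^sup>2) * W\<^sup>2 + h\<^sup>2) / (2 * h\<^sup>2 * W\<^sup>2))"
    using pos by (simp add: field_simps)
  \<comment> \<open>The value of h^2 together with r^2 + W^2 = 1 collapses this numerator, leaving a
    \<gamma>-term without h.\<close>
  also have "(1 - a\<^sup>2) * W\<^sup>2 + h\<^sup>2 = 1" using rW h by algebra
  finally have "(2 * \<rho>1 * \<theta>1 + \<rho> * \<theta>2) * \<gamma> = (\<rho> * \<theta>1 * \<gamma>) * (y * (1 / (2 * h\<^sup>2 * W\<^sup>2)))" by simp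
  also have "\<dots> = y\<^sup>2 * \<beta> / (4 * r\<^sup>2 * W^3)"
    unfolding \<gamma> using pos by (simp add: field_simps power2_eq_square power3_eq_cube)
  finally have g: "(2 * \<rho>1 * \<theta>1 + \<rho> * \<theta>2) * \<gamma> = y\<^sup>2 * \<beta> / (4 * r\<^sup>2 * W^3)" .
  have A: "W * ((\<rho>2 - \<rho> * \<theta>1\<^sup>2) * \<alpha>) =
      (- (a\<^sup>2 * W\<^sup>2 * x2 / (2 * r\<^sup>2)) + a\<^sup>2 * W\<^sup>2 * y\<^sup>2 / (4 * r^4) + W\<^sup>2 * (a\<^sup>2 * \<theta>1\<^sup>2)) * \<beta>"
    using pos unfolding \<alpha> \<rho> by (simp add: field_simps power2_eq_square power3_eq_cube power4_eq_xxxx)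
  have B: "W * (y\<^sup>2 * \<beta> / (4 * r\<^sup>2 * W^3) + W2 * \<beta>) = (y\<^sup>2 / (4 * r\<^sup>2 * W\<^sup>2) - x2 / 2 - y\<^sup>2 / (4 * W\<^sup>2)) * \<beta>"
    using pos unfolding W by (simp add: field_simps power2_eq_square power3_eq_cube)
  have C: "\<rho>1\<^sup>2 + \<rho>\<^sup>2 * \<theta>1\<^sup>2 + W1\<^sup>2 = a\<^sup>2 * y\<^sup>2 / (4 * r\<^sup>2) + r\<^sup>2 * (a\<^sup>2 * \<theta>1\<^sup>2) + y\<^sup>2 / (4 * W\<^sup>2)"
    using pos unfolding \<rho> W by (simp add: field_simps power2_eq_square)
  have D: "- (a\<^sup>2 * W\<^sup>2 * x2 / (2 * r\<^sup>2)) + a\<^sup>2 * W\<^sup>2 * y\<^sup>2 / (4 * r^4) + W\<^sup>2 * (a\<^sup>2 * \<theta>1\<^sup>2) +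
      (y\<^sup>2 / (4 * r\<^sup>2 * W\<^sup>2) - x2 / 2 - y\<^sup>2 / (4 * W\<^sup>2)) -
      (a\<^sup>2 * y\<^sup>2 / (4 * r\<^sup>2) + r\<^sup>2 * (a\<^sup>2 * \<theta>1\<^sup>2) + y\<^sup>2 / (4 * W\<^sup>2)) = 0"
  proof -
    \<comment> \<open>After the given values are inserted and the denominator 4 R^2 V is cleared, D
      is a polynomial identity in R, with V = 1 - R.\<close>
    define R V where "R = r\<^sup>2" and "V = W\<^sup>2"
    have p: "R > 0" "V > 0" using pos by (auto simp: R_def V_def)
    have RV: "V = 1 - R" using rW by (simp add: R_def V_def)
    have 4: "r^4 = R\<^sup>2" by (simp add: R_def)
    have "(- (a\<^sup>2 * V * x2 / (2 * R)) + a\<^sup>2 * V * y\<^sup>2 / (4 * R\<^sup>2) + V * (\<sigma>\<^sup>2 * \<epsilon>\<^sup>2 * h\<^sup>2 / (4 * R\<^sup>2 * V)) +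
      (y\<^sup>2 / (4 * R * V) - x2 / 2 - y\<^sup>2 / (4 * V)) -
      (a\<^sup>2 * y\<^sup>2 / (4 * R) + R * (\<sigma>\<^sup>2 * \<epsilon>\<^sup>2 * h\<^sup>2 / (4 * R\<^sup>2 * V)) + y\<^sup>2 / (4 * V))) * (4 * R\<^sup>2 * V) =
      - 2 * a\<^sup>2 * V\<^sup>2 * R * x2 + a\<^sup>2 * V\<^sup>2 * y\<^sup>2 + V * (\<sigma>\<^sup>2 * \<epsilon>\<^sup>2 * h\<^sup>2) + y\<^sup>2 * R - 2 * R\<^sup>2 * V * x2 - y\<^sup>2 * R\<^sup>2
       - a\<^sup>2 * y\<^sup>2 * R * V - R * (\<sigma>\<^sup>2 * \<epsilon>\<^sup>2 * h\<^sup>2) - y\<^sup>2 * R\<^sup>2"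
      using p by (simp add: field_simps power2_eq_square)
    also have "\<dots> = 0"
      unfolding y x2 h R_def[symmetric] V_def[symmetric] RV by (simp add: field_simps power2_eq_square)
    finally show ?thesis unfolding \<theta>1 4 R_def[symmetric] V_def[symmetric] using p by simp
  qed
  have "W * ((\<rho>2 - \<rho> * \<theta>1\<^sup>2) * \<alpha> + (2 * \<rho>1 * \<theta>1 + \<rho> * \<theta>2) * \<gamma> + W2 * \<beta>) =
      W * ((\<rho>2 - \<rho> * \<theta>1\<^sup>2) * \<alpha>) + W * (y\<^sup>2 * \<beta> / (4 * r\<^sup>2 * W^3) + W2 * \<beta>)"
    unfolding g by (simp add: distrib_left)
  also have "\<dots> = (\<rho>1\<^sup>2 + \<rho>\<^sup>2 * \<theta>1\<^sup>2 + W1\<^sup>2) * \<beta>"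
    unfolding A B C distrib_right[symmetric] using D by (simp only: right_minus_eq)
  finally show ?thesis .
qed

text \<open>Write \<open>|z|\<^sup>2 = a\<^sup>2 x\<close> and \<open>|w|\<^sup>2 = 1 - x\<close>. Along a geodesic with Clairaut constant \<open>a \<epsilon>\<close> the
  coordinate \<open>x\<close> oscillates between the roots of \<open>x (1 - x) = \<epsilon>\<^sup>2\<close>, and the parameter \<open>t\<close> with \<open>x = 1/2 + k cos t\<close>,
  \<open>k\<^sup>2 = 1/4 - \<epsilon>\<^sup>2\<close>, reduces the geodesic equation to a quadrature for the angle of \<open>z\<close>.
  The parametrization of \<open>k\<close> and \<open>\<epsilon>\<close> by \<open>b\<close> makes both rational; \<open>b = 0\<close> is the Clifford torus.\<close>

definition amplitude :: "real \<Rightarrow> real" where "amplitude b = b / (1 + b\<^sup>2)"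

definition clairaut :: "real \<Rightarrow> real" where "clairaut b = (1 - b\<^sup>2) / (2 * (1 + b\<^sup>2))"

definition profile :: "real \<Rightarrow> real \<Rightarrow> real" where "profile b t = 1 / 2 + amplitude b * cos t"

text \<open>The Clairaut relation for the rescaled metric gives d\<theta>/dx = \<epsilon> h / (2 a x
  W sqrt (x (1 - x) - \<epsilon>^2)) up to sign, with h^2 = a^2 (1 - x) + x and W^2 = 1 - x. The
  last root is k |sin t|, which cancels against dx = - k sin t dt.\<close>

definition ang_speed :: "real \<Rightarrow> real \<Rightarrow> real \<Rightarrow> real" where
  "ang_speed a b t = clairaut b * sqrt (a\<^sup>2 * (1 - profile b t) + profile b t) /
     (2 * a * profile b t * sqrt (1 - profile b t))"

text \<open>Any antiderivative will do: changing the constant rotates the surface in the first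
  coordinate.\<close>

definition angle :: "real \<Rightarrow> real \<Rightarrow> real \<Rightarrow> real" where
  "angle a b = (SOME F. \<forall>t. (F has_real_derivative ang_speed a b t) (at t))"

definition period :: "real \<Rightarrow> real \<Rightarrow> real" where
  "period a b = angle a b (2 * pi) - angle a b 0"

text \<open>With \<sigma> = 2 pi q, one unit of u covers q oscillations, which is how the surface
  becomes periodic with period 1.\<close>

definition otsuki :: "real \<Rightarrow> real \<Rightarrow> real \<Rightarrow> real \<times> real \<Rightarrow> complex \<times> complex" where
  "otsuki a b \<sigma> = rot_surface
     (\<lambda>u. of_real (a * sqrt (profile b (\<sigma> * u))) * cis (angle a b (\<sigma> * u)))
     (\<lambda>u. sqrt (1 - profile b (\<sigma> * u))) 1"

section \<open>Positivity, smoothness and periodicity of the profile and its angle\<close>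

locale otsuki_params =
  fixes a b :: real
  assumes a: "a > 0" and b: "0 \<le> b" "b < 1"
begin

lemma b_sq: "b\<^sup>2 < 1" using b by (simp add: abs_square_less_1)

lemma amplitude_ge: "0 \<le> amplitude b" using b by (simp add: amplitude_def)

lemma amplitude_less: "amplitude b < 1 / 2"
proof -
  have "0 < (1 - b)\<^sup>2" using b by simp
  then have "2 * b < 1 + b\<^sup>2" by (simp add: power2_eq_square algebra_simps)
  then show ?thesis by (simp add: amplitude_def field_simps add_pos_nonneg)
qed

lemma clairaut_pos: "clairaut b > 0"
  using b_sq by (simp add: clairaut_def add_pos_nonneg)

lemma clairaut_amplitude: "(clairaut b)\<^sup>2 = 1 / 4 - (amplitude b)\<^sup>2"
proof -
  have "1 + b\<^sup>2 \<noteq> 0" by (metis add.commute add_nonneg_eq_0_iff zero_le_one zero_le_power2 zero_neq_one)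
  then show ?thesis
    by (simp add: clairaut_def amplitude_def power_divide divide_simps) (simp add: power2_eq_square algebra_simps)
qed

lemma profile_bounds: "0 < profile b t" "profile b t < 1"
proof -
  have "\<bar>amplitude b * cos t\<bar> \<le> amplitude b * 1"
    unfolding abs_mult using amplitude_ge by (intro mult_mono) auto
  then show "0 < profile b t" "profile b t < 1" using amplitude_less by (auto simp: profile_def)
qed

lemma conformal_pos: "0 < a\<^sup>2 * (1 - profile b t) + profile b t"
  using profile_bounds[of t] a by (simp add: add_pos_pos)

lemma ang_speed_pos: "ang_speed a b t > 0"
  using profile_bounds[of t] conformal_pos[of t] clairaut_pos a by (simp add: ang_speed_def)

lemma smooth_profile: "smooth_on UNIV (profile b)"
proof -
  have "smooth_on UNIV (\<lambda>t. 1 / 2 + amplitude b * Re (cis t))"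
    by (intro smooth_on_add smooth_on_const smooth_on_bilinear[OF bounded_bilinear_mult]
        smooth_on_linear_compose[OF bounded_linear_Re] smooth_on_cis open_UNIV)
  then show ?thesis by (simp add: profile_def[abs_def])
qed

lemma smooth_one_minus_profile: "smooth_on UNIV (\<lambda>t. 1 - profile b t)"
proof -
  have "smooth_on UNIV (\<lambda>t. 1 + (-1) * profile b t)"
    by (intro smooth_on_add smooth_on_const smooth_on_bilinear[OF bounded_bilinear_mult]
        smooth_profile open_UNIV)
  then show ?thesis by simp
qed

lemma smooth_ang_speed: "smooth_on UNIV (ang_speed a b)"
proof -
  have "smooth_on UNIV (\<lambda>t. clairaut b * sqrt (a\<^sup>2 * (1 - profile b t) + profile b t) *
      inverse (2 * a * profile b t * sqrt (1 - profile b t)))"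
    by (intro smooth_on_add smooth_on_const smooth_on_bilinear[OF bounded_bilinear_mult] smooth_on_sqrt
        smooth_on_inverse smooth_profile smooth_one_minus_profile open_UNIV)
      (use profile_bounds conformal_pos a in auto)
  then show ?thesis unfolding ang_speed_def[abs_def] divide_inverse .
qed

lemma continuous_ang_speed: "continuous_on S (ang_speed a b)"
  by (rule continuous_on_subset[OF smooth_on_imp_continuous_on[OF smooth_ang_speed] subset_UNIV])

lemma angle_deriv: "(angle a b has_real_derivative ang_speed a b t) (at t)"
proof -
  have "isCont (ang_speed a b) x" for x
    using continuous_ang_speed[of UNIV] by (simp add: continuous_on_eq_continuous_at)
  then have "\<exists>F. \<forall>t. (F has_real_derivative ang_speed a b t) (at t)"
    using einterval_antiderivative[of "-\<infinity>" "\<infinity>" "ang_speed a b"]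
    by (auto simp: has_real_derivative_iff_has_vector_derivative)
  from someI_ex[OF this] show ?thesis by (simp add: angle_def)
qed

lemma smooth_angle: "smooth_on UNIV (angle a b)"
  by (rule smooth_on_antiderivative[OF angle_deriv smooth_ang_speed])

lemma profile_periodic: "profile b (t + 2 * pi) = profile b t"
  by (simp add: profile_def)

lemma angle_add_period: "angle a b (t + 2 * pi) = angle a b t + period a b"
proof -
  have "((\<lambda>t. angle a b (t + 2 * pi) - angle a b t) has_real_derivative
      ang_speed a b (s + 2 * pi) * 1 - ang_speed a b s) (at s)" for s
    by (intro DERIV_diff angle_deriv DERIV_chain2[OF angle_deriv]) (auto intro!: derivative_eq_intros)
  moreover have "ang_speed a b (s + 2 * pi) = ang_speed a b s" for s
    by (simp add: ang_speed_def profile_periodic)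
  ultimately have "((\<lambda>t. angle a b (t + 2 * pi) - angle a b t) has_real_derivative 0) (at s)" for s
    by simp
  from DERIV_isconst_all[OF allI[OF this], of t 0] show ?thesis by (simp add: period_def)
qed

lemma angle_add_periods: "angle a b (t + 2 * pi * of_int m) = angle a b t + of_int m * period a b"
proof (induction m arbitrary: t rule: int_induct[of _ 0])
  case (step1 i)
  then show ?case using angle_add_period[of "t + 2 * pi * of_int i"] by (simp add: algebra_simps)
next
  case (step2 i)
  then show ?case using angle_add_period[of "t + 2 * pi * of_int (i - 1)"] by (simp add: algebra_simps)
qed simp

lemma strict_mono_angle: "strict_mono (angle a b)"
proof (rule strict_monoI)
  fix s t :: real assume "s < t"
  then show "angle a b s < angle a b t"
    by (rule DERIV_pos_imp_increasing) (use angle_deriv ang_speed_pos in blast)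
qed

end

text \<open>Vectors are kept in the frame rotating with \<theta>. Differentiation stays within this
  form, and inner products in the frame no longer see the angle.\<close>

lemma has_vector_derivative_polar:
  assumes "(A has_real_derivative A') (at u)" "(B has_real_derivative B') (at u)"
    "(\<theta> has_real_derivative \<theta>') (at u)"
  shows "((\<lambda>u. Complex (A u) (B u) * cis (\<theta> u)) has_vector_derivative
    Complex (A' - B u * \<theta>') (B' + A u * \<theta>') * cis (\<theta> u)) (at u)"
proof -
  have AB: "((\<lambda>u. complex_of_real (A u) + \<i> * complex_of_real (B u)) has_derivative
      (\<lambda>h. complex_of_real (A' * h) + \<i> * complex_of_real (B' * h))) (at u)"
    using assms(1,2) unfolding has_field_derivative_def
    by (intro has_derivative_add has_derivative_mult_right has_derivative_of_real)
  have C: "((\<lambda>u. cis (\<theta> u)) has_derivative (\<lambda>h. (\<theta>' * h) *\<^sub>R (\<i> * cis (\<theta> u)))) (at u)"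
    using assms(3) unfolding has_field_derivative_def by (rule has_derivative_cis)
  show ?thesis unfolding has_vector_derivative_def Complex_eq
    by (rule has_derivative_eq_rhs[OF has_derivative_mult[OF AB C]])
      (auto simp: fun_eq_iff scaleR_conv_of_real algebra_simps)
qed

lemma inner_Complex_cis:
  "(Complex A B * cis t) \<bullet> (Complex A' B' * cis t) = A * A' + B * B'"
  unfolding inner_mult_cis by (simp add: inner_complex_def)

lemma mult_cis_decompose: "\<exists>A B. z = Complex A B * cis t"
proof -
  have "z = (z * cis (- t)) * cis t" by (simp add: mult.assoc cis_mult)
  then show ?thesis by (metis complex.exhaust)
qed

section \<open>Minimality and topology of the generated tori\<close>

context otsuki_params
begin

lemma otsuki_derivs:
  fixes \<sigma> :: real
  assumes \<sigma>: "\<sigma> > 0"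
  defines "x \<equiv> \<lambda>u. profile b (\<sigma> * u)" and "y \<equiv> \<lambda>u. - \<sigma> * amplitude b * sin (\<sigma> * u)"
  defines "x2 \<equiv> \<lambda>u. \<sigma>\<^sup>2 * (1 - 2 * x u) / 2" and "\<theta>1 \<equiv> \<lambda>u. \<sigma> * ang_speed a b (\<sigma> * u)"
  defines "r \<equiv> \<lambda>u. sqrt (x u)" and "W \<equiv> \<lambda>u. sqrt (1 - x u)"
  defines "h \<equiv> \<lambda>u. sqrt (a\<^sup>2 * (1 - x u) + x u)"
  defines "\<theta>2 \<equiv> \<lambda>u. \<theta>1 u * y u * ((1 - a\<^sup>2) / (2 * (h u)\<^sup>2) - 1 / (r u)\<^sup>2 + 1 / (2 * (W u)\<^sup>2))"
  shows "((\<lambda>u. a * r u) has_real_derivative a * y u / (2 * r u)) (at u)"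
    and "((\<lambda>u. a * y u / (2 * r u)) has_real_derivative a * (x2 u / (2 * r u) - (y u)\<^sup>2 / (4 * (r u)^3))) (at u)"
    and "(W has_real_derivative - y u / (2 * W u)) (at u)"
    and "((\<lambda>u. - y u / (2 * W u)) has_real_derivative - x2 u / (2 * W u) - (y u)\<^sup>2 / (4 * (W u)^3)) (at u)"
    and "((\<lambda>u. angle a b (\<sigma> * u)) has_real_derivative \<theta>1 u) (at u)"
    and "(\<theta>1 has_real_derivative \<theta>2 u) (at u)"
    and "(y u)\<^sup>2 = \<sigma>\<^sup>2 * ((r u)\<^sup>2 * (W u)\<^sup>2 - (clairaut b)\<^sup>2)"
    and "a\<^sup>2 * (\<theta>1 u)\<^sup>2 = \<sigma>\<^sup>2 * (clairaut b)\<^sup>2 * (h u)\<^sup>2 / (4 * (r u)^4 * (W u)\<^sup>2)"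
proof -
  have xb: "0 < x u" "x u < 1" for u using profile_bounds by (auto simp: x_def)
  have cpos: "0 < a\<^sup>2 * (1 - x u) + x u" for u using conformal_pos by (simp add: x_def)
  have rp: "r u > 0" and Wp: "W u > 0" and hp: "h u > 0" for u
    using xb[of u] cpos[of u] by (auto simp: r_def W_def h_def)
  have r2: "(r u)\<^sup>2 = x u" and W2: "(W u)\<^sup>2 = 1 - x u" and h2: "(h u)\<^sup>2 = a\<^sup>2 * (1 - x u) + x u" for u
    using xb[of u] cpos[of u] by (auto simp: r_def W_def h_def)
  have dx: "(x has_real_derivative y u) (at u)" for u
    unfolding x_def y_def profile_def by (auto intro!: derivative_eq_intros)
  have dy: "(y has_real_derivative x2 u) (at u)" for u
    unfolding x_def y_def x2_def profile_def
    by (auto intro!: derivative_eq_intros simp: power2_eq_square algebra_simps)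
  have dr: "(r has_real_derivative y u / (2 * r u)) (at u)" for u
    unfolding r_def using xb[of u] by (auto intro!: derivative_eq_intros dx simp: field_simps)
  have dW: "(W has_real_derivative - y u / (2 * W u)) (at u)" for u
    unfolding W_def using xb[of u] by (auto intro!: derivative_eq_intros dx simp: field_simps)
  have dh: "(h has_real_derivative (1 - a\<^sup>2) * y u / (2 * h u)) (at u)" for u
    unfolding h_def using cpos[of u] by (auto intro!: derivative_eq_intros dx simp: field_simps)
  show "((\<lambda>u. a * r u) has_real_derivative a * y u / (2 * r u)) (at u)"
    using DERIV_cmult[OF dr, of a u] by simp
  have "((\<lambda>u. a * y u / (2 * r u)) has_real_derivative
      ((a * x2 u) * (2 * r u) - (a * y u) * (2 * (y u / (2 * r u)))) / ((2 * r u) * (2 * r u))) (at u)"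
    using rp[of u] by (intro DERIV_divide DERIV_cmult dy dr) auto
  then show "((\<lambda>u. a * y u / (2 * r u)) has_real_derivative a * (x2 u / (2 * r u) - (y u)\<^sup>2 / (4 * (r u)^3))) (at u)"
    by (rule DERIV_cong) (use rp[of u] in \<open>simp add: field_simps power2_eq_square power3_eq_cube\<close>)
  show "(W has_real_derivative - y u / (2 * W u)) (at u)" by (rule dW)
  have "((\<lambda>u. - y u / (2 * W u)) has_real_derivative
      ((- x2 u) * (2 * W u) - (- y u) * (2 * (- y u / (2 * W u)))) / ((2 * W u) * (2 * W u))) (at u)"
    using Wp[of u] by (intro DERIV_divide DERIV_cmult DERIV_minus dy dW) auto
  then show "((\<lambda>u. - y u / (2 * W u)) has_real_derivative - x2 u / (2 * W u) - (y u)\<^sup>2 / (4 * (W u)^3)) (at u)"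
    by (rule DERIV_cong) (use Wp[of u] in \<open>simp add: field_simps power2_eq_square power3_eq_cube\<close>)
  show "((\<lambda>u. angle a b (\<sigma> * u)) has_real_derivative \<theta>1 u) (at u)"
    using DERIV_chain2[OF angle_deriv, of "\<lambda>u. \<sigma> * u" \<sigma> u] DERIV_cmult[OF DERIV_ident, of \<sigma> u]
    by (simp add: \<theta>1_def mult.commute)
  define K where "K = \<sigma> * clairaut b / (2 * a)"
  have \<theta>1: "\<theta>1 u = K * (h u / (x u * W u))" for u
    using a by (simp add: \<theta>1_def ang_speed_def h_def W_def x_def K_def)
  have "((\<lambda>u. K * (h u / (x u * W u))) has_real_derivative
     K * ((((1 - a\<^sup>2) * y u / (2 * h u)) * (x u * W u) - h u * (y u * W u + (- y u / (2 * W u)) * x u)) /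
       ((x u * W u) * (x u * W u)))) (at u)"
    using xb[of u] Wp[of u] by (intro DERIV_divide DERIV_cmult DERIV_mult dx dW dh) auto
  moreover have "K * ((((1 - a\<^sup>2) * y u / (2 * h u)) * (x u * W u) - h u * (y u * W u + (- y u / (2 * W u)) * x u)) /
       ((x u * W u) * (x u * W u))) = \<theta>2 u"
    unfolding \<theta>2_def \<theta>1 r2 using xb[of u] Wp[of u] hp[of u]
    by (simp add: field_simps power2_eq_square)
  ultimately show "(\<theta>1 has_real_derivative \<theta>2 u) (at u)" unfolding \<theta>1 by simp
  have "(y u)\<^sup>2 = \<sigma>\<^sup>2 * ((amplitude b)\<^sup>2 * (1 - (cos (\<sigma> * u))\<^sup>2))"
    by (simp add: y_def power_mult_distrib sin_squared_eq)
  also have "(amplitude b)\<^sup>2 * (1 - (cos (\<sigma> * u))\<^sup>2) = x u * (1 - x u) - (clairaut b)\<^sup>2"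
    unfolding clairaut_amplitude x_def profile_def by (simp add: power2_eq_square algebra_simps)
  finally show "(y u)\<^sup>2 = \<sigma>\<^sup>2 * ((r u)\<^sup>2 * (W u)\<^sup>2 - (clairaut b)\<^sup>2)" by (simp add: r2 W2)
  have "(r u)^4 = (x u)\<^sup>2" using r2[of u] by (metis power2_eq_square power4_eq_xxxx mult.assoc)
  then show "a\<^sup>2 * (\<theta>1 u)\<^sup>2 = \<sigma>\<^sup>2 * (clairaut b)\<^sup>2 * (h u)\<^sup>2 / (4 * (r u)^4 * (W u)\<^sup>2)"
    unfolding \<theta>1 K_def using a xb[of u] Wp[of u] by (simp add: field_simps power_mult_distrib power_divide)
qed

text \<open>Bundles the derivatives in the rotating frame with the minimal surface equation, so that
  the later arguments need only signs and inner products and not the formulas for the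
  coefficients.\<close>

lemma otsuki_partials:
  fixes \<sigma> :: real
  assumes \<sigma>: "\<sigma> > 0"
  obtains r W \<theta> \<rho>1 \<rho>2 W1 W2 \<theta>1 \<theta>2 :: "real \<Rightarrow> real" where
    "du (otsuki a b \<sigma>) = rot_surface (\<lambda>u. Complex (\<rho>1 u) (a * r u * \<theta>1 u) * cis (\<theta> u)) W1 1"
    "dv (otsuki a b \<sigma>) = rot_surface (\<lambda>_. 0) W (2 * pi * \<i>)"
    "du (du (otsuki a b \<sigma>)) = rot_surface (\<lambda>u. Complex (\<rho>2 u - a * r u * (\<theta>1 u)\<^sup>2)
       (2 * \<rho>1 u * \<theta>1 u + a * r u * \<theta>2 u) * cis (\<theta> u)) W2 1"
    "dv (dv (otsuki a b \<sigma>)) = rot_surface (\<lambda>_. 0) W (2 * pi * \<i> * (2 * pi * \<i>))"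
    "otsuki a b \<sigma> = rot_surface (\<lambda>u. Complex (a * r u) 0 * cis (\<theta> u)) W 1"
    "\<And>u. r u > 0" "\<And>u. W u > 0" "\<And>u. \<theta>1 u > 0" "\<And>u. W u = sqrt (1 - profile b (\<sigma> * u))"
    "\<And>u \<alpha> \<beta> \<gamma>. a * r u * \<alpha> / a\<^sup>2 + W u * \<beta> = 0 \<Longrightarrow> \<rho>1 u * \<alpha> + a * r u * \<theta>1 u * \<gamma> + W1 u * \<beta> = 0 \<Longrightarrow>
       W u * ((\<rho>2 u - a * r u * (\<theta>1 u)\<^sup>2) * \<alpha> + (2 * \<rho>1 u * \<theta>1 u + a * r u * \<theta>2 u) * \<gamma> + W2 u * \<beta>) =
       ((\<rho>1 u)\<^sup>2 + (a * r u)\<^sup>2 * (\<theta>1 u)\<^sup>2 + (W1 u)\<^sup>2) * \<beta>"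
proof -
  define x where "x u = profile b (\<sigma> * u)" for u
  define y where "y u = - \<sigma> * amplitude b * sin (\<sigma> * u)" for u
  define x2 where "x2 u = \<sigma>\<^sup>2 * (1 - 2 * x u) / 2" for u
  define \<theta> where "\<theta> u = angle a b (\<sigma> * u)" for u
  define \<theta>1 where "\<theta>1 u = \<sigma> * ang_speed a b (\<sigma> * u)" for u
  define r where "r u = sqrt (x u)" for u
  define W where "W u = sqrt (1 - x u)" for u
  define h where "h u = sqrt (a\<^sup>2 * (1 - x u) + x u)" for u
  define \<theta>2 where "\<theta>2 u = \<theta>1 u * y u * ((1 - a\<^sup>2) / (2 * (h u)\<^sup>2) - 1 / (r u)\<^sup>2 + 1 / (2 * (W u)\<^sup>2))" for u
  define \<rho>1 where "\<rho>1 u = a * y u / (2 * r u)" for u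
  define \<rho>2 where "\<rho>2 u = a * (x2 u / (2 * r u) - (y u)\<^sup>2 / (4 * (r u)^3))" for u
  define W1 where "W1 u = - y u / (2 * W u)" for u
  define W2 where "W2 u = - x2 u / (2 * W u) - (y u)\<^sup>2 / (4 * (W u)^3)" for u
  note D = otsuki_derivs[OF \<sigma>, folded x_def, folded x_def y_def r_def W_def \<theta>_def \<theta>1_def h_def x2_def,
    folded \<theta>2_def \<rho>1_def \<rho>2_def W1_def W2_def]
  have xb: "0 < x u" "x u < 1" for u using profile_bounds by (auto simp: x_def)
  have rp: "r u > 0" and Wp: "W u > 0" and hp: "h u > 0" and \<theta>p: "\<theta>1 u > 0" for u
    using xb[of u] conformal_pos[of "\<sigma> * u"] ang_speed_pos \<sigma>
    by (auto simp: r_def W_def h_def \<theta>1_def x_def)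
  have o: "otsuki a b \<sigma> = rot_surface (\<lambda>u. Complex (a * r u) 0 * cis (\<theta> u)) W 1"
    by (simp add: otsuki_def r_def W_def x_def \<theta>_def complex_of_real_def[symmetric] fun_eq_iff rot_surface_def)
  have Z1: "((\<lambda>u. Complex (a * r u) 0 * cis (\<theta> u)) has_vector_derivative
      Complex (\<rho>1 u) (a * r u * \<theta>1 u) * cis (\<theta> u)) (at u)" for u
    using has_vector_derivative_polar[OF D(1) DERIV_const[of 0] D(5)] by simp
  have Z2: "((\<lambda>u. Complex (\<rho>1 u) (a * r u * \<theta>1 u) * cis (\<theta> u)) has_vector_derivative
      Complex (\<rho>2 u - a * r u * (\<theta>1 u)\<^sup>2) (2 * \<rho>1 u * \<theta>1 u + a * r u * \<theta>2 u) * cis (\<theta> u)) (at u)" for u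
    using has_vector_derivative_polar[OF D(2) DERIV_mult[OF D(1) D(6)] D(5)]
    by (simp add: power2_eq_square algebra_simps)
  note R = rot_surface_derivs[OF Z1 D(3)] and R2 = rot_surface_derivs[OF Z2 D(4)]
    and R3 = rot_surface_derivs[OF has_vector_derivative_const D(3)]
  show ?thesis
  proof (rule that[of \<rho>1 r \<theta>1 \<theta> W1 W \<rho>2 \<theta>2 W2])
    fix u \<alpha> \<beta> \<gamma>
    assume t: "a * r u * \<alpha> / a\<^sup>2 + W u * \<beta> = 0" "\<rho>1 u * \<alpha> + a * r u * \<theta>1 u * \<gamma> + W1 u * \<beta> = 0"
    have rW: "(r u)\<^sup>2 + (W u)\<^sup>2 = 1" "(h u)\<^sup>2 = a\<^sup>2 * (W u)\<^sup>2 + (r u)\<^sup>2" "x2 u = \<sigma>\<^sup>2 * ((W u)\<^sup>2 - (r u)\<^sup>2) / 2"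
      using xb[of u] conformal_pos[of "\<sigma> * u"] by (auto simp: r_def W_def h_def x2_def x_def)
    show "W u * ((\<rho>2 u - a * r u * (\<theta>1 u)\<^sup>2) * \<alpha> + (2 * \<rho>1 u * \<theta>1 u + a * r u * \<theta>2 u) * \<gamma> + W2 u * \<beta>) =
       ((\<rho>1 u)\<^sup>2 + (a * r u)\<^sup>2 * (\<theta>1 u)\<^sup>2 + (W1 u)\<^sup>2) * \<beta>"
      by (rule minimal_equation[OF a rp Wp hp _ rW(1,2) D(7) rW(3) D(8) \<theta>2_def refl \<rho>1_def \<rho>2_def W1_def W2_def t])
        (use \<theta>p[of u] in simp)
  next
    show "W u = sqrt (1 - profile b (\<sigma> * u))" for u by (simp add: W_def x_def)
  qed (use rp Wp \<theta>p o R R2 R3 in auto)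
qed

lemma otsuki_minimal_at:
  assumes \<sigma>: "\<sigma> > 0" and n: "unit_normal a (otsuki a b \<sigma>) x n"
  shows "mean_curvature (otsuki a b \<sigma>) x n = 0"
proof -
  obtain r W \<theta> \<rho>1 \<rho>2 W1 W2 \<theta>1 \<theta>2 :: "real \<Rightarrow> real" where
    fu: "du (otsuki a b \<sigma>) = rot_surface (\<lambda>u. Complex (\<rho>1 u) (a * r u * \<theta>1 u) * cis (\<theta> u)) W1 1"
    and fv: "dv (otsuki a b \<sigma>) = rot_surface (\<lambda>_. 0) W (2 * pi * \<i>)"
    and fuu: "du (du (otsuki a b \<sigma>)) = rot_surface (\<lambda>u. Complex (\<rho>2 u - a * r u * (\<theta>1 u)\<^sup>2)
       (2 * \<rho>1 u * \<theta>1 u + a * r u * \<theta>2 u) * cis (\<theta> u)) W2 1"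
    and fvv: "dv (dv (otsuki a b \<sigma>)) = rot_surface (\<lambda>_. 0) W (2 * pi * \<i> * (2 * pi * \<i>))"
    and f: "otsuki a b \<sigma> = rot_surface (\<lambda>u. Complex (a * r u) 0 * cis (\<theta> u)) W 1"
    and pos: "\<And>u. W u > 0"
    and eq: "\<And>u \<alpha> \<beta> \<gamma>. a * r u * \<alpha> / a\<^sup>2 + W u * \<beta> = 0 \<Longrightarrow> \<rho>1 u * \<alpha> + a * r u * \<theta>1 u * \<gamma> + W1 u * \<beta> = 0 \<Longrightarrow>
       W u * ((\<rho>2 u - a * r u * (\<theta>1 u)\<^sup>2) * \<alpha> + (2 * \<rho>1 u * \<theta>1 u + a * r u * \<theta>2 u) * \<gamma> + W2 u * \<beta>) =
       ((\<rho>1 u)\<^sup>2 + (a * r u)\<^sup>2 * (\<theta>1 u)\<^sup>2 + (W1 u)\<^sup>2) * \<beta>"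
    by (rule otsuki_partials[OF \<sigma>]) (rule that, assumption+)
  obtain u v where x: "x = (u, v)" by fastforce
  obtain \<alpha> \<gamma> where n1: "fst n = Complex \<alpha> \<gamma> * cis (\<theta> u)" using mult_cis_decompose by blast
  obtain \<beta> \<delta> where n2: "snd n = Complex \<beta> \<delta> * cis (2 * pi * v)" using mult_cis_decompose by blast
  have c: "complex_of_real w * (1 * z) = Complex w 0 * z"
    "complex_of_real w * (2 * pi * \<i> * z) = Complex 0 (2 * pi * w) * z"
    "complex_of_real w * (2 * pi * \<i> * (2 * pi * \<i>) * z) = Complex (- (4 * pi\<^sup>2 * w)) 0 * z" for w z
    by (simp_all add: complex_eq_iff power2_eq_square)
  note rs = rot_surface_def inner_prod_def fst_conv snd_conv c inner_Complex_cis n1 n2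
  have t: "a * r u * \<alpha> / a\<^sup>2 + W u * \<beta> = 0"
    using n unfolding unit_normal_def ellipsoid_tangent_def x f mem_Collect_eq rs by simp
  have nu: "\<alpha> * \<rho>1 u + \<gamma> * (a * r u * \<theta>1 u) + \<beta> * W1 u = 0"
    using n unfolding unit_normal_def x fu rs by simp
  have "W u * ((\<rho>2 u - a * r u * (\<theta>1 u)\<^sup>2) * \<alpha> + (2 * \<rho>1 u * \<theta>1 u + a * r u * \<theta>2 u) * \<gamma> + W2 u * \<beta>) =
       ((\<rho>1 u)\<^sup>2 + (a * r u)\<^sup>2 * (\<theta>1 u)\<^sup>2 + (W1 u)\<^sup>2) * \<beta>"
    by (rule eq[OF t]) (use nu in \<open>simp add: algebra_simps\<close>)
  moreover have "dv (otsuki a b \<sigma>) x \<bullet> dv (otsuki a b \<sigma>) x = 4 * pi\<^sup>2 * (W u)\<^sup>2"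
    unfolding fv x rs by (simp add: power2_eq_square)
  moreover have "du (otsuki a b \<sigma>) x \<bullet> dv (otsuki a b \<sigma>) x = 0"
    unfolding fu fv x rs by simp
  moreover have "du (otsuki a b \<sigma>) x \<bullet> du (otsuki a b \<sigma>) x = (\<rho>1 u)\<^sup>2 + (a * r u)\<^sup>2 * (\<theta>1 u)\<^sup>2 + (W1 u)\<^sup>2"
    unfolding fu x rs by (simp add: power2_eq_square)
  moreover have "du (du (otsuki a b \<sigma>)) x \<bullet> n =
      (\<rho>2 u - a * r u * (\<theta>1 u)\<^sup>2) * \<alpha> + (2 * \<rho>1 u * \<theta>1 u + a * r u * \<theta>2 u) * \<gamma> + W2 u * \<beta>"
    unfolding fuu x rs by simp
  moreover have "dv (dv (otsuki a b \<sigma>)) x \<bullet> n = - (4 * pi\<^sup>2 * W u) * \<beta>"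
    unfolding fvv x rs by simp
  \<comment> \<open>The first fundamental form is diagonal, so the numerator of the mean curvature
    is 4 pi^2 w (w N - E \<beta>).\<close>
  moreover have "(4 * pi\<^sup>2 * w\<^sup>2) * N + E * (- (4 * pi\<^sup>2 * w) * \<beta>) = 0" if "w * N = E * \<beta>" for w N E :: real
    using that by algebra
  ultimately show ?thesis unfolding mean_curvature_def by simp
qed

lemma otsuki_smooth: "smooth_on UNIV (otsuki a b \<sigma>)"
proof -
  have l: "smooth_on UNIV (\<lambda>p :: real \<times> real. \<sigma> * fst p)" "smooth_on UNIV (\<lambda>p :: real \<times> real. 2 * pi * snd p)"
    by (auto intro!: smooth_on_linear bounded_linear_const_mult bounded_linear_fst bounded_linear_snd)
  note c = smooth_on_compose[OF open_UNIV subset_UNIV _ l(1)] smooth_on_compose[OF open_UNIV subset_UNIV _ l(2)]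
  have "smooth_on UNIV (\<lambda>p. (of_real (a * sqrt (profile b (\<sigma> * fst p))) * cis (angle a b (\<sigma> * fst p)),
      of_real (sqrt (1 - profile b (\<sigma> * fst p))) * (1 * cis (2 * pi * snd p))))"
    by (intro smooth_on_Pair smooth_on_bilinear[OF bounded_bilinear_mult]
        smooth_on_linear_compose[OF bounded_linear_of_real] smooth_on_const smooth_on_sqrt
        smooth_on_compose[OF open_UNIV subset_UNIV smooth_on_cis] c
        smooth_profile smooth_one_minus_profile smooth_angle l open_UNIV)
      (use profile_bounds in auto)
  then show ?thesis unfolding otsuki_def rot_surface_def[abs_def] .
qed

lemma otsuki_in_ellipsoid: "otsuki a b \<sigma> x \<in> ellipsoid a"
  using profile_bounds[of "\<sigma> * fst x"] a
  by (simp add: otsuki_def rot_surface_def ellipsoid_def norm_mult power_mult_distrib)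

text \<open>A unit shift of u covers q oscillations and turns the angle by q periods, that is, by p
  full turns.\<close>

lemma otsuki_periodic:
  assumes per: "of_nat q * period a b = 2 * pi * of_int p" and xy: "same_torus_point x y"
  shows "otsuki a b (2 * pi * of_nat q) x = otsuki a b (2 * pi * of_nat q) y"
proof -
  obtain i j where i: "fst x = fst y + of_int i" and j: "snd x = snd y + of_int j"
    using xy unfolding same_torus_point_def by (metis Ints_cases add.commute diff_add_cancel)
  have t: "2 * pi * of_nat q * fst x = 2 * pi * of_nat q * fst y + 2 * pi * of_int (int q * i)"
    by (simp add: i algebra_simps)
  have 1: "cis (2 * pi * snd x) = cis (2 * pi * snd y)"
    by (simp add: j distrib_left cis_mult[symmetric])
  have "angle a b (2 * pi * of_nat q * fst x) = angle a b (2 * pi * of_nat q * fst y) + 2 * pi * of_int (i * p)"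
    unfolding t angle_add_periods using per by (simp add: algebra_simps)
  then have 2: "cis (angle a b (2 * pi * of_nat q * fst x)) = cis (angle a b (2 * pi * of_nat q * fst y))"
    by (simp add: cis_mult[symmetric])
  have 3: "profile b (2 * pi * of_nat q * fst x) = profile b (2 * pi * of_nat q * fst y)"
  proof -
    have c: "cos (s + 2 * pi * of_int m) = cos s" for s and m :: int
      by (simp add: cos_add cos_int_2pin sin_int_2pin)
    show ?thesis unfolding t profile_def c ..
  qed
  show ?thesis unfolding otsuki_def rot_surface_def by (simp only: 1 2 3)
qed

lemma otsuki_immersed:
  assumes q: "q > 0" and per: "of_nat q * period a b = 2 * pi * of_int p"
  shows "immersed_torus a (otsuki a b (2 * pi * of_nat q))"
proof -
  let ?f = "otsuki a b (2 * pi * of_nat q)"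
  have \<sigma>: "2 * pi * real q > 0" using q by simp
  have "inj (frechet_derivative ?f (at x))" for x
  proof -
    obtain r W \<theta> \<rho>1 W1 \<theta>1 :: "real \<Rightarrow> real" where
      fu: "du ?f = rot_surface (\<lambda>u. Complex (\<rho>1 u) (a * r u * \<theta>1 u) * cis (\<theta> u)) W1 1"
      and fv: "dv ?f = rot_surface (\<lambda>_. 0) W (2 * pi * \<i>)"
      and pos: "\<And>u. r u > 0" "\<And>u. W u > 0" "\<And>u. \<theta>1 u > 0"
      by (rule otsuki_partials[OF \<sigma>]) (rule that, assumption+)
    have lin: "linear (frechet_derivative ?f (at x))"
      by (rule linear_frechet_derivative[OF smooth_on_imp_differentiable[OF otsuki_smooth UNIV_I]])
    have "h = 0" if h: "frechet_derivative ?f (at x) h = 0" for h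
    proof -
      have "h = fst h *\<^sub>R (1, 0) + snd h *\<^sub>R (0, 1)" by (cases h) simp
      then have "frechet_derivative ?f (at x) h = fst h *\<^sub>R du ?f x + snd h *\<^sub>R dv ?f x"
        unfolding du_def dv_def by (metis linear_add[OF lin] linear_cmul[OF lin])
      then have 0: "fst h *\<^sub>R du ?f x + snd h *\<^sub>R dv ?f x = 0" using h by simp
      have "du ?f x \<bullet> dv ?f x = 0"
        unfolding fu fv rot_surface_def inner_prod_def fst_conv snd_conv mult.assoc[symmetric] inner_mult_cis
        by (simp add: inner_complex_def)
      moreover have "fst (du ?f x) \<noteq> 0" "snd (dv ?f x) \<noteq> 0"
        using pos(1,3)[of "fst x"] pos(2)[of "fst x"] a
        unfolding fu fv rot_surface_def by (simp_all add: Complex_eq_0)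
      then have "du ?f x \<noteq> 0" "dv ?f x \<noteq> 0" by auto
      ultimately have "fst h = 0" "snd h = 0"
        using arg_cong[OF 0, of "\<lambda>z. z \<bullet> du ?f x"] arg_cong[OF 0, of "\<lambda>z. z \<bullet> dv ?f x"]
        by (auto simp: inner_add_left inner_add_right inner_commute)
      then show ?thesis by (simp add: prod_eq_iff)
    qed
    then show ?thesis using linear_injective_0[OF lin] by blast
  qed
  then show ?thesis unfolding immersed_torus_def
    using otsuki_periodic[OF per] otsuki_in_ellipsoid otsuki_smooth by blast
qed

lemma otsuki_minimal:
  assumes "q > 0" "of_nat q * period a b = 2 * pi * of_int p"
  shows "minimal_torus a (otsuki a b (2 * pi * of_nat q))"
  unfolding minimal_torus_def using otsuki_immersed[OF assms] otsuki_minimal_at assms(1) by simp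

lemma otsuki_S1_invariant: "S1_invariant (range (otsuki a b \<sigma>))"
proof -
  have sub: "torus_action (1, w) ` range (otsuki a b \<sigma>) \<subseteq> range (otsuki a b \<sigma>)" if w: "cmod w = 1" for w
  proof -
    obtain s where s: "w = cis s" using w by (metis rcis_cmod_Arg rcis_def mult_1 of_real_1)
    have "torus_action (1, w) (otsuki a b \<sigma> (u, v)) = otsuki a b \<sigma> (u, v + s / (2 * pi))" for u v
      by (simp add: torus_action_def otsuki_def rot_surface_def s distrib_left cis_mult[symmetric])
    then show ?thesis by (auto intro: range_eqI)
  qed
  have "torus_action (1, w) ` range (otsuki a b \<sigma>) = range (otsuki a b \<sigma>)" if w: "cmod w = 1" for w
  proof
    have "torus_action (1, w) (torus_action (1, inverse w) z) = z" for z
    proof -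
      have "w * inverse w = 1" using w by (intro right_inverse) auto
      then show ?thesis by (cases z) (simp add: torus_action_def flip: mult.assoc)
    qed
    then have "z \<in> torus_action (1, w) ` range (otsuki a b \<sigma>)" if "z \<in> range (otsuki a b \<sigma>)" for z
      using sub[of "inverse w"] w that by (metis (no_types, lifting) image_eqI inverse_1 norm_inverse subsetD)
    then show "range (otsuki a b \<sigma>) \<subseteq> torus_action (1, w) ` range (otsuki a b \<sigma>)" by blast
  qed (rule sub[OF w])
  then show ?thesis unfolding S1_invariant_def by auto
qed

text \<open>The angle is strictly increasing and makes exactly one full turn per oscillation. Hence
  the phase of z determines u modulo 1, and the phase of w determines v modulo 1.\<close>

lemma otsuki_embedded:
  assumes per: "period a b = 2 * pi"
  shows "embedded_torus a (otsuki a b (2 * pi))"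
proof -
  have "immersed_torus a (otsuki a b (2 * pi))" using otsuki_immersed[of 1 1] per by simp
  moreover have "same_torus_point x y" if eq: "otsuki a b (2 * pi) x = otsuki a b (2 * pi) y" for x y
  proof -
    have cis_eq: "\<exists>m :: int. s = t + 2 * pi * of_int m"
      if "of_real c * cis s = of_real d * cis t" "c > 0" "d > 0" for c d s t
    proof -
      have "c = d" using arg_cong[OF that(1), of norm] that(2,3) by (simp add: norm_mult)
      then have "cis s = cis t" using that by simp
      then have "cos s = cos t" "sin s = sin t" by (auto simp: complex_eq_iff)
      then show ?thesis using sin_cos_eq_iff[of s t] by (auto simp: algebra_simps)
    qed
    have pos: "a * sqrt (profile b t) > 0" "sqrt (1 - profile b t) > 0" for t
      using profile_bounds[of t] a by auto
    obtain m :: int where m: "angle a b (2 * pi * fst x) = angle a b (2 * pi * fst y) + 2 * pi * of_int m"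
      using arg_cong[OF eq, of fst] cis_eq[OF _ pos(1) pos(1)]
      unfolding otsuki_def rot_surface_def fst_conv by blast
    then have "angle a b (2 * pi * fst x) = angle a b (2 * pi * fst y + 2 * pi * of_int m)"
      by (simp add: angle_add_periods per)
    then have "2 * pi * fst x = 2 * pi * fst y + 2 * pi * of_int m"
      using strict_mono_eq[OF strict_mono_angle] by blast
    then have "2 * pi * (fst x - fst y) = 2 * pi * of_int m" by (simp add: algebra_simps)
    then have 1: "fst x - fst y = of_int m" by simp
    obtain l :: int where "2 * pi * snd x = 2 * pi * snd y + 2 * pi * of_int l"
      using arg_cong[OF eq, of snd] cis_eq[OF _ pos(2) pos(2)]
      unfolding otsuki_def rot_surface_def snd_conv mult_1_left by blast
    then have "2 * pi * (snd x - snd y) = 2 * pi * of_int l" by (simp add: algebra_simps)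
    then have 2: "snd x - snd y = of_int l" by simp
    show ?thesis unfolding same_torus_point_def 1 2 by simp
  qed
  ultimately show ?thesis by (simp add: embedded_torus_def)
qed

lemma otsuki_not_clifford:
  assumes b0: "b > 0" and per: "period a b = 2 * pi"
  shows "\<not> congruent_in_ellipsoid a (range (otsuki a b (2 * pi))) (clifford_torus a)"
proof -
  let ?f = "otsuki a b (2 * pi)"
  obtain r W \<theta> \<rho>1 W1 \<theta>1 :: "real \<Rightarrow> real" where
    fu: "du ?f = rot_surface (\<lambda>u. Complex (\<rho>1 u) (a * r u * \<theta>1 u) * cis (\<theta> u)) W1 1"
    and fv: "dv ?f = rot_surface (\<lambda>_. 0) W (2 * pi * \<i>)"
    and pos: "\<And>u. r u > 0" "\<And>u. W u > 0" "\<And>u. \<theta>1 u > 0"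
    and W: "\<And>u. W u = sqrt (1 - profile b (2 * pi * u))"
    by (rule otsuki_partials[of "2 * pi"]) (simp, rule that, assumption+)
  have c: "complex_of_real w * (1 * z) = Complex w 0 * z"
    "complex_of_real w * (2 * pi * \<i> * z) = Complex 0 (2 * pi * w) * z" for w z
    by (simp_all add: complex_eq_iff)
  note rs = rot_surface_def inner_prod_def fst_conv snd_conv c inner_Complex_cis
  show ?thesis
  proof (rule not_congruent_clifford_torus[OF a otsuki_smooth otsuki_in_ellipsoid])
    show "du ?f (u, v) \<bullet> du ?f (u, v) = (\<rho>1 u)\<^sup>2 + (a * r u * \<theta>1 u)\<^sup>2 + (W1 u)\<^sup>2" for u v
      unfolding fu rs by (simp add: power2_eq_square)
    show "0 < (\<rho>1 u)\<^sup>2 + (a * r u * \<theta>1 u)\<^sup>2 + (W1 u)\<^sup>2" for u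
      using pos(1,3)[of u] a by (intro add_pos_nonneg add_nonneg_pos) auto
    show "dv ?f (u, v) \<bullet> dv ?f (u, v) = (2 * pi * W u)\<^sup>2" for u v
      unfolding fv rs by (simp add: power2_eq_square)
    show "0 < (2 * pi * W u)\<^sup>2" for u using pos(2)[of u] by simp
    show "du ?f (u, v) \<bullet> dv ?f (u, v) = 0" for u v unfolding fu fv rs by simp
    show "?f (1, v) = ?f (0, v)" for v
      using otsuki_periodic[of 1 1 "(1, v)" "(0, v)"] per by (simp add: same_torus_point_def)
    have "amplitude b > 0" using b0 by (simp add: amplitude_def add_pos_nonneg)
    \<comment> \<open>Half an oscillation apart the profile is at its two extremes, so the orbits
      have different lengths.\<close>
    then have "profile b (2 * pi * (1 / 2)) \<noteq> profile b (2 * pi * 0)" by (simp add: profile_def)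
    then have "(W (1 / 2))\<^sup>2 \<noteq> (W 0)\<^sup>2"
      unfolding W using profile_bounds[of "2 * pi * (1 / 2)"] profile_bounds[of "2 * pi * 0"] by simp
    then show "(2 * pi * W (1 / 2))\<^sup>2 \<noteq> (2 * pi * W 0)\<^sup>2" by (simp add: power_mult_distrib)
  qed
qed

text \<open>The z-projection of the torus is just the profile curve, a differentiable image of a
  line in the plane and so a null set.\<close>

lemma otsuki_no_interior:
  assumes "x \<in> range (otsuki a b \<sigma>)" "r > 0"
  shows "\<not> ball x r \<inter> ellipsoid a \<subseteq> range (otsuki a b \<sigma>)"
proof (rule ellipsoid_no_interior[OF a _ _ assms(1) _ assms(2)])
  let ?Z = "\<lambda>u. fst (otsuki a b \<sigma> (u, 0))"
  show "negligible (range ?Z)"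
  proof (rule negligible_differentiable_image_lowdim)
    have "(otsuki a b \<sigma> \<circ> (\<lambda>u. (u, 0))) differentiable (at u)" for u
      using smooth_on_imp_differentiable[OF otsuki_smooth[of \<sigma>] UNIV_I]
      by (intro differentiable_chain_at) (auto intro!: derivative_intros)
    then have "(\<lambda>u. otsuki a b \<sigma> (u, 0)) differentiable (at u)" for u by (simp add: o_def)
    from differentiable_chain_at[OF this bounded_linear_imp_differentiable[OF bounded_linear_fst]]
    show "?Z differentiable_on UNIV"
      by (auto simp: differentiable_on_def o_def)
  qed simp
  show "fst p \<in> range ?Z \<and> snd p \<noteq> 0" if p: "p \<in> range (otsuki a b \<sigma>)" for p
  proof -
    obtain u v where "p = otsuki a b \<sigma> (u, v)" using p by force
    then show ?thesis using profile_bounds[of "\<sigma> * u"]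
      by (auto simp: otsuki_def rot_surface_def)
  qed
qed (use assms otsuki_in_ellipsoid in auto)

lemma otsuki_closed:
  assumes "of_nat q * period a b = 2 * pi * of_int p"
  shows "closed (range (otsuki a b (2 * pi * of_nat q)))"
proof -
  let ?f = "otsuki a b (2 * pi * of_nat q)"
  have "range ?f = ?f ` cbox (0, 0) (1, 1)"
  proof -
    have "?f x \<in> ?f ` cbox (0, 0) (1, 1)" for x
    proof (rule image_eqI)
      show "?f x = ?f (frac (fst x), frac (snd x))"
        by (rule otsuki_periodic[OF assms]) (simp add: same_torus_point_def frac_def)
      show "(frac (fst x), frac (snd x)) \<in> cbox (0, 0) (1, 1)"
        by (simp add: cbox_Pair_eq frac_ge_0 frac_lt_1 less_imp_le)
    qed
    then show ?thesis by blast
  qed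
  moreover have "compact (?f ` cbox (0, 0) (1, 1))"
    by (intro compact_continuous_image compact_cbox
        continuous_on_subset[OF smooth_on_imp_continuous_on[OF otsuki_smooth]]) simp
  ultimately show ?thesis using compact_imp_closed by metis
qed

end

subsection \<open>The sweep angle\<close>

text \<open>In terms of b the integrand is the Poisson kernel (1 - b^2) / (1 + b^2 + 2 b cos t). An
  antiderivative is t minus twice the argument of 1 + b cis t, and arctan expresses this argument
  since the real part is positive. Negative b is included because it exchanges the profile x with 1
  - x.\<close>

lemma has_integral_inverse_profile:
  assumes b: "\<bar>b\<bar> < 1"
  shows "((\<lambda>t. clairaut b / profile b t) has_integral 2 * pi) {0..2 * pi}"
proof -
  define F where "F t = t - 2 * arctan (b * sin t / (1 + b * cos t))" for t
  have b2: "b\<^sup>2 < 1" using b by (simp add: abs_square_less_1)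
  have "(F has_real_derivative clairaut b / profile b t) (at t)" for t
  proof -
    have "\<bar>b * cos t\<bar> \<le> \<bar>b\<bar> * 1" unfolding abs_mult by (intro mult_left_mono) auto
    then have pos: "1 + b * cos t > 0" using b by linarith
    define d where "d = b * sin t / (1 + b * cos t)"
    define d' where "d' = (b * cos t * (1 + b * cos t) + b * sin t * (b * sin t)) / ((1 + b * cos t) * (1 + b * cos t))"
    have d: "((\<lambda>t. b * sin t / (1 + b * cos t)) has_real_derivative d') (at t)"
      unfolding d'_def using pos by (auto intro!: derivative_eq_intros simp: algebra_simps)
    have "((\<lambda>t. arctan (b * sin t / (1 + b * cos t))) has_real_derivative inverse (1 + d\<^sup>2) * d') (at t)"
      unfolding d_def by (rule DERIV_chain2[OF DERIV_arctan d])
    then have F: "(F has_real_derivative 1 - 2 * (inverse (1 + d\<^sup>2) * d')) (at t)"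
      unfolding F_def by (intro DERIV_diff DERIV_ident DERIV_cmult)
    have sc: "(sin t)\<^sup>2 = 1 - (cos t)\<^sup>2" by (simp add: sin_squared_eq)
    define N where "N = 1 + b\<^sup>2 + 2 * b * cos t"
    have N: "(1 + b * cos t)\<^sup>2 + (b * sin t)\<^sup>2 = N"
      using sc unfolding N_def by algebra
    have Np: "N > 0" unfolding N[symmetric] using pos by (simp add: add_pos_nonneg)
    have M: "b * cos t * (1 + b * cos t) + b * sin t * (b * sin t) = b * cos t + b\<^sup>2"
      using sc by algebra
    have "1 + d\<^sup>2 = N / (1 + b * cos t)\<^sup>2"
      unfolding N[symmetric] d_def using pos by (simp add: power_divide add_divide_distrib)
    then have q: "inverse (1 + d\<^sup>2) * d' = (b * cos t + b\<^sup>2) / N"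
      unfolding d'_def M using pos Np by (simp add: power2_eq_square)
    have "1 - 2 * (inverse (1 + d\<^sup>2) * d') = (1 - b\<^sup>2) / N"
      unfolding q using Np by (simp add: divide_simps) (simp add: N_def)
    also have "\<dots> = clairaut b / profile b t"
    proof -
      have p: "1 + b\<^sup>2 > 0" by (simp add: add_pos_nonneg)
      then have "profile b t = N / (2 * (1 + b\<^sup>2))"
        by (simp add: profile_def amplitude_def N_def field_simps)
      then show ?thesis using p Np by (simp add: clairaut_def)
    qed
    finally show ?thesis using F by simp
  qed
  then have "((\<lambda>t. clairaut b / profile b t) has_integral F (2 * pi) - F 0) {0..2 * pi}"
    by (intro fundamental_theorem_of_calculus)
      (auto simp: has_real_derivative_iff_has_vector_derivative[symmetric] intro: has_field_derivative_at_within)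
  then show ?thesis by (simp add: F_def)
qed

context otsuki_params
begin

lemma has_integral_ang_speed: "(ang_speed a b has_integral period a b) {0..2 * pi}"
  unfolding period_def
  by (intro fundamental_theorem_of_calculus)
    (auto simp: has_real_derivative_iff_has_vector_derivative[symmetric]
      intro: has_field_derivative_at_within angle_deriv)

text \<open>Bounding h by a W + r splits the speed into \<epsilon> / (2 x), whose integral is
  exactly pi, and the error s / (2 a) with s = \<epsilon> / (r W), which has to be shown small with
  \<epsilon>.\<close>

lemma period_le: "period a b \<le> pi + 3 * pi * sqrt (clairaut b) / (2 * a)"
proof -
  define e where "e = clairaut b"
  define \<eta> where "\<eta> = sqrt e"
  have e: "e > 0" "\<eta> > 0" "\<eta>\<^sup>2 = e" using clairaut_pos by (auto simp: e_def \<eta>_def)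
  have i1: "((\<lambda>t. e / profile b t) has_integral 2 * pi) {0..2 * pi}"
    unfolding e_def by (rule has_integral_inverse_profile) (use b in auto)
  have "clairaut (- b) = clairaut b" "profile (- b) t = 1 - profile b t" for t
    by (auto simp: clairaut_def profile_def amplitude_def)
  then have i2: "((\<lambda>t. e / (1 - profile b t)) has_integral 2 * pi) {0..2 * pi}"
    using has_integral_inverse_profile[of "- b"] b by (simp add: e_def)
  have i0: "((\<lambda>t. \<eta> / 2) has_integral (2 * pi - 0) *\<^sub>R (\<eta> / 2)) {0..2 * pi}"
    using has_integral_const_real[of "\<eta> / 2" 0 "2 * pi"] by simp
  have bound: "((\<lambda>t. (1 / 2) * (e / profile b t) + (1 / (2 * a)) * (\<eta> / 2 +
      (\<eta> / 2) * (e / profile b t + e / (1 - profile b t)))) has_integral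
      (1 / 2) * (2 * pi) + (1 / (2 * a)) * ((2 * pi - 0) *\<^sub>R (\<eta> / 2) + (\<eta> / 2) * (2 * pi + 2 * pi))) {0..2 * pi}"
    by (intro has_integral_add has_integral_mult_right i0 i1 i2)
  have "period a b \<le> (1 / 2) * (2 * pi) + (1 / (2 * a)) * ((2 * pi - 0) *\<^sub>R (\<eta> / 2) + (\<eta> / 2) * (2 * pi + 2 * pi))"
  proof (rule has_integral_le[OF has_integral_ang_speed bound])
    fix t
    define x where "x = profile b t"
    define r where "r = sqrt x"
    define W where "W = sqrt (1 - x)"
    have x: "0 < x" "x < 1" using profile_bounds by (auto simp: x_def)
    have rW: "r > 0" "W > 0" "r\<^sup>2 = x" "W\<^sup>2 = 1 - x" using x by (auto simp: r_def W_def)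
    have h: "sqrt (a\<^sup>2 * (1 - x) + x) \<le> a * W + r"
    proof (rule real_le_lsqrt)
      show "a\<^sup>2 * (1 - x) + x \<le> (a * W + r)\<^sup>2"
        using rW a by (simp add: power2_sum power_mult_distrib)
    qed (use rW a in simp)
    define s where "s = e / (r * W)"
    have "ang_speed a b t \<le> e * (a * W + r) / (2 * a * x * W)"
      unfolding ang_speed_def x_def[symmetric] e_def[symmetric] W_def[symmetric]
      using h e rW x a by (intro divide_right_mono mult_left_mono) auto
    also have "\<dots> = (1 / 2) * (e / x) + (1 / (2 * a)) * s"
      unfolding s_def rW(3)[symmetric] using rW(1,2) a by (simp add: field_simps power2_eq_square)
    \<comment> \<open>With weight \<eta> = sqrt \<epsilon> both summands have integrals of order
      \<eta>: s^2 is \<epsilon> times a sum of two Poisson kernels, of total integral 4 pi. Together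
      they contribute 3 pi \<eta>.\<close>
    also have "s \<le> \<eta> / 2 + s\<^sup>2 / (2 * \<eta>)"
    proof -
      have "0 \<le> (s - \<eta>)\<^sup>2" by simp
      then have "2 * \<eta> * s \<le> \<eta>\<^sup>2 + s\<^sup>2" by (simp add: power2_diff algebra_simps)
      then show ?thesis using e by (simp add: field_simps power2_eq_square)
    qed
    also have "s\<^sup>2 / (2 * \<eta>) = (\<eta> / 2) * (e / x + e / (1 - x))"
    proof -
      have "s\<^sup>2 = e * \<eta>\<^sup>2 / (x * (1 - x))"
        unfolding e(3) by (simp add: s_def power_divide power_mult_distrib rW power2_eq_square[of e])
      also have "\<dots> / (2 * \<eta>) = (\<eta> / 2) * (e / (x * (1 - x)))"
        using e(1,2) x by (simp add: field_simps power2_eq_square)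
      also have "e / (x * (1 - x)) = e / x + e / (1 - x)" using x by (simp add: field_simps)
      finally show ?thesis .
    qed
    finally show "ang_speed a b t \<le> (1 / 2) * (e / profile b t) + (1 / (2 * a)) * (\<eta> / 2 +
      (\<eta> / 2) * (e / profile b t + e / (1 - profile b t)))"
      using a by (simp add: x_def mult_left_mono divide_right_mono)
  qed
  also have "\<dots> = pi + 3 * pi * \<eta> / (2 * a)" using a by (simp add: field_simps)
  finally show ?thesis by (simp add: \<eta>_def e_def)
qed

end

lemma period_zero: 
  assumes a: "a > 0" shows "period a 0 = pi * sqrt (a\<^sup>2 + 1) / a"
proof -
  interpret otsuki_params a 0 by unfold_locales (use a in auto)
  have "ang_speed a 0 t = sqrt (a\<^sup>2 + 1) / (2 * a)" for t
  proof -
    have "sqrt (a\<^sup>2 / 2 + 1 / 2) = sqrt (a\<^sup>2 + 1) * sqrt (1 / 2)"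
      by (simp add: real_sqrt_mult[symmetric] add_divide_distrib)
    then show ?thesis
      by (simp add: ang_speed_def profile_def amplitude_def clairaut_def)
  qed
  then have "ang_speed a 0 = (\<lambda>t. sqrt (a\<^sup>2 + 1) / (2 * a))" by auto
  then have "((\<lambda>t. sqrt (a\<^sup>2 + 1) / (2 * a)) has_integral period a 0) {0..2 * pi}"
    using has_integral_ang_speed by simp
  moreover have "((\<lambda>t. sqrt (a\<^sup>2 + 1) / (2 * a)) has_integral 2 * pi * (sqrt (a\<^sup>2 + 1) / (2 * a))) {0..2 * pi}"
    using has_integral_const_real[of "sqrt (a\<^sup>2 + 1) / (2 * a)" 0 "2 * pi"] by simp
  ultimately have "period a 0 = 2 * pi * (sqrt (a\<^sup>2 + 1) / (2 * a))" by (rule has_integral_unique)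
  then show ?thesis by simp
qed

text \<open>Each b chooses its angle function separately, so continuity is read off the integral of
  the speed, which is jointly continuous in b and t.\<close>

lemma continuous_period:
  assumes a: "a > 0" shows "continuous_on {0..<1} (period a)"
proof -
  have P: "otsuki_params a b" if "b \<in> {0..<1}" for b
    by unfold_locales (use a that in auto)
  have "continuous_on ({0..<1} \<times> cbox 0 (2 * pi)) (\<lambda>(b, t). ang_speed a b t)"
  proof -
    have nz: "1 + b\<^sup>2 \<noteq> 0" for b :: real
      by (metis add.commute add_nonneg_eq_0_iff zero_le_one zero_le_power2 zero_neq_one)
    have c: "continuous_on S (\<lambda>p. profile (fst p) (snd p))" for S :: "(real \<times> real) set"
      unfolding profile_def amplitude_def by (intro continuous_intros) (use nz in auto)
    have c2: "continuous_on S (\<lambda>p. clairaut (fst p))" for S :: "(real \<times> real) set"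
      unfolding clairaut_def
      by (intro continuous_intros) (simp add: nz del: distrib_left_numeral)
    show ?thesis unfolding ang_speed_def case_prod_unfold
    proof (intro continuous_intros c c2 ballI)
      fix p :: "real \<times> real" assume "p \<in> {0..<1} \<times> cbox 0 (2 * pi)"
      then interpret otsuki_params a "fst p" by (intro P) auto
      show "2 * a * profile (fst p) (snd p) * sqrt (1 - profile (fst p) (snd p)) \<noteq> 0"
        using profile_bounds[of "snd p"] a by simp
    qed
  qed
  from integral_continuous_on_param[OF this]
  have "continuous_on {0..<1} (\<lambda>b. integral {0..2 * pi} (ang_speed a b))" by simp
  moreover have "integral {0..2 * pi} (ang_speed a b) = period a b" if "b \<in> {0..<1}" for b
    by (rule integral_unique[OF otsuki_params.has_integral_ang_speed[OF P[OF that]]])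
  ultimately show ?thesis by (rule continuous_on_eq)
qed

lemma period_small:
  assumes a: "a > 0" and c: "c > pi"
  obtains b where "0 < b" "b < 1" "period a b < c"
proof -
  have nz: "1 + b\<^sup>2 \<noteq> 0" for b :: real
    by (metis add.commute add_nonneg_eq_0_iff zero_le_one zero_le_power2 zero_neq_one)
  have "isCont (\<lambda>b. pi + 3 * pi * sqrt (clairaut b) / (2 * a)) 1"
    unfolding clairaut_def using a nz by (intro continuous_intros) auto
  then have "((\<lambda>b. pi + 3 * pi * sqrt (clairaut b) / (2 * a)) \<longlongrightarrow> pi) (at 1)"
    by (simp add: isCont_def clairaut_def)
  from order_tendstoD(2)[OF this c]
  have "eventually (\<lambda>b. pi + 3 * pi * sqrt (clairaut b) / (2 * a) < c) (at_left 1)"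
    by (simp add: eventually_at_split)
  moreover have "eventually (\<lambda>b::real. b \<in> {0<..<1}) (at_left 1)"
    by (rule eventually_at_leftI[of 0]) auto
  ultimately obtain b where bc: "pi + 3 * pi * sqrt (clairaut b) / (2 * a) < c" "b \<in> {0<..<1}"
    using eventually_happens'[OF trivial_limit_at_left_real eventually_conj] by blast
  interpret otsuki_params a b by unfold_locales (use a bc in auto)
  show ?thesis by (rule that[of b]) (use bc period_le in auto)
qed

text \<open>The intermediate value theorem. Strictness on both sides excludes the endpoints, in
  particular b' = 0, the Clifford torus.\<close>

lemma period_attains:
  assumes a: "a > 0" and b: "0 < b" "b < 1" and y: "period a b < y" "y < period a 0"
  obtains b' where "0 < b'" "b' < b" "period a b' = y"
proof -
  have "continuous_on {0..b} (period a)"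
    by (rule continuous_on_subset[OF continuous_period[OF a]]) (use b in auto)
  then obtain b' where b': "0 \<le> b'" "b' \<le> b" "period a b' = y"
    using IVT2'[of "period a" b y 0] y b by auto
  have "b' \<noteq> 0" "b' \<noteq> b" using b' y by auto
  then show ?thesis using that[of b'] b' by auto
qed

subsection \<open>Congruence classes of the tori\<close>

lemma norm_cis_diff_le: "norm (cis s - cis t) \<le> \<bar>s - t\<bar>"
proof -
  have "norm (cis s - cis t) \<le> 1 * norm (s - t)"
  proof (rule differentiable_bound[where S = UNIV and f' = "\<lambda>x h. h *\<^sub>R (\<i> * cis x)"])
    show "(cis has_derivative (\<lambda>h. h *\<^sub>R (\<i> * cis x))) (at x within UNIV)" for x
      using has_derivative_cis[OF has_derivative_ident, of x] by simp
    show "onorm (\<lambda>h. h *\<^sub>R (\<i> * cis x)) \<le> 1" for x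
      by (rule onorm_le) (simp add: norm_mult)
  qed auto
  then show ?thesis by simp
qed

text \<open>By Bezout the multiples of 2 pi p / q modulo 2 pi run through all multiples of 2 pi / q,
  so some member of the orbit of \<theta> is within one grid step of \<alpha>.\<close>

lemma coprime_rotation_dense:
  fixes p q :: int
  assumes "coprime p q" "q > 0"
  obtains j :: int where "norm (cis (\<theta> + of_int j * (2 * pi * of_int p / of_int q)) - cis \<alpha>) \<le> 2 * pi / of_int q"
proof -
  \<comment> \<open>The position of \<alpha> in grid steps counted from \<theta>. Rounding down
    gives m, and m times the Bezout coefficient u is the required multiple.\<close>
  define \<delta> where "\<delta> = (\<alpha> - \<theta>) * of_int q / (2 * pi)"
  define m where "m = \<lfloor>\<delta>\<rfloor>"
  obtain u v where uv: "u * p + v * q = 1"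
    using bezout_int[of p q] assms(1) by (auto simp: coprime_iff_gcd_eq_1)
  have mq: "m * u * p = m - m * v * q"
    using uv by (metis add_diff_cancel_right' distrib_left mult.assoc mult.right_neutral)
  have q: "real_of_int q > 0" using assms(2) by simp
  have "of_int (m * u) * (2 * pi * of_int p / of_int q) = 2 * pi * of_int (m * u * p) / of_int q" by simp
  also have "\<dots> = 2 * pi * of_int m / of_int q + 2 * pi * of_int (- (m * v))"
    unfolding mq using q by (simp add: field_simps)
  finally have "cis (\<theta> + of_int (m * u) * (2 * pi * of_int p / of_int q)) =
      cis (\<theta> + 2 * pi * of_int m / of_int q) * cis (2 * pi * of_int (- (m * v)))"
    by (simp only: cis_mult add.assoc)
  also have "cis (2 * pi * of_int (- (m * v))) = 1" by (rule cis_multiple_2pi) simp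
  finally have "norm (cis (\<theta> + of_int (m * u) * (2 * pi * of_int p / of_int q)) - cis \<alpha>) \<le>
      \<bar>\<theta> + 2 * pi * of_int m / of_int q - \<alpha>\<bar>" using norm_cis_diff_le by simp
  also have "\<theta> + 2 * pi * of_int m / of_int q - \<alpha> = 2 * pi / of_int q * (of_int m - \<delta>)"
    unfolding \<delta>_def using q by (simp add: field_simps)
  also have "\<bar>\<dots>\<bar> \<le> 2 * pi / of_int q * 1"
  proof -
    have "\<bar>of_int m - \<delta>\<bar> \<le> 1" unfolding m_def by linarith
    then show ?thesis unfolding abs_mult using q by (intro mult_mono) auto
  qed
  finally show ?thesis unfolding mult_1_right by (rule that)
qed

context otsuki_params
begin

lemma amplitude_mono:
  assumes "0 \<le> c" "c \<le> b" shows "amplitude c \<le> amplitude b"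
proof -
  have "c * b \<le> 1 * 1" using assms b by (intro mult_mono) auto
  then have "0 \<le> (b - c) * (1 - c * b)" using assms by (intro mult_nonneg_nonneg) auto
  then have "c * (1 + b\<^sup>2) \<le> b * (1 + c\<^sup>2)" by (simp add: algebra_simps power2_eq_square)
  then show ?thesis unfolding amplitude_def
    by (simp add: divide_le_eq pos_le_divide_eq add_pos_nonneg mult.commute)
qed

text \<open>The moduli and the phase of w can be matched exactly: t is chosen at the right level of
  the profile and v by the phase. Passing from t to t + 2 pi j keeps the level and turns z by j
  periods, so only the phase of z carries an error, scaled by |z|, which is at most a.\<close>

lemma otsuki_dense:
  fixes p :: int and q :: nat
  assumes per: "of_nat q * period a b = 2 * pi * of_int p" and cop: "coprime p (int q)" and q: "q > 0"
    and y: "y \<in> ellipsoid a" "\<bar>(cmod (fst y))\<^sup>2 / a\<^sup>2 - 1 / 2\<bar> < amplitude b"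
  shows "\<exists>x \<in> range (otsuki a b (2 * pi * of_nat q)). dist x y \<le> a * (2 * pi / of_nat q)"
proof -
  obtain z w where zw: "y = (z, w)" by fastforce
  define X where "X = (cmod z)\<^sup>2 / a\<^sup>2"
  have amp: "amplitude b > 0" using y(2) by linarith
  define t where "t = arccos ((X - 1 / 2) / amplitude b)"
  have "\<bar>(X - 1 / 2) / amplitude b\<bar> \<le> 1" using y(2) amp by (simp add: X_def zw abs_divide)
  then have "cos t = (X - 1 / 2) / amplitude b" 
    unfolding t_def by (intro cos_arccos) linarith+
  then have prof: "profile b t = X" using amp by (simp add: profile_def)
  have X: "0 < X" "X < 1" using profile_bounds[of t] prof by auto
  have Xw: "1 - X = (cmod w)\<^sup>2" using y(1) by (simp add: zw ellipsoid_def X_def)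
  have polar: "c = of_real (cmod c) * cis (Arg c)" for c
    using rcis_cmod_Arg[of c] by (simp add: rcis_def)
  have zr: "z = of_real (a * sqrt X) * cis (Arg z)"
    using polar[of z] a by (simp add: X_def real_sqrt_divide)
  have wr: "w = of_real (sqrt (1 - X)) * cis (Arg w)"
    using polar[of w] by (simp add: Xw)
  have per': "period a b = 2 * pi * of_int p / of_int (int q)" using per q by (simp add: field_simps)
  obtain j :: int where j: "norm (cis (angle a b t + of_int j * (2 * pi * of_int p / of_int (int q))) - cis (Arg z)) \<le> 2 * pi / of_int (int q)"
    using coprime_rotation_dense[OF cop, of "angle a b t" "Arg z"] q by auto
  define u where "u = (t + 2 * pi * of_int j) / (2 * pi * of_nat q)"
  have qu: "2 * pi * of_nat q * u = t + 2 * pi * of_int j" using q by (simp add: u_def)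
  have prof': "profile b (t + 2 * pi * of_int j) = X"
    unfolding prof[symmetric] profile_def by (simp add: cos_add cos_int_2pin sin_int_2pin)
  define x where "x = otsuki a b (2 * pi * of_nat q) (u, Arg w / (2 * pi))"
  have "x = (of_real (a * sqrt X) * cis (angle a b t + of_int j * period a b), of_real (sqrt (1 - X)) * cis (Arg w))"
    unfolding x_def otsuki_def rot_surface_def fst_conv snd_conv qu prof' angle_add_periods by simp
  then have "dist x y = norm (of_real (a * sqrt X) * cis (angle a b t + of_int j * period a b) - z)"
    using wr by (simp add: zw dist_Pair_Pair dist_norm)
  also have "\<dots> = norm (of_real (a * sqrt X) * (cis (angle a b t + of_int j * period a b) - cis (Arg z)))"
    by (subst (1) zr) (simp only: right_diff_distrib)
  also have "\<dots> = (a * sqrt X) * norm (cis (angle a b t + of_int j * period a b) - cis (Arg z))"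
    using a X by (simp add: norm_mult)
  also have "\<dots> \<le> (a * 1) * (2 * pi / of_nat q)"
    using j a X per' by (intro mult_mono) auto
  finally show ?thesis by (intro bexI[of _ x]) (auto simp: x_def)
qed

end

section \<open>Tori whose sweep angles have powers of two as denominators\<close>

lemma odd_between:
  fixes A B :: real
  assumes "B - A > 2"
  obtains p :: int where "odd p" "A < of_int p" "of_int p < B"
proof
  \<comment> \<open>With this m, the number 2 m + 1 is the least odd integer above A.\<close>
  define m where "m = \<lfloor>(A + 1) / 2\<rfloor>"
  have m: "of_int m \<le> (A + 1) / 2" "(A + 1) / 2 < of_int m + 1" unfolding m_def by linarith+
  show "odd (2 * m + 1)" by simp
  show "A < of_int (2 * m + 1)" using m(2) by (simp add: field_simps)
  show "of_int (2 * m + 1) < B" using assms m(1) by (simp add: field_simps)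
qed

lemma otsuki_sequence:
  assumes a: "a > 0"
  obtains b :: "nat \<Rightarrow> real" and p :: "nat \<Rightarrow> int" and N :: nat and b0 where
    "0 < b0" "\<And>n. b0 \<le> b n" "\<And>n. b n < 1" "\<And>n. odd (p n)"
    "\<And>n. of_nat (2 ^ (n + N)) * period a (b n) = 2 * pi * of_int (p n)"
proof -
  have "a < sqrt (a\<^sup>2 + 1)" by (rule real_less_rsqrt) simp
  then have P0: "period a 0 > pi" unfolding period_zero[OF a] using a by (simp add: field_simps)
  obtain b1 where b1: "0 < b1" "b1 < 1" "period a b1 < period a 0" using period_small[OF a P0] by blast
  \<comment> \<open>The middle third of the attained interval. Staying below \<open>hi\<close> keeps
    the parameter away from the Clifford torus: by continuity at 0 it is at least some d > 0, which
    becomes \<open>b0\<close>. \<open>N\<close> makes room for an odd numerator at every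
    denominator.\<close>
  define lo where "lo = (2 * period a b1 + period a 0) / 3"
  define hi where "hi = (period a b1 + 2 * period a 0) / 3"
  have lh: "period a b1 < lo" "lo < hi" "hi < period a 0" using b1(3) by (auto simp: lo_def hi_def)
  have "\<exists>d>0. \<forall>b\<in>{0..<1}. dist b 0 < d \<longrightarrow> dist (period a b) (period a 0) < period a 0 - hi"
    by (rule continuous_period[OF a, unfolded continuous_on_iff, rule_format]) (use lh in auto)
  then obtain d where d0: "d > 0"
    "\<And>b. b \<in> {0..<1} \<Longrightarrow> dist b 0 < d \<Longrightarrow> dist (period a b) (period a 0) < period a 0 - hi" by blast
  have d: "d > 0" "\<And>b. b \<in> {0..<1} \<Longrightarrow> b < d \<Longrightarrow> period a b > hi"
    using d0 by (auto simp: dist_real_def abs_less_iff)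
  obtain N where N: "(hi - lo) / (2 * pi) * 2 ^ N > 2"
  proof -
    define c where "c = (hi - lo) / (2 * pi)"
    have pos: "c > 0" using lh by (simp add: c_def)
    obtain N where "2 / c < 2 ^ N" using real_arch_pow[of 2] by auto
    then have "c * 2 ^ N > 2" using pos by (simp add: pos_divide_less_eq mult.commute)
    then show ?thesis unfolding c_def by (rule that)
  qed
  have "\<exists>p b. odd p \<and> d \<le> b \<and> b < 1 \<and> of_nat (2 ^ (n + N)) * period a b = 2 * pi * of_int p" for n
  proof -
    define Q :: real where "Q = 2 ^ (n + N)"
    have Q: "Q > 0" "Q \<ge> 2 ^ N" by (auto simp: Q_def intro: power_increasing)
    have "(hi - lo) / (2 * pi) * 2 ^ N \<le> (hi - lo) / (2 * pi) * Q"
      using lh Q by (intro mult_left_mono) auto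
    then have "hi * Q / (2 * pi) - lo * Q / (2 * pi) > 2"
      using N by (simp add: algebra_simps diff_divide_distrib)
    then obtain p where p: "odd p" "lo * Q / (2 * pi) < of_int p" "of_int p < hi * Q / (2 * pi)"
      using odd_between by blast
    define y where "y = 2 * pi * of_int p / Q"
    have y: "lo < y" "y < hi" using p(2,3) Q(1) by (auto simp: y_def field_simps)
    obtain b where b: "0 < b" "b < b1" "period a b = y"
      using period_attains[OF a b1(1,2), of y] y lh by auto
    have "d \<le> b" using d(2)[of b] b b1 y by force
    then show ?thesis using p(1) b b1 Q(1) by (intro exI[of _ p] exI[of _ b]) (simp add: y_def Q_def)
  qed
  then obtain p b where "\<And>n. odd (p n) \<and> d \<le> b n \<and> b n < 1 \<and>
      of_nat (2 ^ (n + N)) * period a (b n) = 2 * pi * of_int (p n)" by metis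
  then show ?thesis using that[of d b p N] d(1) by blast
qed

theorem mainTheorem2:
  "\<exists>E :: real set. E \<subseteq> {1 / sqrt 3 <..} \<and> finite E \<and> card E \<le> 1 \<and>
     (\<forall>a \<in> {0<..} - E. \<exists>T :: (real \<times> real \<Rightarrow> complex \<times> complex) set.
        infinite T \<and>
        (\<forall>f\<in>T. minimal_torus a f \<and> S1_invariant (range f)) \<and>
        pairwise (\<lambda>f g. \<not> congruent_in_ellipsoid a (range f) (range g)) T \<and>
        (a < 1 / sqrt 3 \<longrightarrow>
           (\<exists>f\<in>T. embedded_torus a f \<and>
              \<not> congruent_in_ellipsoid a (range f) (clifford_torus a))))"
proof (intro exI[of _ "{} :: real set"] conjI ballI)
  fix a :: real assume "a \<in> {0<..} - {}"
  then have a: "a > 0" by simp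
  let ?cong = "congruent_in_ellipsoid a"
  obtain b :: "nat \<Rightarrow> real" and p :: "nat \<Rightarrow> int" and N :: nat and b0 where
    b0: "0 < b0" and b: "\<And>n. b0 \<le> b n" "\<And>n. b n < 1" and p: "\<And>n. odd (p n)"
    and per: "\<And>n. of_nat (2 ^ (n + N)) * period a (b n) = 2 * pi * of_int (p n)"
    by (rule otsuki_sequence[OF a]) (rule that, assumption+)
  define f where "f n = otsuki a (b n) (2 * pi * of_nat (2 ^ (n + N)))" for n
  have P: "otsuki_params a (b n)" for n
    by unfold_locales (use a b0 b[of n] in auto)
  have fE: "range (f n) \<subseteq> ellipsoid a" for n
    unfolding f_def using otsuki_params.otsuki_in_ellipsoid[OF P] by auto
  have min: "minimal_torus a (f n)" "S1_invariant (range (f n))" for n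
    unfolding f_def using otsuki_params.otsuki_minimal[OF P _ per] otsuki_params.otsuki_S1_invariant[OF P]
    by simp_all
  \<comment> \<open>A point of the Clifford torus: its level x = 1/2 is the centre of every
    oscillation, so all tori of the sequence sweep a neighbourhood of it.\<close>
  define p0 :: "complex \<times> complex" where "p0 = (of_real (a / sqrt 2), of_real (1 / sqrt 2))"
  have p0: "p0 \<in> ellipsoid a" "(cmod (fst p0))\<^sup>2 / a\<^sup>2 = 1 / 2"
    using a by (auto simp: p0_def ellipsoid_def power_divide norm_divide)
  have k0: "amplitude b0 > 0" using b0 by (simp add: amplitude_def add_pos_nonneg)
  obtain r where r: "r > 0" "\<And>y. dist y p0 < r \<Longrightarrow> \<bar>(cmod (fst y))\<^sup>2 / a\<^sup>2 - 1 / 2\<bar> < amplitude b0"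
  proof -
    have "isCont (\<lambda>y :: complex \<times> complex. (cmod (fst y))\<^sup>2 / a\<^sup>2) p0"
      using a by (intro continuous_intros) auto
    then show ?thesis using that k0 p0(2) unfolding continuous_at_eps_delta dist_real_def by metis
  qed
  have dense: "eventually (\<lambda>n. \<forall>y\<in>ball p0 r \<inter> ellipsoid a. \<exists>x\<in>range (f n). dist x y < \<epsilon>) sequentially"
    if \<epsilon>: "\<epsilon> > 0" for \<epsilon>
  proof -
    have "(\<lambda>n. (a * (2 * pi) / 2 ^ N) * (1 / 2) ^ n) \<longlonglongrightarrow> (a * (2 * pi) / 2 ^ N) * 0"
      by (intro tendsto_mult tendsto_const LIMSEQ_power_zero) simp
    then have "eventually (\<lambda>n. (a * (2 * pi) / 2 ^ N) * (1 / 2) ^ n < \<epsilon>) sequentially"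
      using \<epsilon> by (intro order_tendstoD(2)) auto
    then show ?thesis
    proof (rule eventually_mono, intro ballI)
      fix n y assume n: "(a * (2 * pi) / 2 ^ N) * (1 / 2) ^ n < \<epsilon>" and y: "y \<in> ball p0 r \<inter> ellipsoid a"
      have 1: "\<bar>(cmod (fst y))\<^sup>2 / a\<^sup>2 - 1 / 2\<bar> < amplitude (b n)"
        using r(2)[of y] y otsuki_params.amplitude_mono[OF P less_imp_le[OF b0] b(1)[of n]]
        by (simp add: dist_commute)
      have 2: "coprime (p n) (int (2 ^ (n + N)))" using p by simp
      have 3: "y \<in> ellipsoid a" using y by simp
      obtain x where "x \<in> range (f n)" "dist x y \<le> a * (2 * pi / of_nat (2 ^ (n + N)))"
        using otsuki_params.otsuki_dense[OF P per 2 zero_less_power[OF zero_less_numeral] 3 1]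
        unfolding f_def by blast
      moreover have "a * (2 * pi / of_nat (2 ^ (n + N))) = (a * (2 * pi) / 2 ^ N) * (1 / 2) ^ n"
        by (simp add: power_add power_divide field_simps)
      ultimately show "\<exists>x\<in>range (f n). dist x y < \<epsilon>" using n by (metis order_le_less_trans)
    qed
  qed
  \<comment> \<open>Formulated for an arbitrary closed torus of the family, since it is applied both
    to the members of the sequence and to the embedded torus.\<close>
  have fin: "finite {n. ?cong (range (f n)) (range (otsuki a c (2 * pi * of_nat q)))}"
    if "otsuki_params a c" "of_nat q * period a c = 2 * pi * of_int m" for c q m
  proof -
    interpret otsuki_params a c by (rule that(1))
    show ?thesis
      by (rule finite_congruent_dense[OF a fE otsuki_closed[OF that(2)] _ otsuki_no_interior p0(1) r(1) dense])
        (use otsuki_in_ellipsoid in auto)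
  qed
  have "symp (\<lambda>m n. ?cong (range (f m)) (range (f n)))"
    by (rule sympI) (rule congruent_in_ellipsoid_sym[OF _ fE])
  moreover have "finite {n. ?cong (range (f n)) (range (f m))}" for m
    unfolding f_def[of m] by (rule fin[OF P per])
  ultimately obtain H where H: "infinite H"
    "\<And>m n. m \<in> H \<Longrightarrow> n \<in> H \<Longrightarrow> m \<noteq> n \<Longrightarrow> \<not> ?cong (range (f m)) (range (f n))"
    by (rule Ramsey_finite_classes) blast
  have inj: "inj_on f H"
    by (rule inj_onI) (metis H(2) congruent_in_ellipsoid_refl)
  show "\<exists>T :: (real \<times> real \<Rightarrow> complex \<times> complex) set.
        infinite T \<and> (\<forall>f\<in>T. minimal_torus a f \<and> S1_invariant (range f)) \<and>
        pairwise (\<lambda>f g. \<not> ?cong (range f) (range g)) T \<and>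
        (a < 1 / sqrt 3 \<longrightarrow> (\<exists>f\<in>T. embedded_torus a f \<and> \<not> ?cong (range f) (clifford_torus a)))"
  proof (cases "a < 1 / sqrt 3")
    case False
    show ?thesis
    proof (intro exI[of _ "f ` H"] conjI impI ballI)
      show "infinite (f ` H)" using H(1) inj by (simp add: finite_image_iff)
      show "pairwise (\<lambda>f g. \<not> ?cong (range f) (range g)) (f ` H)"
        using H(2) by (auto simp: pairwise_def)
    qed (use False min in auto)
  next
    case True
    have "a\<^sup>2 < (1 / sqrt 3)\<^sup>2" using True a by (intro power_strict_mono) auto
    \<comment> \<open>Equivalent to 3 a^2 < 1; it says that the Clifford value of the sweep angle
      exceeds 2 pi.\<close>
    then have "(2 * a)\<^sup>2 < a\<^sup>2 + 1" by (simp add: power_divide power_mult_distrib)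
    then have "2 * a < sqrt (a\<^sup>2 + 1)" by (rule real_less_rsqrt)
    then have P0: "2 * pi < period a 0" unfolding period_zero[OF a] using a by (simp add: field_simps)
    obtain b1 where b1: "0 < b1" "b1 < 1" "period a b1 < 2 * pi" using period_small[OF a, of "2 * pi"] by auto
    obtain c where c: "0 < c" "c < b1" "period a c = 2 * pi"
      using period_attains[OF a b1 P0] by blast
    interpret C: otsuki_params a c by unfold_locales (use a c b1 in auto)
    define g where "g = otsuki a c (2 * pi)"
    have gper: "of_nat 1 * period a c = 2 * pi * of_int 1" using c by simp
    have g1: "g = otsuki a c (2 * pi * of_nat 1)" by (simp add: g_def)
    have gE: "range g \<subseteq> ellipsoid a" using C.otsuki_in_ellipsoid by (auto simp: g_def)
    \<comment> \<open>The indices whose tori are congruent to the embedded one; removing them leaves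
      an infinite family to which it can be added.\<close>
    define K where "K = {n. ?cong (range (f n)) (range g)}"
    have K: "finite K" unfolding K_def g1 by (rule fin[OF C.otsuki_params_axioms gper])
    show ?thesis
    proof (intro exI[of _ "insert g (f ` (H - K))"] conjI impI)
      have "infinite (H - K)" using H(1) K by simp
      moreover have "inj_on f (H - K)" using inj by (rule inj_on_subset) auto
      ultimately show "infinite (insert g (f ` (H - K)))" by (simp add: finite_image_iff)
      show "\<forall>f\<in>insert g (f ` (H - K)). minimal_torus a f \<and> S1_invariant (range f)"
        using min C.otsuki_minimal[OF _ gper] C.otsuki_S1_invariant by (auto simp: g_def)
      show "pairwise (\<lambda>f g. \<not> ?cong (range f) (range g)) (insert g (f ` (H - K)))"
        using H(2) congruent_in_ellipsoid_sym[OF _ gE] by (auto simp: pairwise_def K_def)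
      show "\<exists>f\<in>insert g (f ` (H - K)). embedded_torus a f \<and> \<not> ?cong (range f) (clifford_torus a)"
        using C.otsuki_embedded[OF c(3)] C.otsuki_not_clifford[OF c(1,3)] by (auto simp: g_def)
    qed
  qed
qed auto

end
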